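(* Suppose that for all integers $1 \le s \le t$ the function $R_{s,t}$ (defined in the context) satisfies $$R_{s,t}(z_1,\ldots,z_{s+t-1}) = R_{s,t}(z_1^{-1},\ldots,z_{s+t-1}^{-1}).$$ Then for all integers $n \ge 1$ and all $i=1,\ldots,n$, $$B_{n,i}= \frac{\binom{2n+i-2}{2n-1} \binom{4n-i-1}{2n-1}}{\binom{4n-2}{2n-1}} \prod_{j=1}^{n-1} \frac{(3j-1)(2j-1)!(6j-3)!}{(4j-2)!(4j-1)!}.$$
   Context: An alternating sign matrix (ASM) is a square matrix with entries in $\{0,1,-1\}$ such that in each row and each column the non-zero entries alternate in sign and sum to $1$. A vertically symmetric alternating sign matrix (VSASM) is an ASM invariant under reflection in the vertical symmetry axis. VSASMs exist only for odd dimensions; for $(2n+1)\times(2n+1)$ VSASMs, the second row contains precisely two $1$s and one $-1$ (the latter in the middle column). $B_{n,i}$ denotes the number of $(2n+1)\times(2n+1)$ VSASMs in which the first (leftmost) $1$ in the second row is in column $i$. For a function $p$ in $n$ variables, $\mathbf{Sym}\, p(x_1,\ldots,x_n) := \sum_{\sigma \in \mathcal{S}_n} p(x_{\sigma(1)},\ldots,x_{\sigma(n)})$ (unnormalized symmetrizer). Define the rational function $$P_{s,t}(z_1,\ldots,z_{s+t-1}):= \prod_{i=1}^{s} z_i^{2s-2i-t+1} (1-z_i^{-1})^{i-1} \prod_{i=s+1}^{s+t-1} z_i^{2i-2s-t} (1-z_i^{-1})^s \prod_{1 \le p < q \le s+t-1} \frac{1 - z_p + z_p z_q}{z_q - z_p}$$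 and $R_{s,t}(z_1,\ldots,z_{s+t-1}) := \mathbf{Sym}\, P_{s,t}(z_1,\ldots,z_{s+t-1})$, where the symmetrizer runs over $\mathcal{S}_{s+t-1}$. *)

theory Defs
  imports
    Complex_Main
    "HOL-Combinatorics.Permutations"
    "Jordan_Normal_Form.Matrix"
begin

definition alternating_sign_vec :: "int vec \<Rightarrow> bool" where
  "alternating_sign_vec v \<longleftrightarrow>
     (\<forall>a b. a < b \<and> b < dim_vec v \<and> v $ a \<noteq> 0 \<and> v $ b \<noteq> 0 \<and> (\<forall>c. a < c \<and> c < b \<longrightarrow> v $ c = 0)
        \<longrightarrow> sgn (v $ b) = - sgn (v $ a)) \<and>
     (\<Sum>a<dim_vec v. v $ a) = 1"

definition is_ASM :: "int mat \<Rightarrow> bool" where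
  "is_ASM A \<longleftrightarrow>
     square_mat A \<and> elements_mat A \<subseteq> {0, 1, -1} \<and>
     (\<forall>r<dim_row A. alternating_sign_vec (row A r)) \<and>
     (\<forall>c<dim_col A. alternating_sign_vec (col A c))"

definition is_VSASM :: "int mat \<Rightarrow> bool" where
  "is_VSASM A \<longleftrightarrow>
     is_ASM A \<and>
     (\<forall>r<dim_row A. \<forall>c<dim_col A. A $$ (r, dim_col A - 1 - c) = A $$ (r, c))"

text \<open>Matrix indices start at 0: the second row has index 1, and column number \<open>i\<close> (counted
  from 1) has index \<open>c\<close> with \<open>i = Suc c\<close>.\<close>

definition B_VSASM :: "nat \<Rightarrow> nat \<Rightarrow> nat" where
  "B_VSASM n i = card {A \<in> carrier_mat (2 * n + 1) (2 * n + 1). is_VSASM A \<and>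
     (\<exists>c<2 * n + 1. i = Suc c \<and> A $$ (1, c) = 1 \<and> (\<forall>d<c. A $$ (1, d) \<noteq> 1))}"

text \<open>A function in the \<open>m\<close> variables \<open>z\<^sub>1, \<dots>, z\<^sub>m\<close> is a function of \<open>z :: nat \<Rightarrow> 'a\<close> that
  depends only on \<open>z 1, \<dots>, z m\<close>.\<close>

definition Sym :: "nat \<Rightarrow> ((nat \<Rightarrow> 'a) \<Rightarrow> 'a) \<Rightarrow> (nat \<Rightarrow> 'a) \<Rightarrow> 'a::comm_monoid_add" where
  "Sym m p x = (\<Sum>\<sigma> | \<sigma> permutes {1..m}. p (\<lambda>k. x (\<sigma> k)))"

definition P :: "nat \<Rightarrow> nat \<Rightarrow> (nat \<Rightarrow> 'a::field) \<Rightarrow> 'a" where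
  "P s t z =
     (\<Prod>i = 1..s. z i powi (2 * int s - 2 * int i - int t + 1) * (1 - inverse (z i)) ^ (i - 1)) *
     (\<Prod>i = s + 1..s + t - 1. z i powi (2 * int i - 2 * int s - int t) * (1 - inverse (z i)) ^ s) *
     (\<Prod>(p, q) | 1 \<le> p \<and> p < q \<and> q \<le> s + t - 1. (1 - z p + z p * z q) / (z q - z p))"

definition R :: "nat \<Rightarrow> nat \<Rightarrow> (nat \<Rightarrow> 'a::field) \<Rightarrow> 'a" where
  "R s t z = Sym (s + t - 1) (P s t) z"

text \<open>The points at which no denominator of \<open>R s t\<close>, as a rational function, vanishes as written.
  Together with \<open>z\<close>, the point of the inverses also lies in this domain. Since two rational
  functions over the complex numbers are equal iff they agree on the common domain of their
  defining expressions, identities between rational functions are stated pointwise on it.\<close>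

definition R_domain :: "nat \<Rightarrow> nat \<Rightarrow> (nat \<Rightarrow> 'a::field) set" where
  "R_domain s t = {z. (\<forall>k\<in>{1..s + t - 1}. z k \<noteq> 0) \<and> inj_on z {1..s + t - 1}}"

end

theory Submission
  imports
    Defs
    "HOL-Combinatorics.Multiset_Permutations"
    "HOL-Computational_Algebra.Polynomial"
    "HOL-Computational_Algebra.Formal_Power_Series"
begin

text \<open>
  The partial row sums of the left half of a VSASM of order \<open>2n+1\<close> form a monotone triangle with
  bottom row \<open>1, 3, \<dots>, 2n-1\<close>, and \<open>B\<^sub>n\<^sub>,\<^sub>i\<close> counts the triangles whose leftmost diagonal contains
  exactly \<open>n-i+1\<close> entries \<open>1\<close>.  The number of monotone triangles with bottom row \<open>k\<close> is the value at
  \<open>z = (1, \<dots>, 1)\<close> of the symmetrization of \<open>\<Prod> z\<^sub>i\<^bsup>k i\<^esup> \<Prod> (1 - z\<^sub>p + z\<^sub>p z\<^sub>q) / (z\<^sub>q - z\<^sub>p)\<close>, because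
  setting one variable to \<open>1\<close> produces the sum over interlacing rows.  The expression is singular
  there, so the limit along \<open>(1, q, \<dots>, q\<^bsup>n-1\<^esup>)\<close>, \<open>q \<rightarrow> 1\<close>, is taken.

  As a function of its first bottom entry the count is a polynomial \<open>f\<close> whose Newton coefficients
  are \<open>\<plusminus> B\<^sub>n\<^sub>,\<^sub>i\<close>.  One more variable \<open>z\<^sub>0\<^bsup>k\<^esup>\<close> in front of \<open>P\<^sub>n\<^sub>,\<^sub>n\<close> gives an \<open>n\<close>-fold antidifference \<open>F\<close>
  of \<open>f\<close>, of degree \<open>2n-1\<close>.  Its intermediate differences vanish at prescribed points, which makes
  its Newton coefficients the palindrome \<open>B\<^sub>n\<^sub>,\<^sub>1, \<dots>, B\<^sub>n\<^sub>,\<^sub>n, B\<^sub>n\<^sub>,\<^sub>n, \<dots>, B\<^sub>n\<^sub>,\<^sub>1\<close>, and \<open>R\<^sub>n\<^sub>,\<^sub>n(z) = R\<^sub>n\<^sub>,\<^sub>n(z\<^bsup>-1\<^esup>)\<close>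
  becomes \<open>F(x) = -F(4n-2-x)\<close>.  The palindrome and this reflection act on the array of all iterated
  differences and antidifferences of \<open>F\<close> and generate a group \<open>S\<^sub>3\<close>; together they force the
  \<open>(2n-1)\<close>-st antidifference, of degree \<open>4n-2\<close>, to vanish at \<open>0, \<dots>, 2n-2\<close> and \<open>4n-1, \<dots>, 6n-3\<close>.  So
  it is known up to a factor, which follows from \<open>B\<^sub>n\<^sub>,\<^sub>1 = \<Sum>\<^sub>i B\<^sub>n\<^sub>-\<^sub>1\<^sub>,\<^sub>i\<close>.
\<close>

section \<open>Symmetrized sums over orderings of a finite set\<close>

text \<open>Values on finite sets of distinct non-zero points fit the pointwise hypothesis on
  \<open>R\<close>; the price is that the point with all coordinates 1 is reached only as a limit.
  Geometric progressions serve because two operations stay within them up to scaling: removing 1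
  from \<open>1, q, .., q^n\<close>, and inverting all points. Scaling multiplies a symmetrized
  monomial by a power of \<open>q\<close> with fixed exponent, which tends to 1 and so is invisible
  in the limit.

  The factors \<open>1 - 1/z\<close> of \<open>P\<close> vanish at 1 and cancel against the
  \<open>z / (z - 1)\<close> that a 1 inserted to the left of \<open>z\<close> produces. So 1 can
  stand only before or right behind the additional variable, which gives both the antidifference
  property and one known zero of each antidifference.

  The hypothesis is about the variables of \<open>P\<close> without the additional one. Uncoupling
  that variable costs the operator \<open>1 - E + E^2\<close>, \<open>E\<close> being the shift of
  \<open>k\<close>; it is injective on polynomials in \<open>k\<close>, although not on all
  functions.

  The reflection passes to differences for free, but to antidifferences only up to a constant; the
  palindrome supplies these constants.\<close>

fun vdm_prod :: "'a::comm_ring_1 list \<Rightarrow> 'a" where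
  "vdm_prod [] = 1"
| "vdm_prod (x # xs) = (\<Prod>y\<leftarrow>xs. y - x) * vdm_prod xs"

fun weight :: "('a \<Rightarrow> 'a \<Rightarrow> 'a) \<Rightarrow> 'a::comm_ring_1 list \<Rightarrow> 'a" where
  "weight \<omega> [] = 1"
| "weight \<omega> (x # xs) = (\<Prod>y\<leftarrow>xs. \<omega> x y) * weight \<omega> xs"

fun evals :: "('a \<Rightarrow> 'a) list \<Rightarrow> 'a::comm_ring_1 list \<Rightarrow> 'a" where
  "evals (g # gs) (x # xs) = g x * evals gs xs"
| "evals _ _ = 1"

abbreviation zpow :: "int \<Rightarrow> 'a::field \<Rightarrow> 'a" where "zpow k \<equiv> (\<lambda>x. x powi k)"

abbreviation lmono :: "int list \<Rightarrow> 'a::field list \<Rightarrow> 'a" where "lmono ks \<equiv> evals (map zpow ks)"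

text \<open>For \<open>p = lmono ks\<close> with increasing \<open>ks\<close> this is a quotient of
  alternants: a Schur function up to a power of the product of the variables.\<close>

definition symsum :: "'a::field set \<Rightarrow> ('a list \<Rightarrow> 'a) \<Rightarrow> 'a" where
  "symsum Z p = (\<Sum>xs\<in>permutations_of_set Z. p xs / vdm_prod xs)"

lemma prod_list_perm:
  assumes "xs \<in> permutations_of_set Z"
  shows "(\<Prod>y\<leftarrow>xs. f y) = (\<Prod>y\<in>Z. f y)"
  using assms by (auto simp: permutations_of_set_def prod.distinct_set_conv_list)

lemma sum_perm_Cons:
  assumes "finite Z" "Z \<noteq> {}"
  shows "(\<Sum>xs\<in>permutations_of_set Z. F xs) = (\<Sum>x\<in>Z. \<Sum>ys\<in>permutations_of_set (Z - {x}). F (x # ys))"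
proof -
  have "(\<Sum>xs\<in>permutations_of_set Z. F xs) = (\<Sum>x\<in>Z. \<Sum>xs\<in>(#) x ` permutations_of_set (Z - {x}). F xs)"
    unfolding permutations_of_set_nonempty[OF assms(2)]
    by (rule sum.UNION_disjoint) (use assms in auto)
  also have "\<dots> = (\<Sum>x\<in>Z. \<Sum>ys\<in>permutations_of_set (Z - {x}). F (x # ys))"
    by (rule sum.cong[OF refl], subst sum.reindex) (auto simp: inj_on_def)
  finally show ?thesis .
qed

lemma symsum_Cons:
  assumes "finite Z" "Z \<noteq> {}"
  shows "symsum Z p = (\<Sum>x\<in>Z. symsum (Z - {x}) (\<lambda>ys. p (x # ys)) / (\<Prod>y\<in>Z - {x}. y - x))"
  unfolding symsum_def sum_perm_Cons[OF assms]
  by (intro sum.cong refl) (auto simp: sum_divide_distrib prod_list_perm intro!: sum.cong)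

lemma symsum_cong:
  assumes "\<And>xs. set xs = Z \<Longrightarrow> distinct xs \<Longrightarrow> length xs = card Z \<Longrightarrow> p xs = p' xs"
  shows "symsum Z p = symsum Z p'"
  unfolding symsum_def
  by (intro sum.cong refl) (use assms length_finite_permutations_of_set in \<open>auto simp: permutations_of_set_def distinct_card\<close>)

lemma symsum_add: "symsum Z (\<lambda>xs. p xs + p' xs) = symsum Z p + symsum Z p'"
  by (simp add: symsum_def add_divide_distrib sum.distrib)

lemma symsum_diff: "symsum Z (\<lambda>xs. p xs - p' xs) = symsum Z p - symsum Z p'"
  by (simp add: symsum_def diff_divide_distrib sum_subtractf)

lemma symsum_cmult: "symsum Z (\<lambda>xs. c * p xs) = c * symsum Z p"
  by (simp add: symsum_def sum_distrib_left)

lemma symsum_sum: "symsum Z (\<lambda>xs. \<Sum>i\<in>I. p i xs) = (\<Sum>i\<in>I. symsum Z (p i))"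
  unfolding symsum_def sum_divide_distrib by (rule sum.swap)

lemma symsum_zero: "symsum Z (\<lambda>xs. 0) = 0"
  by (simp add: symsum_def)

section \<open>Inserting a new point into an ordering\<close>

fun insertions :: "'a \<Rightarrow> 'a list \<Rightarrow> 'a list list" where
  "insertions a [] = [[a]]"
| "insertions a (y # ys) = (a # y # ys) # map ((#) y) (insertions a ys)"

lemma sum_perm_insert:
  assumes "finite Z" "a \<notin> Z"
  shows "(\<Sum>xs\<in>permutations_of_set (insert a Z). F xs :: 'b::comm_monoid_add) =
    (\<Sum>ys\<in>permutations_of_set Z. \<Sum>xs\<leftarrow>insertions a ys. F xs)"
  using assms
proof (induction Z arbitrary: F rule: finite_psubset_induct)
  case (psubset Z)
  show ?case
  proof (cases "Z = {}")
    case False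
    have [simp]: "insert a Z - {a} = Z" using psubset.prems by auto
    have "(\<Sum>xs\<in>permutations_of_set (insert a Z). F xs) =
      (\<Sum>ys\<in>permutations_of_set Z. F (a # ys)) +
      (\<Sum>x\<in>Z. \<Sum>ys\<in>permutations_of_set (insert a Z - {x}). F (x # ys))"
      using psubset by (subst sum_perm_Cons) auto
    also have "(\<Sum>x\<in>Z. \<Sum>ys\<in>permutations_of_set (insert a Z - {x}). F (x # ys)) =
      (\<Sum>x\<in>Z. \<Sum>ys\<in>permutations_of_set (Z - {x}). \<Sum>xs\<leftarrow>insertions a ys. F (x # xs))"
    proof (rule sum.cong[OF refl])
      fix x assume "x \<in> Z"
      then have "insert a Z - {x} = insert a (Z - {x})" using psubset.prems by auto
      then show "(\<Sum>ys\<in>permutations_of_set (insert a Z - {x}). F (x # ys)) =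
         (\<Sum>ys\<in>permutations_of_set (Z - {x}). \<Sum>xs\<leftarrow>insertions a ys. F (x # xs))"
        using psubset.IH[of "Z - {x}" "\<lambda>xs. F (x # xs)"] \<open>x \<in> Z\<close> psubset.prems by auto
    qed
    also have "(\<Sum>ys\<in>permutations_of_set Z. F (a # ys)) + \<dots> =
      (\<Sum>ys\<in>permutations_of_set Z. \<Sum>xs\<leftarrow>insertions a ys. F xs)"
      using False psubset.hyps
      by (simp add: sum_perm_Cons sum.distrib comp_def)
    finally show ?thesis .
  qed simp
qed

lemma prod_list_insertions: "xs \<in> set (insertions a ys) \<Longrightarrow> (\<Prod>x\<leftarrow>xs. f x) = f a * (\<Prod>x\<leftarrow>ys. f x :: 'b::comm_monoid_mult)"
  by (induction ys arbitrary: xs) (auto simp: mult_ac)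

text \<open>The orderings of \<open>insert 1 Z\<close> arise from those of \<open>Z\<close> by inserting \<open>1\<close> at some position;
  \<open>branching\<close> is the resulting sum over the positions, relative to the weight of the ordering of \<open>Z\<close>.\<close>

fun branching :: "('a \<Rightarrow> 'a) \<Rightarrow> ('a \<Rightarrow> 'a) list \<Rightarrow> 'a::field list \<Rightarrow> 'a" where
  "branching u (g # gs) [] = g 1"
| "branching u (g # gs) (y # ys) = g 1 * evals (map (\<lambda>h x. h x * u x / (x - 1)) gs) (y # ys) + g y / (1 - y) * branching u gs ys"
| "branching u [] _ = 0"

lemma evals_mult_div:
  "length gs = length xs \<Longrightarrow> evals (map (\<lambda>h x. h x * u x / v x) gs) xs =
     evals gs xs * (\<Prod>x\<leftarrow>xs. u x) / (\<Prod>x\<leftarrow>xs. v x :: 'a::field)"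
proof (induction gs arbitrary: xs)
  case (Cons g gs) then show ?case by (cases xs) (auto simp: mult_ac)
qed auto

lemma sum_list_insertions:
  "(\<Sum>xs\<leftarrow>insertions a (y # ys). F xs) = F (a # y # ys) + (\<Sum>xs\<leftarrow>insertions a ys. F (y # xs))"
  by (simp add: comp_def)

text \<open>Where 1 stands behind \<open>y\<close>, the pair contributes only
  \<open>1 / (1 - y)\<close>, since \<open>\<omega> y 1 = 1\<close>; where it stands before
  \<open>y\<close>, the pair contributes \<open>\<omega> 1 y / (y - 1)\<close>, and \<open>y\<close>
  moves on to the next function of \<open>gs\<close>.\<close>

lemma branch_list:
  assumes "\<And>y. \<omega> y 1 = 1" "length gs = Suc (length ys)"
  shows "(\<Sum>xs\<leftarrow>insertions 1 ys. evals gs xs * weight \<omega> xs / vdm_prod xs) = branching (\<omega> 1) gs ys * weight \<omega> ys / (vdm_prod ys :: 'a::field)"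
  using assms(2)
proof (induction ys arbitrary: gs)
  case Nil then show ?case by (cases gs) auto
next
  case (Cons y ys)
  then obtain g gs' where gs: "gs = g # gs'" and len: "length gs' = Suc (length ys)" by (cases gs) auto
  have "(\<Sum>xs\<leftarrow>insertions 1 ys. evals gs (y # xs) * weight \<omega> (y # xs) / vdm_prod (y # xs)) =
    (\<Sum>xs\<leftarrow>insertions 1 ys. (g y * (\<Prod>x\<leftarrow>ys. \<omega> y x) / ((1 - y) * (\<Prod>x\<leftarrow>ys. x - y))) * (evals gs' xs * weight \<omega> xs / vdm_prod xs))"
    by (intro arg_cong[where f = sum_list] map_cong refl)
       (simp add: gs prod_list_insertions assms(1) mult_ac)
  also have "\<dots> = (g y * (\<Prod>x\<leftarrow>ys. \<omega> y x) / ((1 - y) * (\<Prod>x\<leftarrow>ys. x - y))) * (branching (\<omega> 1) gs' ys * weight \<omega> ys / vdm_prod ys)"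
    by (simp only: sum_list_const_mult Cons.IH[OF len])
  finally have tail: "(\<Sum>xs\<leftarrow>insertions 1 ys. evals gs (y # xs) * weight \<omega> (y # xs) / vdm_prod (y # xs)) =
    (g y / (1 - y) * branching (\<omega> 1) gs' ys) * (weight \<omega> (y # ys) / vdm_prod (y # ys))"
    by (simp add: mult_ac)
  have head: "evals gs (1 # zs) * weight \<omega> (1 # zs) / vdm_prod (1 # zs) =
      (g 1 * evals (map (\<lambda>h x. h x * \<omega> 1 x / (x - 1)) gs') zs) * (weight \<omega> zs / vdm_prod zs)"
    if "length gs' = length zs" for zs
    using that by (simp add: gs evals_mult_div)
  show ?case
    unfolding sum_list_insertions tail head[of "y # ys", unfolded length_Cons, OF len]
    by (simp only: gs branching.simps distrib_right times_divide_eq_right add_divide_distrib)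
qed

lemma branch:
  assumes "\<And>y. \<omega> y 1 = 1" "finite Z" "1 \<notin> Z" "length gs = Suc (card Z)"
  shows "symsum (insert 1 Z) (\<lambda>xs. evals gs xs * weight \<omega> xs) = symsum Z (\<lambda>ys. branching (\<omega> 1) gs ys * weight \<omega> ys)"
  unfolding symsum_def sum_perm_insert[OF assms(2,3)]
  by (intro sum.cong refl branch_list assms) (use assms(4) in \<open>simp add: length_finite_permutations_of_set\<close>)

text \<open>Terms that vanish after symmetrization, the source of cancellation being antisymmetry in the
  first two arguments (\<open>symnull_swap\<close>). The points \<open>0\<close> and \<open>1\<close> are excluded because the terms in question
  contain negative powers and denominators \<open>x - 1\<close>.\<close>

definition symnull :: "('a \<Rightarrow> 'a \<Rightarrow> 'a) \<Rightarrow> nat \<Rightarrow> ('a::field list \<Rightarrow> 'a) \<Rightarrow> bool" where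
  "symnull \<omega> n \<zeta> \<longleftrightarrow> (\<forall>Z. finite Z \<longrightarrow> card Z = n \<longrightarrow> 0 \<notin> Z \<longrightarrow> 1 \<notin> Z \<longrightarrow> symsum Z (\<lambda>ys. \<zeta> ys * weight \<omega> ys) = 0)"

lemma symnull_cong:
  assumes "symnull \<omega> n \<zeta>" "\<And>xs. length xs = n \<Longrightarrow> 0 \<notin> set xs \<Longrightarrow> 1 \<notin> set xs \<Longrightarrow> \<zeta>' xs = \<zeta> xs"
  shows "symnull \<omega> n \<zeta>'"
  unfolding symnull_def
proof (intro allI impI)
  fix Z :: "'a set" assume Z: "finite Z" "card Z = n" "0 \<notin> Z" "1 \<notin> Z"
  have "symsum Z (\<lambda>ys. \<zeta>' ys * weight \<omega> ys) = symsum Z (\<lambda>ys. \<zeta> ys * weight \<omega> ys)"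
    by (rule symsum_cong) (use Z assms(2) in auto)
  then show "symsum Z (\<lambda>ys. \<zeta>' ys * weight \<omega> ys) = 0" using assms(1) Z by (simp add: symnull_def)
qed

lemma symnull_zero: "symnull \<omega> n (\<lambda>xs. 0)"
  by (simp add: symnull_def symsum_zero)

lemma symnull_add: "symnull \<omega> n \<zeta> \<Longrightarrow> symnull \<omega> n \<zeta>' \<Longrightarrow> symnull \<omega> n (\<lambda>xs. \<zeta> xs + \<zeta>' xs)"
  by (simp add: symnull_def ring_distribs symsum_add)

text \<open>With the first entry fixed, its weight and its Vandermonde factors depend on the other
  entries only as a set and leave the sum over their orderings.\<close>

lemma symnull_Cons:
  assumes "symnull \<omega> n \<zeta>"
  shows "symnull \<omega> (Suc n) (\<lambda>xs. g (hd xs) * \<zeta> (tl xs))"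
  unfolding symnull_def
proof (intro allI impI)
  fix Z :: "'a set" assume Z: "finite Z" "card Z = Suc n" "0 \<notin> Z" "1 \<notin> Z"
  have "symsum (Z - {x}) (\<lambda>ys. g (hd (x # ys)) * \<zeta> (tl (x # ys)) * weight \<omega> (x # ys)) = 0" if "x \<in> Z" for x
  proof -
    have "symsum (Z - {x}) (\<lambda>ys. g (hd (x # ys)) * \<zeta> (tl (x # ys)) * weight \<omega> (x # ys)) =
      symsum (Z - {x}) (\<lambda>ys. (g x * (\<Prod>y\<in>Z - {x}. \<omega> x y)) * (\<zeta> ys * weight \<omega> ys))"
      by (rule symsum_cong) (auto simp: prod.distinct_set_conv_list[symmetric])
    also have "\<dots> = 0" unfolding symsum_cmult using assms Z that by (simp add: symnull_def)
    finally show ?thesis .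
  qed
  then show "symsum Z (\<lambda>ys. g (hd ys) * \<zeta> (tl ys) * weight \<omega> ys) = 0"
    using Z by (subst symsum_Cons) auto
qed

lemma symnull_swap:
  assumes "\<And>y y' ys. \<zeta> (y' # y # ys) * \<omega> y' y = \<zeta> (y # y' # ys) * \<omega> y y'"
  shows "symnull \<omega> (Suc (Suc n)) (\<zeta> :: 'a::field_char_0 list \<Rightarrow> 'a)"
  unfolding symnull_def
proof (intro allI impI)
  fix Z :: "'a set" assume Z: "finite Z" "card Z = Suc (Suc n)" "0 \<notin> Z" "1 \<notin> Z"
  define sw :: "'a list \<Rightarrow> 'a list" where "sw xs = (hd (tl xs)) # hd xs # tl (tl xs)" for xs
  let ?F = "\<lambda>xs. \<zeta> xs * weight \<omega> xs / vdm_prod xs"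
  have form: "\<exists>y y' ys. xs = y # y' # ys" if "xs \<in> permutations_of_set Z" for xs
    using length_finite_permutations_of_set[OF that] Z
    by (metis length_Suc_conv)
  have "bij_betw sw (permutations_of_set Z) (permutations_of_set Z)"
    by (rule bij_betw_byWitness[where f' = sw])
       (use form in \<open>fastforce simp: sw_def permutations_of_set_def\<close>)+
  then have "(\<Sum>xs\<in>permutations_of_set Z. ?F xs) = (\<Sum>xs\<in>permutations_of_set Z. ?F (sw xs))"
    by (rule sum.reindex_bij_betw[symmetric])
  also have "\<dots> = (\<Sum>xs\<in>permutations_of_set Z. - ?F xs)"
  proof (intro sum.cong refl)
    fix xs assume "xs \<in> permutations_of_set Z"
    with form obtain y y' ys where xs: "xs = y # y' # ys" by blast
    have "\<zeta> (y' # y # ys) * weight \<omega> (y' # y # ys) = \<zeta> (y # y' # ys) * weight \<omega> (y # y' # ys)"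
      using assms[of y' y ys] by (simp add: mult_ac)
    moreover have "vdm_prod (y' # y # ys) = - vdm_prod (y # y' # ys)"
      by (simp add: algebra_simps)
    ultimately show "?F (sw xs) = - ?F xs" by (simp add: sw_def xs del: weight.simps vdm_prod.simps)
  qed
  finally show "symsum Z (\<lambda>ys. \<zeta> ys * weight \<omega> ys) = 0"
    by (simp add: symsum_def sum_negf del: weight.simps)
qed

section \<open>The limit at the point with all coordinates 1\<close>

text \<open>\<open>cong\<close> is there because functions on lists are total: only the values on
  lists of length \<open>n\<close> without 0 matter, where negative powers make sense.\<close>

inductive laurent :: "nat \<Rightarrow> (complex list \<Rightarrow> complex) \<Rightarrow> bool" where
  mono: "length ks = n \<Longrightarrow> laurent n (lmono ks)"
| zero: "laurent n (\<lambda>xs. 0)"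
| cmult: "laurent n p \<Longrightarrow> laurent n (\<lambda>xs. c * p xs)"
| add: "laurent n p \<Longrightarrow> laurent n p' \<Longrightarrow> laurent n (\<lambda>xs. p xs + p' xs)"
| cong: "laurent n p \<Longrightarrow> (\<And>xs. length xs = n \<Longrightarrow> 0 \<notin> set xs \<Longrightarrow> p' xs = p xs) \<Longrightarrow> laurent n p'"

lemma laurent_sum: "(\<And>i. i \<in> I \<Longrightarrow> laurent n (p i)) \<Longrightarrow> laurent n (\<lambda>xs. \<Sum>i\<in>I. p i xs)"
  by (induction I rule: infinite_finite_induct) (auto intro: laurent.intros)

lemma laurent_minus: "laurent n p \<Longrightarrow> laurent n (\<lambda>xs. - p xs)"
  using laurent.cmult[of n p "-1"] by simp

lemma laurent_diff: "laurent n p \<Longrightarrow> laurent n p' \<Longrightarrow> laurent n (\<lambda>xs. p xs - p' xs)"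
  using laurent.add[OF _ laurent_minus] by simp

lemma mono_mult:
  assumes "length ks = length xs" "length ls = length xs" "0 \<notin> set xs"
  shows "lmono ks xs * lmono ls xs = lmono (map2 (+) ks ls) xs"
  using assms
proof (induction xs arbitrary: ks ls)
  case (Cons x xs)
  then obtain k ks' l ls' where "ks = k # ks'" "ls = l # ls'" by (metis length_Suc_conv)
  with Cons show ?case by (simp add: power_int_add mult_ac)
qed auto

lemma laurent_mult:
  assumes "laurent n p" "laurent n p'"
  shows "laurent n (\<lambda>xs. p xs * p' xs)"
  using assms
proof (induction rule: laurent.induct)
  case (mono ks n)
  from mono(2,1) show ?case
  proof (induction rule: laurent.induct)
    case (mono ls n)
    show ?case
      by (rule laurent.cong[OF laurent.mono[of "map2 (+) ks ls"]]) (use mono in \<open>simp_all add: mono_mult\<close>)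
  next
    case (cmult n p c)
    then have "laurent n (\<lambda>xs. c * (lmono ks xs * p xs))" by (intro laurent.cmult) auto
    then show ?case by (simp add: mult_ac)
  next
    case (add n p p')
    then show ?case by (simp add: ring_distribs laurent.add)
  next
    case (cong n p p')
    then show ?case by (auto intro: laurent.cong)
  qed (simp add: laurent.zero)
next
  case (cmult n p c)
  then have "laurent n (\<lambda>xs. c * (p xs * p' xs))" by (intro laurent.cmult) auto
  then show ?case by (simp add: mult_ac)
next
  case (add n p p')
  then show ?case by (simp add: ring_distribs laurent.add)
next
  case (cong n p p')
  then show ?case by (auto intro: laurent.cong)
qed (simp add: laurent.zero)

lemma evals_ones [simp]: "evals (replicate n (\<lambda>x. 1)) xs = 1"
proof (induction n arbitrary: xs)
  case (Suc n) then show ?case by (cases xs) auto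
qed auto

lemma laurent_const: "laurent n (\<lambda>xs. c)"
  using laurent.cmult[OF laurent.mono[of "replicate n 0" n], of c] by simp

definition laurent1 :: "(complex \<Rightarrow> complex) \<Rightarrow> bool" where
  "laurent1 g \<longleftrightarrow> laurent 1 (\<lambda>xs. g (hd xs))"

lemma laurent1_zpow: "laurent1 (zpow k)"
  unfolding laurent1_def by (rule laurent.cong[OF laurent.mono[of "[k]"]]) (auto simp: length_Suc_conv)

lemma laurent1_const: "laurent1 (\<lambda>x. c)"
  unfolding laurent1_def by (rule laurent_const)

lemma laurent1_diff: "laurent1 f \<Longrightarrow> laurent1 g \<Longrightarrow> laurent1 (\<lambda>x. f x - g x)"
  unfolding laurent1_def by (rule laurent_diff)

lemma laurent1_minus: "laurent1 f \<Longrightarrow> laurent1 (\<lambda>x. - f x)"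
  unfolding laurent1_def by (rule laurent_minus)

lemma laurent1_mult: "laurent1 f \<Longrightarrow> laurent1 g \<Longrightarrow> laurent1 (\<lambda>x. f x * g x)"
  unfolding laurent1_def by (rule laurent_mult)

lemma laurent1_sum: "(\<And>i. i \<in> I \<Longrightarrow> laurent1 (f i)) \<Longrightarrow> laurent1 (\<lambda>x. \<Sum>i\<in>I. f i x)"
  unfolding laurent1_def by (rule laurent_sum)

lemma laurent_tl: "laurent n p \<Longrightarrow> laurent (Suc n) (\<lambda>xs. p (tl xs))"
proof (induction rule: laurent.induct)
  case (mono ks n)
  show ?case
    by (rule laurent.cong[OF laurent.mono[of "0 # ks"]]) (use mono in \<open>auto simp: length_Suc_conv\<close>)
next
  case (cong n p p')
  have "p' (tl xs) = p (tl xs)" if "length xs = Suc n" "0 \<notin> set xs" for xs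
    using that cong(2)[of "tl xs"] by (cases xs) auto
  then show ?case using cong.IH by (auto intro: laurent.cong)
qed (auto intro: laurent.intros)

lemma laurent_hd:
  assumes "laurent1 g"
  shows "laurent (Suc n) (\<lambda>xs. g (hd xs))"
proof -
  have aux: "laurent (Suc n) (\<lambda>xs. p [hd xs])" if "laurent m p" "m = Suc 0" for m p
    using that
  proof (induction rule: laurent.induct)
    case (mono ks m)
    then obtain k where ks: "ks = [k]" by (auto simp: length_Suc_conv)
    show ?case
      by (rule laurent.cong[OF laurent.mono[of "k # replicate n 0"]]) (auto simp: length_Suc_conv ks)
  next
    case (cong n' p p')
    have "p' [hd xs] = p [hd xs]" if "length xs = Suc n" "0 \<notin> set xs" for xs
      using that cong(2)[of "[hd xs]"] cong.prems by (cases xs) auto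
    then show ?case using cong.IH cong.prems by (auto intro: laurent.cong)
  qed (auto intro: laurent.intros)
  show ?thesis
    using aux[OF assms[unfolded laurent1_def] One_nat_def] by simp
qed

lemma laurent_evals: "\<forall>g\<in>set gs. laurent1 g \<Longrightarrow> length gs = n \<Longrightarrow> laurent n (evals gs)"
proof (induction gs arbitrary: n)
  case Nil then show ?case by (simp add: laurent_const)
next
  case (Cons g gs)
  then obtain m where n: "n = Suc m" by auto
  have "laurent1 g" "laurent m (evals gs)" using Cons n by auto
  then have "laurent n (\<lambda>xs. g (hd xs) * evals gs (tl xs))"
    unfolding n by (intro laurent_mult laurent_hd laurent_tl)
  then show ?case
    by (rule laurent.cong) (auto simp: n length_Suc_conv)
qed

lemma laurent_lin_prod:
  "laurent (Suc n) (\<lambda>xs. \<Prod>y\<leftarrow>tl xs. a + b * hd xs + c * y + d * hd xs * y)"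
proof (induction n)
  case 0
  show ?case by (rule laurent.cong[OF laurent_const[of _ 1]]) (auto simp: length_Suc_conv)
next
  case (Suc n)
  let ?q = "\<lambda>x y::complex. a + b * x + c * y + d * x * y"
  have hd: "laurent (Suc (Suc n)) (\<lambda>xs. hd xs)" for n
    using laurent_hd[OF laurent1_zpow[of 1]] by simp
  have hd2: "laurent (Suc (Suc n)) (\<lambda>xs. hd (tl xs))"
    using laurent_tl[OF laurent_hd[OF laurent1_zpow[of 1]]] by simp
  \<comment> \<open>The product over the variables from the third on is the induction hypothesis
    with the second variable left out.\<close>
  have skip: "laurent (Suc (Suc n)) (\<lambda>xs. p (hd xs # tl (tl xs)))" if "laurent m p" "m = Suc n" for p m
    using that
  proof (induction rule: laurent.induct)
    case (mono ks m)
    then obtain k ks' where ks: "ks = k # ks'" by (auto simp: length_Suc_conv)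
    show ?case
      by (rule laurent.cong[OF laurent.mono[of "k # 0 # ks'"]]) (use mono in \<open>auto simp: length_Suc_conv ks\<close>)
  next
    case (cong n' p p')
    have "p' (hd xs # tl (tl xs)) = p (hd xs # tl (tl xs))" if "length xs = Suc (Suc n)" "0 \<notin> set xs" for xs
      using that cong(2)[of "hd xs # tl (tl xs)"] cong.prems by (auto simp: length_Suc_conv)
    then show ?case using cong.IH cong.prems by (auto intro: laurent.cong)
  qed (auto intro: laurent.intros)
  have "laurent (Suc (Suc n)) (\<lambda>xs. ?q (hd xs) (hd (tl xs)) * (\<Prod>y\<leftarrow>tl (tl xs). ?q (hd xs) y))"
    using skip[OF Suc] by (intro laurent_mult laurent.add laurent_const laurent.cmult) (use hd hd2 in auto)
  then show ?case
    by (rule laurent.cong) (auto simp: length_Suc_conv)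
qed

definition asm_wt :: "complex \<Rightarrow> complex \<Rightarrow> complex" where "asm_wt x y = 1 - x + x * y"

lemma laurent_weight_asm_wt: "laurent n (weight asm_wt)"
proof (induction n)
  case 0 show ?case by (rule laurent.cong[OF laurent_const[of _ 1]]) auto
next
  case (Suc n)
  have "(\<lambda>xs. \<Prod>y\<leftarrow>tl xs. 1 + (-1) * hd xs + 0 * y + 1 * hd xs * y) = (\<lambda>xs. \<Prod>y\<leftarrow>tl xs. asm_wt (hd xs) y)"
    by (simp add: asm_wt_def)
  then have "laurent (Suc n) (\<lambda>xs. \<Prod>y\<leftarrow>tl xs. asm_wt (hd xs) y)"
    using laurent_lin_prod[of n 1 "-1" 0 1] by simp
  from laurent_mult[OF this laurent_tl[OF Suc]] show ?case
    by (rule laurent.cong) (auto simp: length_Suc_conv)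
qed

text \<open>The sign convention makes \<open>geom_sum_eq\<close> true for all bounds, so that
  exponents need not be increasing: \<open>mono_conv\<close> treats arbitrary
  \<open>ks\<close>.\<close>

definition geom_sum :: "int \<Rightarrow> int \<Rightarrow> complex \<Rightarrow> complex" where
  "geom_sum a b x = (if a \<le> b + 1 then (\<Sum>k\<in>{a..b}. x powi k) else - (\<Sum>k\<in>{b+1..a-1}. x powi k))"

lemma geo_aux: "x \<noteq> 0 \<Longrightarrow> x \<noteq> (1::complex) \<Longrightarrow> (\<Sum>k\<in>{a..a + int n - 1}. x powi k) = (x powi (a + int n) - x powi a) / (x - 1)"
proof (induction n)
  case (Suc n)
  have "{a..a + int (Suc n) - 1} = insert (a + int n) {a..a + int n - 1}" by auto
  then show ?case using Suc by (simp add: field_simps power_int_add)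
qed simp

lemma geom_sum_eq:
  assumes x: "x \<noteq> 0" "x \<noteq> 1"
  shows "geom_sum a b x = (x powi (b + 1) - x powi a) / (x - 1)"
proof (cases "a \<le> b + 1")
  case True
  then have "a + int (nat (b + 1 - a)) = b + 1" by simp
  with geo_aux[OF x, of a "nat (b + 1 - a)"] have "(\<Sum>k\<in>{a..b}. x powi k) = (x powi (b + 1) - x powi a) / (x - 1)"
    by (simp only:) simp
  then show ?thesis using True by (simp add: geom_sum_def)
next
  case False
  then have "(b + 1) + int (nat (a - (b + 1))) = a" by simp
  with geo_aux[OF x, of "b + 1" "nat (a - (b + 1))"] have "(\<Sum>k\<in>{b + 1..a - 1}. x powi k) = (x powi a - x powi (b + 1)) / (x - 1)"
    by (simp only:)
  then show ?thesis using False by (simp add: geom_sum_def minus_divide_left)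
qed

lemma laurent1_geom_sum: "laurent1 (geom_sum a b)"
proof (cases "a \<le> b + 1")
  case True
  have "laurent1 (\<lambda>x. \<Sum>k\<in>{a..b}. x powi k)" by (intro laurent1_sum laurent1_zpow)
  moreover have "geom_sum a b = (\<lambda>x. \<Sum>k\<in>{a..b}. x powi k)" using True by (auto simp: geom_sum_def)
  ultimately show ?thesis by simp
next
  case False
  have "laurent1 (\<lambda>x. - (\<Sum>k\<in>{b+1..a-1}. x powi k))" by (intro laurent1_minus laurent1_sum laurent1_zpow)
  moreover have "geom_sum a b = (\<lambda>x. - (\<Sum>k\<in>{b+1..a-1}. x powi k))" using False by (auto simp: geom_sum_def)
  ultimately show ?thesis by simp
qed

section \<open>Geometric progressions of evaluation points\<close>

definition qpoints :: "nat \<Rightarrow> int \<Rightarrow> real \<Rightarrow> complex set" where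
  "qpoints n c q = (\<lambda>i. complex_of_real q powi (c + int i)) ` {..<n}"

lemma powi_inject: "q > 1 \<Longrightarrow> q powi a = q powi b \<longleftrightarrow> a = (b::int)" for q :: real
  by (metis linorder_neqE less_irrefl power_int_strict_increasing)

lemma of_real_powi_inject: "q > 1 \<Longrightarrow> complex_of_real q powi a = complex_of_real q powi b \<longleftrightarrow> a = b"
  by (metis powi_inject of_real_power_int of_real_eq_iff)

lemma qpoints_inj: "q > 1 \<Longrightarrow> inj_on (\<lambda>i. complex_of_real q powi (c + int i)) A"
  by (auto simp: inj_on_def of_real_powi_inject)

lemma finite_qpoints [simp]: "finite (qpoints n c q)"
  by (simp add: qpoints_def)

lemma card_qpoints [simp]: "q > 1 \<Longrightarrow> card (qpoints n c q) = n"
  unfolding qpoints_def by (subst card_image) (auto intro: qpoints_inj)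

lemma zero_notin_qpoints [simp]: "q > 1 \<Longrightarrow> 0 \<notin> qpoints n c q"
  by (auto simp: qpoints_def)

lemma qpoints_Suc: "qpoints (Suc n) 0 q = insert 1 (qpoints n 1 q)"
proof -
  have "qpoints (Suc n) 0 q = insert 1 ((\<lambda>i. complex_of_real q powi (0 + int (Suc i))) ` {..<n})"
    unfolding qpoints_def lessThan_Suc_eq_insert_0 by (simp add: image_image del: of_nat_Suc)
  also have "(\<lambda>i. complex_of_real q powi (0 + int (Suc i))) = (\<lambda>i. complex_of_real q powi (1 + int i))"
    by (intro ext arg_cong[where f = "\<lambda>k. complex_of_real q powi k"]) simp
  finally show ?thesis by (simp only: qpoints_def)
qed

lemma one_notin_qpoints [simp]: "q > 1 \<Longrightarrow> 1 \<notin> qpoints n 1 q"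
proof
  assume q: "q > 1" and "1 \<in> qpoints n 1 q"
  then obtain i where "complex_of_real q powi 0 = complex_of_real q powi (1 + int i)"
    unfolding qpoints_def by (metis (no_types, lifting) imageE power_int_0_right)
  then have "0 = 1 + int i" using of_real_powi_inject[OF q] by blast
  then show False by simp
qed

lemma qpoints_scale: "q > 1 \<Longrightarrow> qpoints n c q = (*) (complex_of_real q powi c) ` qpoints n 0 q"
  by (auto simp: qpoints_def image_image power_int_add)

lemma qpoints_inverse: "inverse ` qpoints (Suc n) 0 q = qpoints (Suc n) (- int n) q"
proof -
  have "inverse ` qpoints (Suc n) 0 q = (\<lambda>i. complex_of_real q powi (- int i)) ` {..<Suc n}"
    unfolding qpoints_def image_image by (intro image_cong refl) (simp add: power_int_minus)
  also have "{..<Suc n} = (\<lambda>i. n - i) ` {..<Suc n}"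
  proof
    show "{..<Suc n} \<subseteq> (\<lambda>i. n - i) ` {..<Suc n}"
    proof
      fix i assume "i \<in> {..<Suc n}"
      then have "i = n - (n - i)" "n - i \<in> {..<Suc n}" by auto
      then show "i \<in> (\<lambda>i. n - i) ` {..<Suc n}" by blast
    qed
  qed auto
  also have "(\<lambda>i. complex_of_real q powi (- int i)) ` \<dots> = qpoints (Suc n) (- int n) q"
    unfolding qpoints_def image_image
    by (intro image_cong refl arg_cong[where f = "\<lambda>k. complex_of_real q powi k"]) auto
  finally show ?thesis .
qed

lemma tendsto_powi_1: "((\<lambda>q. complex_of_real q powi m) \<longlongrightarrow> 1) (at_right 1)"
proof -
  have "((\<lambda>q. complex_of_real q powi m) \<longlongrightarrow> complex_of_real 1 powi m) (at_right 1)"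
    by (intro tendsto_intros) auto
  then show ?thesis by simp
qed

lemma vdm_prod_scale: "vdm_prod (map ((*) a) xs) = a ^ (length xs choose 2) * vdm_prod xs"
proof (induction xs)
  case (Cons x xs)
  have "(\<Prod>y\<leftarrow>ys. a * y - a * x) = a ^ length ys * (\<Prod>y\<leftarrow>ys. y - x)" for ys
    by (induction ys) (auto simp: algebra_simps)
  with Cons show ?case by (simp add: comp_def numeral_2_eq_2 power_add)
qed (simp add: numeral_2_eq_2)

lemma mono_scale: "length ks = length xs \<Longrightarrow> a \<noteq> 0 \<Longrightarrow> lmono ks (map ((*) a) xs) = a powi (sum_list ks) * lmono ks xs"
proof (induction xs arbitrary: ks)
  case (Cons x xs) then show ?case by (cases ks) (auto simp: power_int_mult_distrib power_int_add)
qed simp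

text \<open>The numerators are homogeneous of degree \<open>sum_list ks\<close>, the Vandermonde
  products of degree \<open>card Z choose 2\<close>.\<close>

lemma symsum_scale:
  assumes "finite Z" "a \<noteq> 0" "length ks = card Z"
  shows "symsum ((*) a ` Z) (lmono ks) = a powi (sum_list ks - int (card Z choose 2)) * symsum Z (lmono ks)"
proof -
  have inj: "inj_on ((*) a) Z" using assms by (auto simp: inj_on_def)
  have inj2: "inj_on (map ((*) a)) (permutations_of_set Z)"
    using assms by (intro inj_on_subset[OF inj_mapI]) (auto simp: inj_def)
  have "symsum ((*) a ` Z) (lmono ks) = (\<Sum>xs\<in>permutations_of_set Z. lmono ks (map ((*) a) xs) / vdm_prod (map ((*) a) xs))"
    unfolding symsum_def permutations_of_set_image_inj[OF inj] by (simp add: sum.reindex[OF inj2])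
  also have "\<dots> = (\<Sum>xs\<in>permutations_of_set Z. a powi (sum_list ks - int (card Z choose 2)) * (lmono ks xs / vdm_prod xs))"
  proof (rule sum.cong[OF refl])
    fix xs assume "xs \<in> permutations_of_set Z"
    then have "length xs = card Z" by (rule length_finite_permutations_of_set)
    then show "lmono ks (map ((*) a) xs) / vdm_prod (map ((*) a) xs) =
       a powi (sum_list ks - int (card Z choose 2)) * (lmono ks xs / vdm_prod xs)"
      using assms by (simp add: mono_scale vdm_prod_scale power_int_diff)
  qed
  finally show ?thesis by (simp add: symsum_def sum_distrib_left)
qed

abbreviation upper_prod :: "('a \<Rightarrow> 'a) \<Rightarrow> int list \<Rightarrow> 'a::field list \<Rightarrow> 'a" where
  "upper_prod u ks \<equiv> evals (map (\<lambda>h x. h x * u x / (x - 1)) (map zpow ks))"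

abbreviation one_weight :: "complex \<Rightarrow> complex \<Rightarrow> complex" where "one_weight \<equiv> \<lambda>x y. 1"

text \<open>The branching rule for the weight \<open>1\<close>, where the interlacing rows are those of
  Gelfand--Tsetlin patterns, is needed only to see that the limits exist. The sums \<open>geom_sum\<close> carry a
  sign when their bounds are in the wrong order.\<close>

definition gt_sum :: "int list \<Rightarrow> complex list \<Rightarrow> complex" where
  "gt_sum ks = evals (map2 (\<lambda>a b. geom_sum a (b - 1)) ks (tl ks))"

lemma gt_sum_simps [simp]: "gt_sum [k] xs = 1" "gt_sum (k1 # k2 # ks) (y # ys) = geom_sum k1 (k2 - 1) y * gt_sum (k2 # ks) ys"
  by (simp_all add: gt_sum_def)

text \<open>Evaluating the first geometric sum of \<open>gt_sum\<close> splits the expression in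
  two. Its lower limit gives a term in which the first two entries both carry the exponent
  \<open>k\<close>, symmetric and hence null; its upper limit combines with
  \<open>upper_prod\<close> to the same bracket, one place further on, with \<open>l\<close> for
  \<open>k\<close>.\<close>

lemma symnull_gt_sum_bracket:
  "length ks = n \<Longrightarrow> symnull one_weight (Suc n) (\<lambda>xs. zpow k (hd xs) / (hd xs - 1) * (gt_sum (k # ks) (tl xs) - upper_prod (\<lambda>x. 1) ks (tl xs)))"
proof (induction ks arbitrary: k n)
  case Nil then show ?case by (simp add: symnull_zero)
next
  case (Cons l ks)
  then obtain m where n: "n = Suc m" and m: "length ks = m" by auto
  have 1: "symnull one_weight (Suc (Suc m)) (\<lambda>xs. - (zpow k (hd xs) / (hd xs - 1) * (zpow k (hd (tl xs)) / (hd (tl xs) - 1))) *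
      gt_sum (l # ks) (tl (tl xs)))"
    by (rule symnull_swap) (simp add: mult_ac)
  have 2: "symnull one_weight (Suc (Suc m)) (\<lambda>xs. (zpow k (hd xs) / (hd xs - 1)) *
     (zpow l (hd (tl xs)) / (hd (tl xs) - 1) * (gt_sum (l # ks) (tl (tl xs)) - upper_prod (\<lambda>x. 1) ks (tl (tl xs)))))"
    by (rule symnull_Cons[OF Cons.IH[OF m]])
  show ?case unfolding n
  proof (rule symnull_cong[OF symnull_add[OF 1 2]])
    fix xs :: "complex list" assume xs: "length xs = Suc (Suc m)" "0 \<notin> set xs" "1 \<notin> set xs"
    then obtain y y' ys where ys: "xs = y # y' # ys" by (auto simp: length_Suc_conv)
    have alg: "A * ((C - B) * i' * J - C * i' * U) = - (A * (B * i')) * J + A * (C * i' * (J - U))"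
      for A B C i' J U :: complex by (simp add: algebra_simps)
    show "zpow k (hd xs) / (hd xs - 1) * (gt_sum (k # l # ks) (tl xs) - upper_prod (\<lambda>x. 1) (l # ks) (tl xs)) =
      - (zpow k (hd xs) / (hd xs - 1) * (zpow k (hd (tl xs)) / (hd (tl xs) - 1))) * gt_sum (l # ks) (tl (tl xs)) +
      zpow k (hd xs) / (hd xs - 1) * (zpow l (hd (tl xs)) / (hd (tl xs) - 1) * (gt_sum (l # ks) (tl (tl xs)) - upper_prod (\<lambda>x. 1) ks (tl (tl xs))))"
      using xs alg[of "zpow k y / (y - 1)" "zpow l y'" "zpow k y'" "inverse (y' - 1)"]
      by (simp add: ys geom_sum_eq divide_inverse)
  qed
qed

lemma inverse_one_minus: "inverse (1 - y) = - inverse (y - (1::'a::field))"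
  by (metis inverse_minus_eq minus_diff_eq)

text \<open>In the geometric sum of the first entry, the lower limit accounts for 1 being inserted
  behind that entry, which is the induction, and the upper limit for 1 in front of it; the error of
  the latter is the bracket above.\<close>

lemma symnull_gt_sum:
  "length ks = Suc n \<Longrightarrow> symnull one_weight n (\<lambda>ys. gt_sum ks ys - branching (\<lambda>x. 1) (map zpow ks) ys)"
proof (induction n arbitrary: ks)
  case 0 then show ?case by (auto simp: length_Suc_conv symnull_def symsum_def)
next
  case (Suc n)
  then obtain k l ks' where ks: "ks = k # l # ks'" by (metis length_Suc_conv)
  with Suc have len: "length ks' = n" by simp
  have 1: "symnull one_weight (Suc n) (\<lambda>xs. - (zpow k (hd xs) / (hd xs - 1)) * (gt_sum (l # ks') (tl xs) - branching (\<lambda>x. 1) (map zpow (l # ks')) (tl xs)))"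
    by (rule symnull_Cons[OF Suc.IH]) (simp add: len)
  show ?case unfolding ks
  proof (rule symnull_cong[OF symnull_add[OF 1 symnull_gt_sum_bracket[OF len, of l]]])
    fix xs :: "complex list" assume xs: "length xs = Suc n" "0 \<notin> set xs" "1 \<notin> set xs"
    then obtain y ys where ys: "xs = y # ys" by (auto simp: length_Suc_conv)
    have alg: "(L - K) * i * J - (L * i * U + K * (- i) * B) = - (K * i) * (J - B) + L * i * (J - U)"
      for L K i J U B :: complex by (simp add: algebra_simps)
    show "gt_sum (k # l # ks') xs - branching (\<lambda>x. 1) (map zpow (k # l # ks')) xs =
      - (zpow k (hd xs) / (hd xs - 1)) * (gt_sum (l # ks') (tl xs) - branching (\<lambda>x. 1) (map zpow (l # ks')) (tl xs)) +
      zpow l (hd xs) / (hd xs - 1) * (gt_sum (l # ks') (tl xs) - upper_prod (\<lambda>x. 1) ks' (tl xs))"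
      using xs alg[of "zpow l y" "zpow k y" "inverse (y - 1)"]
      by (simp add: ys geom_sum_eq divide_inverse inverse_one_minus)
  qed
qed

lemma symsum_mono_rec:
  assumes "finite Z" "card Z = n" "1 \<notin> Z" "0 \<notin> Z" "length ks = Suc n"
  shows "symsum (insert 1 Z) (lmono ks) = symsum Z (gt_sum ks)"
proof -
  have w: "weight one_weight xs = 1" for xs by (induction xs) (auto simp: map_replicate_const)
  have "symsum (insert 1 Z) (\<lambda>xs. lmono ks xs * weight one_weight xs) = symsum Z (\<lambda>ys. branching (\<lambda>x. 1) (map zpow ks) ys * weight one_weight ys)"
    using assms by (intro branch) auto
  moreover have "symsum Z (\<lambda>ys. gt_sum ks ys - branching (\<lambda>x. 1) (map zpow ks) ys) = 0"
    using symnull_gt_sum[OF assms(5)] assms by (auto simp: symnull_def w)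
  ultimately show ?thesis by (simp add: w symsum_diff)
qed

text \<open>One limit \<open>L\<close> serves all offsets \<open>c\<close>: the recursion over
  \<open>n\<close> needs the offset 1, the inversion of the points a negative one.\<close>

lemma laurent_conv_aux:
  assumes "laurent m p" "m = n"
    and "\<And>ks. length ks = n \<Longrightarrow> \<exists>L. \<forall>c. ((\<lambda>q. symsum (qpoints n c q) (lmono ks)) \<longlongrightarrow> L) (at_right 1)"
  shows "\<exists>L. \<forall>c. ((\<lambda>q. symsum (qpoints n c q) p) \<longlongrightarrow> L) (at_right 1)"
  using assms(1,2)
proof (induction rule: laurent.induct)
  case (mono ks m) then show ?case using assms(3) by blast
next
  case (zero m) then show ?case by (auto simp: symsum_zero)
next
  case (cmult m p c)
  then obtain L where "\<forall>c. ((\<lambda>q. symsum (qpoints n c q) p) \<longlongrightarrow> L) (at_right 1)" by auto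
  then show ?case unfolding symsum_cmult by (intro exI[of _ "c * L"] allI tendsto_mult_left) auto
next
  case (add m p p')
  then obtain L L' where "\<forall>c. ((\<lambda>q. symsum (qpoints n c q) p) \<longlongrightarrow> L) (at_right 1)"
     "\<forall>c. ((\<lambda>q. symsum (qpoints n c q) p') \<longlongrightarrow> L') (at_right 1)" by auto
  then show ?case unfolding symsum_add by (intro exI[of _ "L + L'"] allI tendsto_add) auto
next
  case (cong m p p')
  then obtain L where L: "\<forall>c. ((\<lambda>q. symsum (qpoints n c q) p) \<longlongrightarrow> L) (at_right 1)" by auto
  have ev': "eventually (\<lambda>q. symsum (qpoints n c q) p = symsum (qpoints n c q) p') (at_right 1)" for c
    using eventually_at_right_less[of "1::real"]
  proof eventually_elim
    case (elim q)
    then show ?case using cong(2) cong.prems zero_notin_qpoints[OF elim] by (intro symsum_cong) auto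
  qed
  have "((\<lambda>q. symsum (qpoints n c q) p') \<longlongrightarrow> L) (at_right 1)" for c
    by (rule iffD1[OF tendsto_cong[OF ev'] L[rule_format]])
  then show ?case by blast
qed

text \<open>Offset 0 contains the point 1, whose removal leaves a Laurent polynomial in one variable
  fewer at offset 1. All other offsets follow by homogeneity, at the cost of a fixed power of
  \<open>q\<close>.\<close>

lemma mono_conv:
  "length ks = n \<Longrightarrow> \<exists>L. \<forall>c. ((\<lambda>q. symsum (qpoints n c q) (lmono ks)) \<longlongrightarrow> L) (at_right 1)"
proof (induction n arbitrary: ks)
  case 0 then show ?case by (auto simp: qpoints_def)
next
  case (Suc n)
  have "laurent n (gt_sum ks)"
    unfolding gt_sum_def using Suc.prems by (intro laurent_evals) (auto simp: set_zip laurent1_geom_sum)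
  from laurent_conv_aux[OF this refl Suc.IH] obtain L where
    L: "((\<lambda>q. symsum (qpoints n 1 q) (gt_sum ks)) \<longlongrightarrow> L) (at_right 1)" by blast
  have "((\<lambda>q. symsum (qpoints (Suc n) c q) (lmono ks)) \<longlongrightarrow> L) (at_right 1)" for c
  proof -
    let ?e = "sum_list ks - int (Suc n choose 2)"
    have evals: "eventually (\<lambda>q. complex_of_real q powi (c * ?e) * symsum (qpoints n 1 q) (gt_sum ks) =
        symsum (qpoints (Suc n) c q) (lmono ks)) (at_right 1)"
      using eventually_at_right_less[of "1::real"]
    proof eventually_elim
      case (elim q)
      have "symsum (qpoints (Suc n) c q) (lmono ks) =
        ((complex_of_real q powi c)) powi ?e * symsum (qpoints (Suc n) 0 q) (lmono ks)"
        using elim Suc.prems by (subst qpoints_scale, simp, subst symsum_scale) auto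
      also have "symsum (qpoints (Suc n) 0 q) (lmono ks) = symsum (qpoints n 1 q) (gt_sum ks)"
        unfolding qpoints_Suc using elim Suc.prems by (intro symsum_mono_rec) auto
      finally show ?case by (simp add: power_int_mult)
    qed
    have "((\<lambda>q. complex_of_real q powi (c * ?e) * symsum (qpoints n 1 q) (gt_sum ks)) \<longlongrightarrow> 1 * L) (at_right 1)"
      by (intro tendsto_mult L tendsto_powi_1)
    then show ?thesis using tendsto_cong[OF evals] by simp
  qed
  then show ?case by blast
qed

text \<open>\<open>Lim\<close> is a junk value unless the limit exists, as it does for Laurent polynomials \<open>p\<close>.\<close>

definition q_limit :: "nat \<Rightarrow> (complex list \<Rightarrow> complex) \<Rightarrow> complex" where
  "q_limit n p = Lim (at_right 1) (\<lambda>q. symsum (qpoints n 0 q) p)"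

lemma q_limit_tendsto: "laurent n p \<Longrightarrow> ((\<lambda>q. symsum (qpoints n c q) p) \<longlongrightarrow> q_limit n p) (at_right 1)"
proof -
  assume "laurent n p"
  from laurent_conv_aux[OF this refl mono_conv] obtain L where
    L: "\<And>c. ((\<lambda>q. symsum (qpoints n c q) p) \<longlongrightarrow> L) (at_right 1)" by blast
  then have "q_limit n p = L" unfolding q_limit_def by (intro tendsto_Lim) auto
  with L show ?thesis by simp
qed

lemma q_limit_unique:
  assumes "laurent n p" "laurent m p'"
    and "\<And>q. q > 1 \<Longrightarrow> symsum (qpoints n c q) p = symsum (qpoints m c' q) p'"
  shows "q_limit n p = q_limit m p'"
proof -
  have "eventually (\<lambda>q. symsum (qpoints n c q) p = symsum (qpoints m c' q) p') (at_right 1)"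
    using eventually_at_right_less[of "1::real"] by eventually_elim (rule assms)
  then have "((\<lambda>q. symsum (qpoints n c q) p) \<longlongrightarrow> q_limit m p') (at_right 1)"
    by (rule iffD2[OF tendsto_cong q_limit_tendsto[OF assms(2), of c']])
  with q_limit_tendsto[OF assms(1), of c] show ?thesis
    by (intro tendsto_unique[OF trivial_limit_at_right_real]) auto
qed

lemma q_limit_cong:
  assumes "laurent n p" "\<And>xs. length xs = n \<Longrightarrow> 0 \<notin> set xs \<Longrightarrow> p' xs = p xs"
  shows "q_limit n p' = q_limit n p"
  using assms laurent.cong[OF assms(1), of p']
  by (intro q_limit_unique[where c = 0 and c' = 0] symsum_cong) auto

lemma q_limit_add:
  assumes "laurent n p" "laurent n p'"
  shows "q_limit n (\<lambda>xs. p xs + p' xs) = q_limit n p + q_limit n p'"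
  using q_limit_tendsto[OF laurent.add[OF assms], of 0] tendsto_add[OF assms[THEN q_limit_tendsto, of 0]]
  unfolding symsum_add by (intro tendsto_unique[OF trivial_limit_at_right_real]) auto

lemma q_limit_cmult:
  assumes "laurent n p"
  shows "q_limit n (\<lambda>xs. c * p xs) = c * q_limit n p"
  using q_limit_tendsto[OF laurent.cmult[OF assms], of 0 c] tendsto_mult_left[OF q_limit_tendsto[OF assms, of 0], of c]
  unfolding symsum_cmult by (intro tendsto_unique[OF trivial_limit_at_right_real]) auto

lemma q_limit_diff:
  assumes "laurent n p" "laurent n p'"
  shows "q_limit n (\<lambda>xs. p xs - p' xs) = q_limit n p - q_limit n p'"
  using q_limit_tendsto[OF laurent_diff[OF assms], of 0] tendsto_diff[OF assms[THEN q_limit_tendsto, of 0]]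
  unfolding symsum_diff by (intro tendsto_unique[OF trivial_limit_at_right_real]) auto

lemma q_limit_zero: "q_limit n (\<lambda>xs. 0) = 0"
  using q_limit_cmult[OF laurent.zero, of n 0] by simp

lemma q_limit_sum: "(\<And>i. i \<in> I \<Longrightarrow> laurent n (p i)) \<Longrightarrow> q_limit n (\<lambda>xs. \<Sum>i\<in>I. p i xs) = (\<Sum>i\<in>I. q_limit n (p i))"
  by (induction I rule: infinite_finite_induct) (simp_all add: q_limit_zero q_limit_add laurent_sum)

lemma q_limit_0: "q_limit 0 p = p []"
  unfolding q_limit_def by (intro tendsto_Lim) (auto simp: qpoints_def symsum_def)

text \<open>Two values of the weight make this work: \<open>asm_wt y 1 = 1\<close> leaves the
  entries before 1 alone, and \<open>asm_wt 1 y = y\<close> is the factor that ends up as the first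
  argument of \<open>branching\<close>.\<close>

lemma q_limit_branch:
  assumes "length gs = Suc n" "laurent (Suc n) (evals gs)" "laurent n h" "symnull asm_wt n (\<lambda>ys. h ys - branching (\<lambda>x. x) gs ys)"
  shows "q_limit (Suc n) (\<lambda>xs. evals gs xs * weight asm_wt xs) = q_limit n (\<lambda>ys. h ys * weight asm_wt ys)"
proof (rule q_limit_unique[where c = 0 and c' = 1])
  fix q :: real assume q: "q > 1"
  have "symsum (qpoints (Suc n) 0 q) (\<lambda>xs. evals gs xs * weight asm_wt xs) =
    symsum (qpoints n 1 q) (\<lambda>ys. branching (asm_wt 1) gs ys * weight asm_wt ys)"
    unfolding qpoints_Suc using q assms by (intro branch) (auto simp: asm_wt_def)
  moreover have "asm_wt 1 = (\<lambda>x. x)" by (auto simp: asm_wt_def)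
  ultimately show "symsum (qpoints (Suc n) 0 q) (\<lambda>xs. evals gs xs * weight asm_wt xs) = symsum (qpoints n 1 q) (\<lambda>ys. h ys * weight asm_wt ys)"
    using assms(4) q by (simp add: symnull_def symsum_diff left_diff_distrib)
qed (intro laurent_mult laurent_weight_asm_wt assms)+

section \<open>Monotone triangles\<close>

text \<open>After the entry \<open>l\<close> has been used, strictness is encoded by raising the next lower bound to
  \<open>l + 1\<close>; so the first two entries of the argument may become equal in the recursion.\<close>

function interlace :: "int list \<Rightarrow> int list set" where
  "interlace [] = {}"
| "interlace [k] = {[]}"
| "interlace (k # l # ks) = (\<lambda>(a, ls). a # ls) ` ({k..<l} \<times> interlace (l # ks)) \<union> (#) l ` interlace ((l + 1) # ks)"
  by pat_completeness auto
termination by (relation "measure length") auto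

lemma finite_interlace [simp]: "finite (interlace ks)"
  by (induction ks rule: interlace.induct) auto

lemma length_interlace: "ls \<in> interlace ks \<Longrightarrow> Suc (length ls) = length ks"
  by (induction ks arbitrary: ls rule: interlace.induct) auto

lemma interlace_iff:
  assumes "ks \<noteq> []" "sorted_wrt (<) (tl ks)" "tl ks \<noteq> [] \<Longrightarrow> hd ks \<le> hd (tl ks)"
  shows "ls \<in> interlace ks \<longleftrightarrow> Suc (length ls) = length ks \<and> sorted_wrt (<) ls \<and>
     (\<forall>i<length ls. ks ! i \<le> ls ! i \<and> ls ! i \<le> ks ! Suc i)"
  using assms
proof (induction ks arbitrary: ls rule: interlace.induct)
  case (3 k l ks)
  note IH = "3.IH"
  show ?case
  proof (cases ls)
    case (Cons a ls')
    have IH1: "ls' \<in> interlace (l # ks) \<longleftrightarrow> Suc (length ls') = length (l # ks) \<and> sorted_wrt (<) ls' \<and>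
     (\<forall>i<length ls'. (l # ks) ! i \<le> ls' ! i \<and> ls' ! i \<le> (l # ks) ! Suc i)"
      using "3.prems" by (intro IH) (auto simp: neq_Nil_conv)
    have IH2: "ls' \<in> interlace ((l + 1) # ks) \<longleftrightarrow> Suc (length ls') = length ((l + 1) # ks) \<and> sorted_wrt (<) ls' \<and>
     (\<forall>i<length ls'. ((l + 1) # ks) ! i \<le> ls' ! i \<and> ls' ! i \<le> ((l + 1) # ks) ! Suc i)"
      using "3.prems" by (intro IH) (auto simp: neq_Nil_conv)
    have mem: "ls \<in> interlace (k # l # ks) \<longleftrightarrow> (k \<le> a \<and> a < l \<and> ls' \<in> interlace (l # ks)) \<or> (a = l \<and> ls' \<in> interlace ((l + 1) # ks))"
      unfolding Cons by auto
    have nth: "(\<forall>i<length ls'. (m # ks) ! i \<le> ls' ! i \<and> ls' ! i \<le> (m # ks) ! Suc i) \<longleftrightarrow>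
        (ls' \<noteq> [] \<longrightarrow> m \<le> hd ls') \<and>
        (\<forall>i<length ls'. (i > 0 \<longrightarrow> ks ! (i - 1) \<le> ls' ! i) \<and> ls' ! i \<le> ks ! i)" for m
      by (cases ls') (auto simp: nth_Cons split: nat.splits)
    have nth2: "(\<forall>i<length ls. (k # l # ks) ! i \<le> ls ! i \<and> ls ! i \<le> (k # l # ks) ! Suc i) \<longleftrightarrow>
        k \<le> a \<and> a \<le> l \<and> (\<forall>i<length ls'. (l # ks) ! i \<le> ls' ! i \<and> ls' ! i \<le> (l # ks) ! Suc i)"
      unfolding Cons by (auto simp: nth_Cons split: nat.splits)
    have hd_le: "sorted_wrt (<) (a # ls') \<longleftrightarrow> (ls' \<noteq> [] \<longrightarrow> a < hd ls') \<and> sorted_wrt (<) ls'"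
      by (cases ls') auto
    show ?thesis
      unfolding mem IH1 IH2 nth2 nth using 3
      unfolding Cons hd_le by (cases "a = l") (auto simp: Cons)
  qed auto
qed auto

definition mt_sum :: "int list \<Rightarrow> complex list \<Rightarrow> complex" where
  "mt_sum ks ys = (\<Sum>ls\<in>interlace ks. lmono ls ys)"

lemma mt_sum_single [simp]: "mt_sum [k] ys = 1"
  by (simp add: mt_sum_def)

lemma mt_sum_rec:
  assumes "k \<le> l"
  shows "mt_sum (k # l # ks) (y # ys) = geom_sum k (l - 1) y * mt_sum (l # ks) ys + y powi l * mt_sum ((l + 1) # ks) ys"
proof -
  have "mt_sum (k # l # ks) (y # ys) =
    (\<Sum>ls\<in>(\<lambda>(a, ls). a # ls) ` ({k..<l} \<times> interlace (l # ks)). lmono ls (y # ys)) +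
    (\<Sum>ls\<in>(#) l ` interlace ((l + 1) # ks). lmono ls (y # ys))"
    unfolding mt_sum_def interlace.simps by (rule sum.union_disjoint) auto
  also have "(\<Sum>ls\<in>(\<lambda>(a, ls). a # ls) ` ({k..<l} \<times> interlace (l # ks)). lmono ls (y # ys)) =
      (\<Sum>(a, ls)\<in>{k..<l} \<times> interlace (l # ks). y powi a * lmono ls ys)"
    by (subst sum.reindex) (auto simp: inj_on_def intro!: sum.cong)
  also have "\<dots> = geom_sum k (l - 1) y * mt_sum (l # ks) ys"
    using assms by (simp add: geom_sum_def mt_sum_def sum_product sum.cartesian_product atLeastLessThanPlusOne_atLeastAtMost_int[of k "l - 1", simplified])
  also have "(\<Sum>ls\<in>(#) l ` interlace ((l + 1) # ks). lmono ls (y # ys)) = y powi l * mt_sum ((l + 1) # ks) ys"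
    by (subst sum.reindex) (auto simp: mt_sum_def sum_distrib_left)
  finally show ?thesis .
qed

text \<open>The pattern is that of \<open>symnull_gt_sum_bracket\<close>, with strictness adding the
  rows over \<open>(k + 1) # ks\<close>. The term with equal exponents \<open>k\<close> now carries
  the factor \<open>1 - y' + y * y'\<close>, which is \<open>asm_wt y' y\<close>; together with
  \<open>asm_wt y y'\<close> from the weight it is symmetric in \<open>y\<close> and
  \<open>y'\<close>.\<close>

lemma symnull_mt_sum_bracket:
  "length ks = n \<Longrightarrow> sorted_wrt (<) (k # ks) \<Longrightarrow>
   symnull asm_wt (Suc n) (\<lambda>xs. zpow k (hd xs) * (mt_sum (k # ks) (tl xs) / (hd xs - 1) + mt_sum ((k + 1) # ks) (tl xs)
      - hd xs * upper_prod (\<lambda>x. x) ks (tl xs) / (hd xs - 1)))"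
proof (induction ks arbitrary: k n)
  case Nil
  show ?case by (rule symnull_cong[OF symnull_zero]) (auto simp: length_Suc_conv Nil field_simps)
next
  case (Cons l ks)
  then obtain m where n: "n = Suc m" and m: "length ks = m" by auto
  have kl: "k < l" "sorted_wrt (<) (l # ks)" using Cons.prems by auto
  have 1: "symnull asm_wt (Suc (Suc m)) (\<lambda>xs. - (zpow k (hd xs) / (hd xs - 1) * (zpow k (hd (tl xs)) / (hd (tl xs) - 1))) *
      (1 - hd (tl xs) + hd xs * hd (tl xs)) * mt_sum (l # ks) (tl (tl xs)))"
    by (rule symnull_swap) (simp add: asm_wt_def mult_ac)
  have 2: "symnull asm_wt (Suc (Suc m)) (\<lambda>xs. (zpow k (hd xs) * (hd xs / (hd xs - 1))) *
     (zpow l (hd (tl xs)) * (mt_sum (l # ks) (tl (tl xs)) / (hd (tl xs) - 1) + mt_sum ((l + 1) # ks) (tl (tl xs))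
      - hd (tl xs) * upper_prod (\<lambda>x. x) ks (tl (tl xs)) / (hd (tl xs) - 1))))"
    by (rule symnull_Cons[OF Cons.IH[OF m kl(2)]])
  show ?case unfolding n
  proof (rule symnull_cong[OF symnull_add[OF 1 2]])
    fix xs :: "complex list" assume xs: "length xs = Suc (Suc m)" "0 \<notin> set xs" "1 \<notin> set xs"
    then obtain y y' ys where ys: "xs = y # y' # ys" by (auto simp: length_Suc_conv)
    have yi: "y * inverse (y - 1) = 1 + inverse (y - 1)"
      using xs by (auto simp: ys field_simps)
    \<comment> \<open>With \<open>i = 1 / (y - 1)\<close> the two sides agree modulo the relation
      \<open>y * i = 1 + i\<close>.\<close>
    have alg: "K * (((L - K') * i' * J + L * J') * i + ((L - y' * K') * i' * J + L * J') - y * (L * y' * i' * U) * i) =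
      - (K * i * (K' * i')) * (1 - y' + y * y') * J + K * (y * i) * (L * (J * i' + J' - y' * U * i'))"
      (is "?l = ?r") if "y * i = 1 + i" for y y' K L K' i' i J J' U :: complex
    proof -
      have "?l - ?r = (K * i' * J * (K' * y' - L) - K * L * J') * (y * i - (1 + i))"
        by (simp add: algebra_simps)
      with that show ?thesis by simp
    qed
    have "zpow (k + 1) y' = y' * zpow k y'" using xs by (simp add: ys power_int_add)
    then show "zpow k (hd xs) * (mt_sum (k # l # ks) (tl xs) / (hd xs - 1) + mt_sum ((k + 1) # l # ks) (tl xs)
      - hd xs * upper_prod (\<lambda>x. x) (l # ks) (tl xs) / (hd xs - 1)) =
      - (zpow k (hd xs) / (hd xs - 1) * (zpow k (hd (tl xs)) / (hd (tl xs) - 1))) *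
      (1 - hd (tl xs) + hd xs * hd (tl xs)) * mt_sum (l # ks) (tl (tl xs)) +
      (zpow k (hd xs) * (hd xs / (hd xs - 1))) *
     (zpow l (hd (tl xs)) * (mt_sum (l # ks) (tl (tl xs)) / (hd (tl xs) - 1) + mt_sum ((l + 1) # ks) (tl (tl xs))
      - hd (tl xs) * upper_prod (\<lambda>x. x) ks (tl (tl xs)) / (hd (tl xs) - 1)))"
      using xs kl alg[OF yi, of "zpow k y" "zpow l y'" "zpow k y'" "inverse (y' - 1)"]
      by (simp add: ys geom_sum_eq mt_sum_rec divide_inverse)
  qed
qed

lemma symnull_mt_sum:
  "length ks = Suc n \<Longrightarrow> sorted_wrt (<) ks \<Longrightarrow> symnull asm_wt n (\<lambda>ys. mt_sum ks ys - branching (\<lambda>x. x) (map zpow ks) ys)"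
proof (induction n arbitrary: ks)
  case 0 then show ?case by (auto simp: length_Suc_conv symnull_def symsum_def)
next
  case (Suc n)
  then obtain k l ks' where ks: "ks = k # l # ks'" by (metis length_Suc_conv)
  with Suc have len: "length ks' = n" and kl: "k < l" "sorted_wrt (<) (l # ks')" by auto
  have 1: "symnull asm_wt (Suc n) (\<lambda>xs. - (zpow k (hd xs) / (hd xs - 1)) * (mt_sum (l # ks') (tl xs) - branching (\<lambda>x. x) (map zpow (l # ks')) (tl xs)))"
    by (rule symnull_Cons[OF Suc.IH]) (use len kl in auto)
  show ?case unfolding ks
  proof (rule symnull_cong[OF symnull_add[OF 1 symnull_mt_sum_bracket[OF len kl(2)]]])
    fix xs :: "complex list" assume xs: "length xs = Suc n" "0 \<notin> set xs" "1 \<notin> set xs"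
    then obtain y ys where ys: "xs = y # ys" by (auto simp: length_Suc_conv)
    have alg: "(L - K) * i * J + L * J' - (L * y * i * U + K * (- i) * B) = - (K * i) * (J - B) + L * (J * i + J' - y * U * i)"
      for L K i J U B J' :: complex by (simp add: algebra_simps)
    show "mt_sum (k # l # ks') xs - branching (\<lambda>x. x) (map zpow (k # l # ks')) xs =
      - (zpow k (hd xs) / (hd xs - 1)) * (mt_sum (l # ks') (tl xs) - branching (\<lambda>x. x) (map zpow (l # ks')) (tl xs)) +
      zpow l (hd xs) * (mt_sum (l # ks') (tl xs) / (hd xs - 1) + mt_sum ((l + 1) # ks') (tl xs) -
        hd xs * upper_prod (\<lambda>x. x) ks' (tl xs) / (hd xs - 1))"
      using xs kl alg[of "zpow l y" "zpow k y" "inverse (y - 1)"]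
      by (simp add: ys geom_sum_eq mt_sum_rec divide_inverse inverse_one_minus)
  qed
qed

section \<open>Triangle counts and their differences in the first bottom entry\<close>

primrec mt_count :: "nat \<Rightarrow> int list \<Rightarrow> nat" where
  "mt_count 0 ks = 1"
| "mt_count (Suc n) ks = (\<Sum>ls\<in>interlace ks. mt_count n ls)"

lemma interlace_sorted: "ls \<in> interlace ks \<Longrightarrow> sorted_wrt (<) ks \<Longrightarrow> sorted_wrt (<) ls"
  by (cases "ks = []", simp, subst (asm) interlace_iff) (auto simp: neq_Nil_conv)

lemma interlace_hd: "ls \<in> interlace (k # ks) \<Longrightarrow> sorted_wrt (<) (k # ks) \<Longrightarrow> ls \<noteq> [] \<Longrightarrow> k \<le> hd ls"
  by (subst (asm) interlace_iff) (auto simp: neq_Nil_conv)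

lemma laurent_lmono_weight: "length ks = n \<Longrightarrow> laurent n (\<lambda>xs. lmono ks xs * weight asm_wt xs)"
  by (intro laurent_mult laurent.mono laurent_weight_asm_wt)

lemma laurent_mt_sum: "length ks = Suc n \<Longrightarrow> laurent n (mt_sum ks)"
  unfolding mt_sum_def[abs_def] by (intro laurent_sum laurent.mono) (auto dest: length_interlace)

lemma q_limit_lmono_rec:
  assumes "length ks = Suc n" "sorted_wrt (<) ks"
  shows "q_limit (Suc n) (\<lambda>xs. lmono ks xs * weight asm_wt xs) = (\<Sum>ls\<in>interlace ks. q_limit n (\<lambda>xs. lmono ls xs * weight asm_wt xs))"
proof -
  have "q_limit (Suc n) (\<lambda>xs. lmono ks xs * weight asm_wt xs) = q_limit n (\<lambda>xs. mt_sum ks xs * weight asm_wt xs)"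
    using assms by (intro q_limit_branch symnull_mt_sum laurent_mt_sum laurent.mono) auto
  also have "\<dots> = (\<Sum>ls\<in>interlace ks. q_limit n (\<lambda>xs. lmono ls xs * weight asm_wt xs))"
    unfolding mt_sum_def sum_distrib_right using assms by (intro q_limit_sum laurent_lmono_weight) (auto dest: length_interlace)
  finally show ?thesis .
qed

lemma q_limit_mt_count:
  "length ks = n \<Longrightarrow> sorted_wrt (<) ks \<Longrightarrow> q_limit n (\<lambda>xs. lmono ks xs * weight asm_wt xs) = of_nat (mt_count n ks)"
proof (induction n arbitrary: ks)
  case 0 then show ?case by (simp add: q_limit_0)
next
  case (Suc n)
  have "q_limit n (\<lambda>xs. lmono ls xs * weight asm_wt xs) = of_nat (mt_count n ls)" if "ls \<in> interlace ks" for ls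
    using Suc.prems length_interlace[OF that] interlace_sorted[OF that] by (intro Suc.IH) auto
  then show ?case using Suc.prems by (simp add: q_limit_lmono_rec)
qed

text \<open>The \<open>j\<close>-th backward difference of the triangle count in the first bottom entry \<open>k\<close>: the lowest
  \<open>j + 1\<close> entries of the leftmost diagonal are frozen at \<open>k\<close>. It is defined for all \<open>k\<close>, but counts
  triangles only for \<open>k < hd xs\<close>.\<close>

primrec trap_value :: "nat \<Rightarrow> int \<Rightarrow> int list \<Rightarrow> complex" where
  "trap_value 0 k xs = q_limit (Suc (length xs)) (\<lambda>ys. lmono (k # xs) ys * weight asm_wt ys)"
| "trap_value (Suc j) k xs = (\<Sum>ls\<in>interlace xs. trap_value j k ls)"

lemma q_limit_1: "q_limit 1 (\<lambda>ys. lmono [k] ys * weight asm_wt ys) = 1"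
  using q_limit_mt_count[of "[k]" 1] by simp

text \<open>\<open>z^k - z^(k+1)\<close> vanishes at 1, so 1 never goes to the front; and when it
  goes behind the first variable, the factor \<open>1 / (1 - z)\<close> turns the difference back
  into \<open>z^k\<close>. So the first entry is copied to the next row instead of being summed
  over.\<close>

lemma trap_value_diff_0:
  assumes "sorted_wrt (<) xs"
  shows "trap_value 0 k xs - trap_value 0 (k + 1) xs = trap_value 1 k xs"
proof (cases xs)
  case Nil then show ?thesis using q_limit_1 by simp
next
  case (Cons x xs')
  define n where "n = length xs'"
  have len: "length xs = Suc n" by (simp add: Cons n_def)
  let ?g = "\<lambda>z::complex. zpow k z - zpow (k + 1) z"
  have g: "laurent1 ?g" by (intro laurent1_diff laurent1_zpow)
  have laurg: "laurent (Suc (Suc n)) (evals (?g # map zpow xs))"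
    using g len by (intro laurent_evals) (auto simp: laurent1_zpow)
  have "trap_value 0 k xs - trap_value 0 (k + 1) xs = q_limit (Suc (Suc n)) (\<lambda>ys. lmono (k # xs) ys * weight asm_wt ys - lmono ((k + 1) # xs) ys * weight asm_wt ys)"
    using len by (simp add: q_limit_diff laurent_lmono_weight del: list.map)
  also have "\<dots> = q_limit (Suc (Suc n)) (\<lambda>ys. evals (?g # map zpow xs) ys * weight asm_wt ys)"
    by (rule q_limit_cong[OF laurent_mult[OF laurg laurent_weight_asm_wt]]) (auto simp: length_Suc_conv algebra_simps)
  also have "\<dots> = q_limit (Suc n) (\<lambda>ys. (zpow k (hd ys) * mt_sum xs (tl ys)) * weight asm_wt ys)"
  proof (rule q_limit_branch)
    have "symnull asm_wt (Suc n) (\<lambda>ys. zpow k (hd ys) * (mt_sum xs (tl ys) - branching (\<lambda>x. x) (map zpow xs) (tl ys)))"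
      using len assms by (intro symnull_Cons symnull_mt_sum) auto
    then show "symnull asm_wt (Suc n) (\<lambda>ys. zpow k (hd ys) * mt_sum xs (tl ys) - branching (\<lambda>x. x) (?g # map zpow xs) ys)"
    proof (rule symnull_cong)
      fix ys :: "complex list" assume ys: "length ys = Suc n" "0 \<notin> set ys" "1 \<notin> set ys"
      then obtain z zs where zs: "ys = z # zs" by (auto simp: length_Suc_conv)
      have "?g z / (1 - z) = zpow k z" using ys by (auto simp: zs power_int_add field_simps)
      then show "zpow k (hd ys) * mt_sum xs (tl ys) - branching (\<lambda>x. x) (?g # map zpow xs) ys =
         zpow k (hd ys) * (mt_sum xs (tl ys) - branching (\<lambda>x. x) (map zpow xs) (tl ys))"
        by (simp add: zs right_diff_distrib)
    qed
  qed (use len laurg in \<open>auto intro!: laurent_mult laurent_hd laurent1_zpow laurent_tl laurent_mt_sum\<close>)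
  also have "\<dots> = q_limit (Suc n) (\<lambda>ys. \<Sum>ls\<in>interlace xs. lmono (k # ls) ys * weight asm_wt ys)"
    using len
    by (intro q_limit_cong laurent_sum laurent_lmono_weight)
       (auto simp: length_Suc_conv mt_sum_def sum_distrib_right sum_distrib_left dest: length_interlace)
  also have "\<dots> = (\<Sum>ls\<in>interlace xs. q_limit (Suc n) (\<lambda>ys. lmono (k # ls) ys * weight asm_wt ys))"
    using len by (intro q_limit_sum laurent_lmono_weight) (auto dest: length_interlace)
  also have "\<dots> = trap_value 1 k xs"
    using len by (auto simp del: list.map dest: length_interlace intro!: sum.cong)
  finally show ?thesis .
qed

lemma trap_value_diff: "sorted_wrt (<) xs \<Longrightarrow> trap_value j k xs - trap_value j (k + 1) xs = trap_value (Suc j) k xs"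
proof (induction j arbitrary: xs)
  case 0 then show ?case using trap_value_diff_0 by simp
next
  case (Suc j)
  then have "trap_value j k ls - trap_value j (k + 1) ls = trap_value (Suc j) k ls" if "ls \<in> interlace xs" for ls
    using that interlace_sorted by blast
  then show ?case by (simp add: sum_subtractf[symmetric])
qed

primrec trap_count :: "nat \<Rightarrow> int \<Rightarrow> int list \<Rightarrow> nat" where
  "trap_count 0 k xs = mt_count (Suc (length xs)) (k # xs)"
| "trap_count (Suc j) k xs = (\<Sum>ls\<in>interlace xs. trap_count j k ls)"

lemma trap_value_trap_count:
  "sorted_wrt (<) (k # xs) \<Longrightarrow> trap_value j k xs = of_nat (trap_count j k xs)"
proof (induction j arbitrary: xs)
  case 0 then show ?case by (simp add: q_limit_mt_count del: mt_count.simps list.map)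
next
  case (Suc j)
  have "trap_value j k ls = of_nat (trap_count j k ls)" if "ls \<in> interlace xs" for ls
  proof (rule Suc.IH)
    have s: "sorted_wrt (<) ls" using that Suc.prems interlace_sorted by auto
    have "k < hd ls" if "ls \<noteq> []"
      using interlace_hd[of ls "hd xs" "tl xs"] \<open>ls \<in> interlace xs\<close> Suc.prems that by (cases xs) auto
    then show "sorted_wrt (<) (k # ls)" using s by (cases ls) auto
  qed
  then show ?case by simp
qed

section \<open>The rational functions P and R\<close>

text \<open>Passing from \<open>s\<close> to \<open>s + 1\<close> in \<open>P\<close> puts a new
  power in front and multiplies all older factors by \<open>1 - 1/z\<close>, hence the recursion.
  For \<open>s = 0\<close> the exponents are \<open>2 - t, 4 - t, .., t - 2\<close>: the row
  \<open>3, 5, .., 2 * t - 1\<close> centred at 0.\<close>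

primrec P_factors :: "nat \<Rightarrow> nat \<Rightarrow> (complex \<Rightarrow> complex) list" where
  "P_factors t 0 = map zpow (map (\<lambda>j. 2 * int j - int t) [1..<t])"
| "P_factors t (Suc s) = zpow (2 * int s - int t + 1) # map (\<lambda>h z. h z * (1 - inverse z)) (P_factors t s)"

lemma length_gs: "length (P_factors t s) = s + (t - 1)"
  by (induction s) auto

lemma laurent1_delta: "laurent1 (\<lambda>z. 1 - inverse z)"
proof -
  have "laurent1 (\<lambda>z. 1 - z powi (-1))" by (intro laurent1_diff laurent1_const laurent1_zpow)
  then show ?thesis by (simp add: power_int_minus)
qed

lemma laurent1_map_delta: "\<forall>h\<in>set H. laurent1 h \<Longrightarrow> \<forall>h\<in>set (map (\<lambda>h z. h z * (1 - inverse z)) H). laurent1 h"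
  by (simp add: laurent1_mult laurent1_delta)

lemma laurent1_gs: "\<forall>g\<in>set (P_factors t s). laurent1 g"
proof (induction s)
  case (Suc s) then show ?case using laurent1_map_delta[OF Suc] by (simp add: laurent1_zpow)
qed (simp add: laurent1_zpow)

lemma branching_vanish: "(\<And>h. h \<in> set gs \<Longrightarrow> h 1 = 0) \<Longrightarrow> branching u gs xs = 0"
proof (induction xs arbitrary: gs)
  case Nil then show ?case by (cases gs) auto
next
  case (Cons x xs) then show ?case by (cases gs) auto
qed

lemma evals_undelta:
  fixes zs :: "'a::field list"
  assumes "0 \<notin> set zs" "1 \<notin> set zs"
  shows "evals (map (\<lambda>h x. h x * x / (x - 1)) (map (\<lambda>h z. h z * (1 - inverse z)) H)) zs = evals H zs"
  using assms
proof (induction zs arbitrary: H)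
  case (Cons z zs)
  have "z \<noteq> 0" using Cons.prems by auto
  then have "(1 - inverse z) * z = z - 1" by (simp add: left_diff_distrib)
  then have "w * (1 - inverse z) * z / (z - 1) = w" for w using Cons.prems by (simp add: mult.assoc)
  with Cons show ?case by (cases H) auto
qed (cases "H"; simp)

text \<open>1 can stand only first, which contributes \<open>g 1 * z * z powi y / (z - 1)\<close>,
  or second, which contributes \<open>- g z / (z - 1)\<close>: further back a factor
  \<open>1 - inverse z\<close> would be evaluated at 1. The sum of the two is
  \<open>g' z\<close>.\<close>

lemma q_limit_peel:
  assumes "length H = n" "laurent1 g" "laurent1 g'" "\<forall>h\<in>set H. laurent1 h"
    and g': "\<And>z. z \<noteq> 0 \<Longrightarrow> z \<noteq> 1 \<Longrightarrow> g' z * (z - 1) = g 1 * (z * z powi y) - g z"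
  shows "q_limit (Suc (Suc n)) (\<lambda>xs. evals (g # zpow y # map (\<lambda>h z. h z * (1 - inverse z)) H) xs * weight asm_wt xs) =
         q_limit (Suc n) (\<lambda>xs. evals (g' # H) xs * weight asm_wt xs)"
proof (rule q_limit_branch)
  let ?D = "map (\<lambda>h z. h z * (1 - inverse z)) H"
  show "laurent (Suc (Suc n)) (evals (g # zpow y # ?D))"
    using assms(1,2) laurent1_map_delta[OF assms(4)] by (intro laurent_evals) (simp_all add: laurent1_zpow)
  show "laurent (Suc n) (evals (g' # H))" using assms(1,3,4) by (intro laurent_evals) simp_all
  show "symnull asm_wt (Suc n) (\<lambda>ys. evals (g' # H) ys - branching (\<lambda>x. x) (g # zpow y # ?D) ys)"
  proof (rule symnull_cong[OF symnull_zero])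
    fix xs :: "complex list" assume xs: "length xs = Suc n" "0 \<notin> set xs" "1 \<notin> set xs"
    then obtain z zs where zs: "xs = z # zs" by (auto simp: length_Suc_conv)
    have z: "z \<noteq> 0" "z \<noteq> 1" and zs': "0 \<notin> set zs" "1 \<notin> set zs" and len: "length zs = n" using xs zs by auto
    have branching_D: "branching (\<lambda>x. x) ?D ws = 0" for ws by (rule branching_vanish) auto
    have tail: "branching (\<lambda>x. x) (zpow y # ?D) zs = evals H zs"
    proof (cases zs)
      case Nil then show ?thesis using len assms(1) by simp
    next
      case (Cons w ws)
      have "branching (\<lambda>x. x) (zpow y # ?D) zs = evals (map (\<lambda>h x. h x * x / (x - 1)) ?D) zs"
        using branching_D unfolding Cons by simp
      then show ?thesis using evals_undelta[OF zs'] by simp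
    qed
    have "branching (\<lambda>x. x) (g # zpow y # ?D) xs = (g 1 * (z powi y * z / (z - 1)) + g z / (1 - z)) * evals H zs"
      using tail evals_undelta[OF zs', of H] by (simp add: zs algebra_simps)
    also have "g 1 * (z powi y * z / (z - 1)) + g z / (1 - z) = (g 1 * (z * z powi y) - g z) / (z - 1)"
      by (simp add: divide_inverse inverse_one_minus algebra_simps)
    also have "\<dots> = g' z" using g'[OF z] z by (simp add: field_simps)
    finally show "evals (g' # H) xs - branching (\<lambda>x. x) (g # zpow y # ?D) xs = 0" by (simp add: zs)
  qed
qed (use assms in simp)

definition Psi :: "nat \<Rightarrow> nat \<Rightarrow> int \<Rightarrow> complex" where
  "Psi t s k = q_limit (Suc (length (P_factors t s))) (\<lambda>xs. evals (zpow k # P_factors t s) xs * weight asm_wt xs)"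

lemma laurent_zpow_gs: "laurent (Suc (length (P_factors t s))) (\<lambda>xs. evals (zpow k # P_factors t s) xs * weight asm_wt xs)"
  using laurent1_gs by (intro laurent_mult laurent_weight_asm_wt laurent_evals) (simp_all add: laurent1_zpow)

lemma Psi_0: "Psi t 0 k = trap_value 0 k (map (\<lambda>j. 2 * int j - int t) [1..<t])"
  by (simp add: Psi_def)

text \<open>Here \<open>g 1 = 0\<close>, so only the second position of 1 is left, and it turns
  \<open>z^k - z^(k+1)\<close> into \<open>z^k\<close>.\<close>

lemma Psi_diff: "Psi t (Suc s) k - Psi t (Suc s) (k + 1) = Psi t s k"
proof -
  let ?g = "\<lambda>z::complex. zpow k z - zpow (k + 1) z"
  have g: "laurent1 ?g" by (intro laurent1_diff laurent1_zpow)
  have laurg: "laurent (Suc (length (P_factors t (Suc s)))) (evals (?g # P_factors t (Suc s)))"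
    using g laurent1_gs[of t "Suc s"] by (intro laurent_evals) simp_all
  have "Psi t (Suc s) k - Psi t (Suc s) (k + 1) =
    q_limit (Suc (length (P_factors t (Suc s)))) (\<lambda>xs. evals (?g # P_factors t (Suc s)) xs * weight asm_wt xs)"
    unfolding Psi_def q_limit_diff[OF laurent_zpow_gs laurent_zpow_gs, symmetric]
    by (rule q_limit_cong[OF laurent_mult[OF laurg laurent_weight_asm_wt]]) (auto simp: length_Suc_conv algebra_simps)
  also have "\<dots> = Psi t s k"
    unfolding Psi_def P_factors.simps list.map length_map length_Cons
    by (intro q_limit_peel g laurent1_zpow laurent1_gs refl) (simp add: power_int_add algebra_simps)
  finally show ?thesis .
qed

text \<open>The exponent is one more than that of the next factor, and then the two positions of 1
  cancel. Each antidifference is thereby pinned down by one known value.\<close>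

lemma Psi_zero: "Psi t (Suc s) (2 * int s - int t + 2) = 0"
proof -
  have "Psi t (Suc s) (2 * int s - int t + 2) =
     q_limit (Suc (length (P_factors t s))) (\<lambda>xs. evals ((\<lambda>x. 0) # P_factors t s) xs * weight asm_wt xs)"
    unfolding Psi_def P_factors.simps list.map length_map length_Cons
  proof (intro q_limit_peel laurent1_const laurent1_zpow laurent1_gs refl)
    fix z :: complex assume "z \<noteq> 0"
    then show "0 * (z - 1) = 1 powi (2 * int s - int t + 2) * (z * z powi (2 * int s - int t + 1)) - z powi (2 * int s - int t + 2)"
      using power_int_add_1'[of z "2 * int s - int t + 1"] by (simp add: add.assoc)
  qed
  also have "\<dots> = q_limit (Suc (length (P_factors t s))) (\<lambda>xs. 0)"
    by (rule q_limit_cong[OF laurent_const]) (auto simp: length_Suc_conv)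
  finally show ?thesis by (simp add: q_limit_zero)
qed

text \<open>Omitting the factors that couple the additional variable \<open>x\<close> to the others amounts to
  multiplication by \<open>1 - x + x\<^sup>2\<close> under the limit: all factors together are \<open>\<Prod>\<^sub>y (1 + x (y - 1))\<close> over all
  \<open>y\<close> including \<open>x\<close>, whose coefficients as a polynomial in \<open>x\<close> are symmetric and tend to those of \<open>1\<close>.\<close>

definition bare_limit :: "nat \<Rightarrow> nat \<Rightarrow> int \<Rightarrow> complex" where
  "bare_limit t s k = q_limit (Suc (length (P_factors t s))) (\<lambda>xs. zpow k (hd xs) * (evals (P_factors t s) (tl xs) * weight asm_wt (tl xs)))"

lemma laurent_bare_limit: "laurent (Suc (length (P_factors t s))) (\<lambda>xs. zpow k (hd xs) * (evals (P_factors t s) (tl xs) * weight asm_wt (tl xs)))"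
  by (intro laurent_mult laurent_hd laurent1_zpow laurent_tl laurent_weight_asm_wt laurent_evals laurent1_gs refl)

lemma tendsto_coeff:
  assumes "finite J"
  shows "((\<lambda>q. \<Prod>i\<in>J. complex_of_real q powi (0 + int i) - 1) \<longlongrightarrow> (if J = {} then 1 else 0)) (at_right 1)"
proof -
  have "((\<lambda>q. \<Prod>i\<in>J. complex_of_real q powi (0 + int i) - 1) \<longlongrightarrow> (\<Prod>i\<in>J. 1 - 1)) (at_right 1)"
    by (intro tendsto_prod tendsto_diff tendsto_const tendsto_powi_1)
  then show ?thesis using assms by (auto simp: power_0_left card_gt_0_iff)
qed

lemma Psi_bare_limit: "Psi t s k - Psi t s (k + 1) + Psi t s (k + 2) = bare_limit t s k"
proof -
  define n where "n = Suc (length (P_factors t s))"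
  define h where "h = (\<lambda>ys. evals (P_factors t s) ys * weight asm_wt ys)"
  let ?f = "\<lambda>k xs. evals (zpow k # P_factors t s) xs * weight asm_wt xs"
  let ?c = "\<lambda>q J. \<Prod>i\<in>J. complex_of_real q powi (0 + int i) - 1"
  have laurf: "laurent n (?f k)" for k unfolding n_def by (rule laurent_zpow_gs)
  have "((\<lambda>q. symsum (qpoints n 0 q) (\<lambda>xs. ?f k xs - ?f (k + 1) xs + ?f (k + 2) xs)) \<longlongrightarrow>
     Psi t s k - Psi t s (k + 1) + Psi t s (k + 2)) (at_right 1)"
    unfolding Psi_def n_def[symmetric] symsum_add symsum_diff
    by (intro tendsto_add tendsto_diff q_limit_tendsto laurf)
  moreover have "eventually (\<lambda>q. symsum (qpoints n 0 q) (\<lambda>xs. ?f k xs - ?f (k + 1) xs + ?f (k + 2) xs) =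
     (\<Sum>J\<in>Pow {..<n}. ?c q J * symsum (qpoints n 0 q) (\<lambda>xs. zpow (k + int (card J)) (hd xs) * h (tl xs)))) (at_right 1)"
    using eventually_at_right_less[of "1::real"]
  proof eventually_elim
    case (elim q)
    have "symsum (qpoints n 0 q) (\<lambda>xs. ?f k xs - ?f (k + 1) xs + ?f (k + 2) xs) =
      symsum (qpoints n 0 q) (\<lambda>xs. \<Sum>J\<in>Pow {..<n}. ?c q J * (zpow (k + int (card J)) (hd xs) * h (tl xs)))"
    proof (rule symsum_cong)
      fix xs assume xs: "set xs = qpoints n 0 q" "distinct xs" "length xs = card (qpoints n 0 q)"
      then obtain x ys where ys: "xs = x # ys" using elim by (auto simp: n_def length_Suc_conv)
      have x0: "x \<noteq> 0" using xs(1) ys zero_notin_qpoints[OF elim, of n 0] by auto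
      have "?f k xs - ?f (k + 1) xs + ?f (k + 2) xs =
        (1 + x * (x - 1)) * (\<Prod>y\<leftarrow>ys. asm_wt x y) * zpow k x * h ys"
        using x0 by (simp add: ys h_def power_int_add algebra_simps power2_eq_square)
      also have "(1 + x * (x - 1)) * (\<Prod>y\<leftarrow>ys. asm_wt x y) = (\<Prod>y\<leftarrow>xs. x * (y - 1) + 1)"
        by (simp add: ys asm_wt_def algebra_simps)
      also have "\<dots> = (\<Prod>y\<in>qpoints n 0 q. x * (y - 1) + 1)"
        using xs by (simp add: prod.distinct_set_conv_list[symmetric])
      also have "\<dots> = (\<Prod>i<n. x * (complex_of_real q powi (0 + int i) - 1) + 1)"
        unfolding qpoints_def by (subst prod.reindex[OF qpoints_inj[OF elim]]) simp
      \<comment> \<open>Expanded over subsets, the coefficients depend only on the set of points and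
        not on the ordering, so they leave the symmetrization.\<close>
      also have "\<dots> = (\<Sum>J\<in>Pow {..<n}. x ^ card J * ?c q J)"
        by (subst prod_add) (auto simp: prod.distrib)
      also have "\<dots> * zpow k x * h ys = (\<Sum>J\<in>Pow {..<n}. ?c q J * (zpow (k + int (card J)) x * h ys))"
        unfolding sum_distrib_right using x0 by (intro sum.cong refl) (simp add: power_int_add mult_ac)
      finally show "?f k xs - ?f (k + 1) xs + ?f (k + 2) xs =
         (\<Sum>J\<in>Pow {..<n}. ?c q J * (zpow (k + int (card J)) (hd xs) * h (tl xs)))" by (simp add: ys)
    qed
    then show ?case by (simp only: symsum_sum symsum_cmult)
  qed
  ultimately have "((\<lambda>q. \<Sum>J\<in>Pow {..<n}. ?c q J * symsum (qpoints n 0 q) (\<lambda>xs. zpow (k + int (card J)) (hd xs) * h (tl xs)))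
      \<longlongrightarrow> Psi t s k - Psi t s (k + 1) + Psi t s (k + 2)) (at_right 1)"
    by (rule Lim_transform_eventually)
  moreover have "((\<lambda>q. \<Sum>J\<in>Pow {..<n}. ?c q J * symsum (qpoints n 0 q) (\<lambda>xs. zpow (k + int (card J)) (hd xs) * h (tl xs)))
      \<longlongrightarrow> (\<Sum>J\<in>Pow {..<n}. (if J = {} then 1 else 0) * bare_limit t s (k + int (card J)))) (at_right 1)"
    unfolding bare_limit_def h_def n_def
    by (intro tendsto_sum tendsto_mult tendsto_coeff q_limit_tendsto laurent_bare_limit) (auto intro: finite_subset)
  moreover have "(\<Sum>J\<in>Pow {..<n}. (if J = {} then 1 else 0) * bare_limit t s (k + int (card J))) =
     (\<Sum>J\<in>Pow {..<n}. if {} = J then bare_limit t s k else 0)"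
    by (intro sum.cong) auto
  ultimately show ?thesis
    using tendsto_unique[OF trivial_limit_at_right_real] by (auto simp: sum.delta)
qed

text \<open>Only the Vandermonde factors of the split-off variable change:
  \<open>1/y - 1/x = - (y - x) / (x * y)\<close>. Over the \<open>N\<close> other points this gives
  \<open>x^N\<close>, and completing the product of the \<open>y\<close> to that of all of
  \<open>Z\<close> costs one \<open>x\<close>; hence the exponent \<open>N - 1 - k\<close>.\<close>

lemma symsum_hd_inverse:
  assumes "finite Z" "card Z = Suc N" "0 \<notin> (Z :: 'a::field set)"
    and h: "\<And>Y. Y \<subseteq> Z \<Longrightarrow> card Y = N \<Longrightarrow> symsum (inverse ` Y) h = symsum Y h"
  shows "symsum (inverse ` Z) (\<lambda>xs. zpow k (hd xs) * h (tl xs)) =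
    (-1) ^ N * (\<Prod>Z) * symsum Z (\<lambda>xs. zpow (int N - 1 - k) (hd xs) * h (tl xs))"
proof -
  have Z: "Z \<noteq> {}" using assms by auto
  have inj: "inj_on inverse A" for A :: "'a set" by (auto simp: inj_on_def)
  have "symsum (inverse ` Z) (\<lambda>xs. zpow k (hd xs) * h (tl xs)) =
    (\<Sum>x\<in>Z. symsum (inverse ` Z - {inverse x}) (\<lambda>ys. zpow k (inverse x) * h ys) / (\<Prod>y\<in>inverse ` Z - {inverse x}. y - inverse x))"
    using assms Z by (subst symsum_Cons) (auto simp: sum.reindex[OF inj])
  also have "\<dots> = (\<Sum>x\<in>Z. (-1) ^ N * (\<Prod>Z) * (symsum (Z - {x}) (\<lambda>ys. zpow (int N - 1 - k) x * h ys) / (\<Prod>y\<in>Z - {x}. y - x)))"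
  proof (rule sum.cong[OF refl])
    fix x assume x: "x \<in> Z"
    let ?Y = "Z - {x}"
    have Y: "inverse ` Z - {inverse x} = inverse ` ?Y" by auto
    have card: "card ?Y = N" using x assms by simp
    have x0: "x \<noteq> 0" using x assms by auto
    have "(\<Prod>y\<in>inverse ` ?Y. y - inverse x) = (\<Prod>y\<in>?Y. (- 1) * (y - x) / (x * y))"
      unfolding prod.reindex[OF inj] comp_def
    proof (rule prod.cong[OF refl])
      fix y assume "y \<in> ?Y"
      then have "y \<noteq> 0" using assms(3) by auto
      then show "inverse y - inverse x = (- 1) * (y - x) / (x * y)"
        using x0 by (simp add: divide_simps)
    qed
    also have "\<dots> = (-1) ^ N * (\<Prod>y\<in>?Y. y - x) / (x ^ N * \<Prod>?Y)"
      unfolding prod_dividef prod.distrib by (simp add: card)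
    finally have 1: "(\<Prod>y\<in>inverse ` ?Y. y - inverse x) = (-1) ^ N * (\<Prod>y\<in>?Y. y - x) / (x ^ N * \<Prod>?Y)" .
    have 2: "\<Prod>Z = x * \<Prod>?Y" using x assms by (simp add: prod.remove)
    have 3: "zpow (int N - 1 - k) x = x ^ N * zpow k (inverse x) / x"
      using x0 by (simp add: power_int_diff power_int_inverse power_int_add field_simps)
    have 4: "inverse ((-1) ^ N) = ((-1) ^ N :: 'a)" by (simp add: power_inverse[symmetric])
    show "symsum (inverse ` Z - {inverse x}) (\<lambda>ys. zpow k (inverse x) * h ys) / (\<Prod>y\<in>inverse ` Z - {inverse x}. y - inverse x) =
      (-1) ^ N * (\<Prod>Z) * (symsum ?Y (\<lambda>ys. zpow (int N - 1 - k) x * h ys) / (\<Prod>y\<in>?Y. y - x))"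
      unfolding Y symsum_cmult h[OF Diff_subset card] 1 2 3 using x0
      by (simp add: divide_inverse 4 mult_ac)
  qed
  also have "\<dots> = (-1) ^ N * (\<Prod>Z) * symsum Z (\<lambda>xs. zpow (int N - 1 - k) (hd xs) * h (tl xs))"
    using assms Z by (simp add: symsum_Cons[of Z] sum_distrib_left)
  finally show ?thesis .
qed

text \<open>The inverted progression is one with offset \<open>- N\<close>, which has the same
  limit, and the product of all points tends to 1.\<close>

lemma bare_limit_refl:
  assumes N: "N = length (P_factors t s)"
    and h: "\<And>Y. finite Y \<Longrightarrow> 0 \<notin> Y \<Longrightarrow> card Y = N \<Longrightarrow>
      symsum (inverse ` Y) (\<lambda>ys. evals (P_factors t s) ys * weight asm_wt ys) = symsum Y (\<lambda>ys. evals (P_factors t s) ys * weight asm_wt ys)"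
  shows "bare_limit t s k = (-1) ^ N * bare_limit t s (int N - 1 - k)"
proof -
  let ?h = "\<lambda>ys. evals (P_factors t s) ys * weight asm_wt ys"
  let ?f = "\<lambda>k xs. zpow k (hd xs) * ?h (tl xs)"
  have "((\<lambda>q. symsum (qpoints (Suc N) (- int N) q) (?f k)) \<longlongrightarrow> bare_limit t s k) (at_right 1)"
    unfolding bare_limit_def N by (rule q_limit_tendsto[OF laurent_bare_limit])
  moreover have "eventually (\<lambda>q. symsum (qpoints (Suc N) (- int N) q) (?f k) =
      (-1) ^ N * (\<Prod>i<Suc N. complex_of_real q powi (0 + int i)) * symsum (qpoints (Suc N) 0 q) (?f (int N - 1 - k))) (at_right 1)"
    using eventually_at_right_less[of "1::real"]
  proof eventually_elim
    case (elim q)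
    have "\<Prod>(qpoints (Suc N) 0 q) = (\<Prod>i<Suc N. complex_of_real q powi (0 + int i))"
      unfolding qpoints_def by (subst prod.reindex[OF qpoints_inj[OF elim]]) simp
    then show ?case
      unfolding qpoints_inverse[symmetric] using elim
      by (subst symsum_hd_inverse[where N = N]) (auto intro!: h intro: finite_subset dest: zero_notin_qpoints[THEN notE, rotated])
  qed
  ultimately have "((\<lambda>q. (-1) ^ N * (\<Prod>i<Suc N. complex_of_real q powi (0 + int i)) * symsum (qpoints (Suc N) 0 q) (?f (int N - 1 - k)))
     \<longlongrightarrow> bare_limit t s k) (at_right 1)"
    by (rule Lim_transform_eventually)
  moreover have "((\<lambda>q. (-1) ^ N * (\<Prod>i<Suc N. complex_of_real q powi (0 + int i)) * symsum (qpoints (Suc N) 0 q) (?f (int N - 1 - k)))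
     \<longlongrightarrow> (-1) ^ N * (\<Prod>i<Suc N. 1) * bare_limit t s (int N - 1 - k)) (at_right 1)"
    unfolding bare_limit_def N by (intro tendsto_mult tendsto_const tendsto_prod tendsto_powi_1 q_limit_tendsto[OF laurent_bare_limit])
  ultimately show ?thesis
    using tendsto_unique[OF trivial_limit_at_right_real] by fastforce
qed

section \<open>Difference operators and the reflection of the antidifference\<close>

definition bdiff :: "(int \<Rightarrow> 'a::ab_group_add) \<Rightarrow> int \<Rightarrow> 'a" where
  "bdiff f k = f k - f (k + 1)"

lemma bdiff_pow_diff: "(bdiff ^^ m) (\<lambda>k. f k - g k) = (\<lambda>k. (bdiff ^^ m) f k - (bdiff ^^ m) g k)"
proof (induction m)
  case (Suc m) then show ?case by (auto simp: bdiff_def)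
qed simp

lemma bdiff_pow_refl:
  "(bdiff ^^ m) f = (\<lambda>k. 0) \<Longrightarrow> (bdiff ^^ m) (\<lambda>k. a * f (c - k)) = (\<lambda>k. 0 :: 'a::comm_ring_1)"
proof (induction m arbitrary: f a c)
  case 0 then have "f k = 0" for k by (simp add: fun_eq_iff)
  then show ?case by simp
next
  case (Suc m)
  have "bdiff (\<lambda>k. a * f (c - k)) = (\<lambda>k. - a * bdiff f ((c - 1) - k))"
    by (auto simp: bdiff_def algebra_simps fun_eq_iff)
  with Suc.IH[of "bdiff f" "- a" "c - 1"] Suc.prems show ?case
    by (simp add: funpow_Suc_right del: funpow.simps)
qed

text \<open>With the shift \<open>E\<close>, the second assumption reads
  \<open>(1 - E bdiff) G = 0\<close>, and \<open>1 - E bdiff\<close> is unipotent where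
  \<open>bdiff\<close> is nilpotent. The recursion alone has non-zero solutions of period 6.\<close>

lemma bdiff_nilpotent_zero:
  assumes "(bdiff ^^ m) G = (\<lambda>k. 0)" "\<And>k. G k - G (k + 1) + G (k + 2) = (0 :: 'a::ab_group_add)"
  shows "G k = 0"
  using assms
proof (induction m arbitrary: G k)
  case 0 then show ?case by (simp add: fun_eq_iff)
next
  case (Suc m)
  have "bdiff G k = 0" for k
  proof (rule Suc.IH)
    show "(bdiff ^^ m) (bdiff G) = (\<lambda>k. 0)" using Suc.prems(1) by (simp add: funpow_Suc_right del: funpow.simps)
    show "bdiff G k - bdiff G (k + 1) + bdiff G (k + 2) = 0" for k
      using Suc.prems(2)[of k] Suc.prems(2)[of "k + 1"] by (simp add: bdiff_def algebra_simps)
  qed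
  then have "G (k + 1) = G k" for k by (simp add: bdiff_def)
  then have "G (k + 1) = G k" "G (k + 2) = G k" using spec[of _ "k + 1"]
    by (auto simp: add.assoc) (metis add.assoc one_add_one)
  with Suc.prems(2)[of k] show ?case by simp
qed

text \<open>Each step of the recursion shortens the row until \<open>interlace []\<close>, which is
  empty, is reached. For increasing \<open>xs\<close> this means that enough differences annihilate
  \<open>trap_value\<close>: it is polynomial in \<open>k\<close>.\<close>

lemma trap_value_0: "length xs < j \<Longrightarrow> trap_value j k xs = 0"
proof (induction j arbitrary: xs)
  case (Suc j)
  have "trap_value j k ls = 0" if "ls \<in> interlace xs" for ls
    using length_interlace[OF that] Suc.prems by (intro Suc.IH) auto
  then show ?case by simp
qed simp

lemma bdiff_trap_value: "sorted_wrt (<) xs \<Longrightarrow> (bdiff ^^ m) (\<lambda>k. trap_value j k xs) = (\<lambda>k. trap_value (j + m) k xs)"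
  by (induction m arbitrary: j) (auto simp: bdiff_def[abs_def] trap_value_diff simp del: trap_value.simps)

lemma bdiff_Psi: "(bdiff ^^ s) (Psi t s) = Psi t 0"
proof (induction s)
  case (Suc s)
  have "bdiff (Psi t (Suc s)) = Psi t s" by (auto simp: bdiff_def[abs_def] Psi_diff)
  with Suc show ?case by (simp add: funpow_Suc_right del: funpow.simps)
qed simp

lemma sorted_X: "sorted_wrt (<) (map (\<lambda>j. 2 * int j - int t) [1..<t])"
  by (simp add: sorted_wrt_map)

text \<open>The reflection is known for \<open>bare_limit\<close>, the image of \<open>Psi\<close>
  under \<open>1 - E + E^2\<close>. The coefficients of this operator are palindromic, so it
  respects the reflection once \<open>N - 1 - k\<close> is replaced by \<open>N + 1 - k\<close>;
  injectivity then removes it.\<close>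

lemma Psi_refl:
  assumes N: "N = length (P_factors t s)"
    and h: "\<And>Y. finite Y \<Longrightarrow> 0 \<notin> Y \<Longrightarrow> card Y = N \<Longrightarrow>
      symsum (inverse ` Y) (\<lambda>ys. evals (P_factors t s) ys * weight asm_wt ys) = symsum Y (\<lambda>ys. evals (P_factors t s) ys * weight asm_wt ys)"
  shows "Psi t s k = (-1) ^ N * Psi t s (int N + 1 - k)"
proof -
  let ?X = "map (\<lambda>j. 2 * int j - int t) [1..<t]"
  have "(bdiff ^^ (Suc (length ?X) + s)) (Psi t s) = (\<lambda>k. 0)"
    unfolding funpow_add comp_def bdiff_Psi Psi_0[abs_def] bdiff_trap_value[OF sorted_X] by (simp add: trap_value_0 del: trap_value.simps)
  then have z: "(bdiff ^^ (Suc (length ?X) + s)) (\<lambda>k. Psi t s k - (-1) ^ N * Psi t s (int N + 1 - k)) = (\<lambda>k. 0)"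
    unfolding bdiff_pow_diff by (simp only: bdiff_pow_refl diff_self)
  have "Psi t s k - (-1) ^ N * Psi t s (int N + 1 - k) = 0"
  proof (rule bdiff_nilpotent_zero[OF z])
    fix k
    have idx: "int N + 1 - (k + 1) = int N - k" "int N + 1 - (k + 2) = int N - 1 - k"
      and idx': "int N - 1 - k + 1 = int N - k" "int N - 1 - k + 2 = int N + 1 - k" by auto
    have "Psi t s k - Psi t s (k + 1) + Psi t s (k + 2) = bare_limit t s k" by (rule Psi_bare_limit)
    also have "bare_limit t s k = (-1) ^ N * bare_limit t s (int N - 1 - k)" by (rule bare_limit_refl[OF N h])
    also have "bare_limit t s (int N - 1 - k) = Psi t s (int N - 1 - k) - Psi t s (int N - k) + Psi t s (int N + 1 - k)"
      using Psi_bare_limit[of t s "int N - 1 - k"] unfolding idx' by (rule sym)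
    finally have "Psi t s k - Psi t s (k + 1) + Psi t s (k + 2) =
      (-1) ^ N * Psi t s (int N - 1 - k) - (-1) ^ N * Psi t s (int N - k) + (-1) ^ N * Psi t s (int N + 1 - k)"
      by (simp only: right_diff_distrib distrib_left)
    then show "Psi t s k - (- 1) ^ N * Psi t s (int N + 1 - k) -
      (Psi t s (k + 1) - (- 1) ^ N * Psi t s (int N + 1 - (k + 1))) +
      (Psi t s (k + 2) - (- 1) ^ N * Psi t s (int N + 1 - (k + 2))) = 0"
      unfolding idx by (simp only: algebra_simps) (simp add: algebra_simps)
  qed
  then show ?thesis by simp
qed

section \<open>Comparison with \<open>P\<close> and \<open>R\<close>\<close>

lemma evals_prod: "length gs = length xs \<Longrightarrow> evals gs xs = (\<Prod>i<length xs. (gs ! i) (xs ! i))"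
proof (induction xs arbitrary: gs)
  case (Cons x xs)
  then obtain g gs' where "gs = g # gs'" by (cases gs) auto
  with Cons show ?case by (simp add: prod.lessThan_Suc_shift del: prod.lessThan_Suc)
qed simp

lemma P_factors_nth:
  "j < s + (t - 1) \<Longrightarrow> (P_factors t s ! j) z =
    (if j < s then z powi (2 * int s - 2 * int (Suc j) - int t + 1) * (1 - inverse z) ^ j
     else z powi (2 * int (Suc j) - 2 * int s - int t) * (1 - inverse z) ^ s)"
proof (induction s arbitrary: j)
  case 0 then show ?case by simp
next
  case (Suc s)
  show ?case
  proof (cases j)
    case 0 then show ?thesis by simp
  next
    case (Suc i)
    with Suc.prems have i: "i < s + (t - 1)" by simp
    show ?thesis unfolding Suc using i Suc.IH[OF i] by (simp add: length_gs algebra_simps)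
  qed
qed

lemma weight_vdm_prod_prod:
  assumes "a \<le> Suc m"
  shows "weight \<omega> (map w [a..<Suc m]) / vdm_prod (map w [a..<Suc m]) =
    (\<Prod>p\<in>{a..m}. \<Prod>q\<in>{Suc p..m}. \<omega> (w p) (w q) / (w q - w p :: 'a::field))"
  using assms
proof (induction rule: inc_induct)
  case base then show ?case by simp
next
  case (step a)
  have l: "[a..<Suc m] = a # [Suc a..<Suc m]" using step by (simp add: upt_rec)
  have set: "{a..m} = insert a {Suc a..m}" using step by auto
  have pl: "(\<Prod>y\<leftarrow>map w [Suc a..<Suc m]. f y) = (\<Prod>q\<in>{Suc a..m}. f (w q))" for f :: "'a \<Rightarrow> 'a"
    by (simp add: prod.distinct_set_conv_list[symmetric] comp_def atLeastLessThanSuc_atLeastAtMost del: upt_Suc)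
  show ?case
    unfolding l list.map weight.simps vdm_prod.simps pl set times_divide_times_eq[symmetric] step.IH
    by (simp add: prod_dividef)
qed

lemma P_evals:
  assumes "1 \<le> t"
  shows "P s t w = evals (P_factors t s) (map w [1..<Suc (s + t - 1)]) * weight asm_wt (map w [1..<Suc (s + t - 1)])
     / vdm_prod (map w [1..<Suc (s + t - 1)])"
proof -
  define m where "m = s + t - 1"
  have m: "m = s + (t - 1)" using assms by (simp add: m_def)
  let ?F = "\<lambda>i. if i \<le> s then w i powi (2 * int s - 2 * int i - int t + 1) * (1 - inverse (w i)) ^ (i - 1)
     else w i powi (2 * int i - 2 * int s - int t) * (1 - inverse (w i)) ^ s"
  have "evals (P_factors t s) (map w [1..<Suc m]) = (\<Prod>i<m. ?F (Suc i))"
    by (subst evals_prod) (auto simp: length_gs m P_factors_nth simp del: upt_Suc of_nat_Suc intro!: prod.cong)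
  also have "\<dots> = (\<Prod>i\<in>{1..m}. ?F i)"
    by (rule prod.reindex_bij_witness[of _ "\<lambda>i. i - 1" Suc]) auto
  also have "{1..m} = {1..s} \<union> {s + 1..m}" using m by auto
  also have "(\<Prod>i\<in>\<dots>. ?F i) = (\<Prod>i=1..s. ?F i) * (\<Prod>i=s+1..m. ?F i)"
    by (rule prod.union_disjoint) auto
  also have "(\<Prod>i=1..s. ?F i) = (\<Prod>i=1..s. w i powi (2 * int s - 2 * int i - int t + 1) * (1 - inverse (w i)) ^ (i - 1))"
    by (rule prod.cong) auto
  also have "(\<Prod>i=s+1..m. ?F i) = (\<Prod>i=s+1..m. w i powi (2 * int i - 2 * int s - int t) * (1 - inverse (w i)) ^ s)"
    by (rule prod.cong) auto
  finally have 1: "evals (P_factors t s) (map w [1..<Suc m]) =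
    (\<Prod>i=1..s. w i powi (2 * int s - 2 * int i - int t + 1) * (1 - inverse (w i)) ^ (i - 1)) *
    (\<Prod>i=s+1..m. w i powi (2 * int i - 2 * int s - int t) * (1 - inverse (w i)) ^ s)" .
  have "weight asm_wt (map w [1..<Suc m]) / vdm_prod (map w [1..<Suc m]) =
     (\<Prod>p\<in>{1..m}. \<Prod>q\<in>{Suc p..m}. asm_wt (w p) (w q) / (w q - w p))"
    by (rule weight_vdm_prod_prod) simp
  also have "\<dots> = (\<Prod>(p, q)\<in>Sigma {1..m} (\<lambda>p. {Suc p..m}). asm_wt (w p) (w q) / (w q - w p))"
    by (rule prod.Sigma) auto
  also have "Sigma {1..m} (\<lambda>p. {Suc p..m}) = {(p, q). 1 \<le> p \<and> p < q \<and> q \<le> m}" by auto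
  also have "(\<Prod>(p, q) | 1 \<le> p \<and> p < q \<and> q \<le> m. asm_wt (w p) (w q) / (w q - w p)) =
     (\<Prod>(p, q) | 1 \<le> p \<and> p < q \<and> q \<le> m. (1 - w p + w p * w q) / (w q - w p))"
    by (rule prod.cong) (auto simp: asm_wt_def)
  finally have 2: "weight asm_wt (map w [1..<Suc m]) / vdm_prod (map w [1..<Suc m]) =
     (\<Prod>(p, q) | 1 \<le> p \<and> p < q \<and> q \<le> m. (1 - w p + w p * w q) / (w q - w p))" .
  show ?thesis
    unfolding P_def m_def[symmetric] 1 times_divide_eq_right[symmetric] 2 ..
qed

lemma bij_betw_permutes_lists:
  assumes "inj_on z {1..m::nat}"
  shows "bij_betw (\<lambda>\<sigma>. map (\<lambda>k. z (\<sigma> k)) [1..<Suc m]) {\<sigma>. \<sigma> permutes {1..m}} (permutations_of_set (z ` {1..m}))"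
proof -
  let ?f = "\<lambda>\<sigma>. map (\<lambda>k. z (\<sigma> k)) [1..<Suc m]"
  have set: "set [1..<Suc m] = {1..m}" by auto
  have inj: "inj_on ?f {\<sigma>. \<sigma> permutes {1..m}}"
  proof (rule inj_onI, rule ext)
    fix \<sigma> \<tau> k assume st: "\<sigma> \<in> {\<sigma>. \<sigma> permutes {1..m}}" "\<tau> \<in> {\<sigma>. \<sigma> permutes {1..m}}" "?f \<sigma> = ?f \<tau>"
    show "\<sigma> k = \<tau> k"
    proof (cases "k \<in> {1..m}")
      case True
      then have "z (\<sigma> k) = z (\<tau> k)" using st(3) unfolding map_eq_conv set by blast
      moreover have "\<sigma> k \<in> {1..m}" "\<tau> k \<in> {1..m}"
        using st(1,2) True permutes_in_image[of \<sigma> "{1..m}" k] permutes_in_image[of \<tau> "{1..m}" k] by auto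
      ultimately show ?thesis by (rule inj_onD[OF assms])
    next
      case False then show ?thesis using st(1,2) by (simp add: permutes_not_in)
    qed
  qed
  have sub: "?f ` {\<sigma>. \<sigma> permutes {1..m}} \<subseteq> permutations_of_set (z ` {1..m})"
  proof
    fix xs assume "xs \<in> ?f ` {\<sigma>. \<sigma> permutes {1..m}}"
    then obtain \<sigma> where \<sigma>: "\<sigma> permutes {1..m}" and xs: "xs = ?f \<sigma>" by auto
    have "set xs = z ` \<sigma> ` {1..m}" unfolding xs set_map set by (simp add: image_image)
    moreover have "inj_on (z \<circ> \<sigma>) {1..m}"
      by (rule comp_inj_on[OF permutes_inj_on[OF \<sigma>]]) (simp only: permutes_image[OF \<sigma>] assms)
    then have "distinct xs" unfolding xs distinct_map set by (simp add: comp_def)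
    ultimately show "xs \<in> permutations_of_set (z ` {1..m})"
      using permutes_image[OF \<sigma>] by auto
  qed
  have "card (?f ` {\<sigma>. \<sigma> permutes {1..m}}) = card (permutations_of_set (z ` {1..m}))"
    using card_image[OF inj] card_image[OF assms] by (simp add: card_permutations)
  then have "?f ` {\<sigma>. \<sigma> permutes {1..m}} = permutations_of_set (z ` {1..m})"
    by (intro card_subset_eq sub) auto
  with inj show ?thesis by (simp add: bij_betw_def)
qed

lemma R_symsum:
  assumes "1 \<le> t" "inj_on z {1..s + t - 1}"
  shows "R s t z = symsum (z ` {1..s + t - 1}) (\<lambda>xs. evals (P_factors t s) xs * weight asm_wt xs)"
  unfolding R_def Sym_def symsum_def P_evals[OF assms(1)]
  by (rule sum.reindex_bij_betw[OF bij_betw_permutes_lists[OF assms(2)]])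

lemma symsum_inverse:
  assumes R: "\<And>z :: nat \<Rightarrow> complex. z \<in> R_domain s t \<Longrightarrow> R s t z = R s t (\<lambda>k. inverse (z k))"
    and t: "1 \<le> t" and Y: "finite Y" "0 \<notin> Y" "card Y = length (P_factors t s)"
  shows "symsum (inverse ` Y) (\<lambda>ys. evals (P_factors t s) ys * weight asm_wt ys) = symsum Y (\<lambda>ys. evals (P_factors t s) ys * weight asm_wt ys)"
proof -
  let ?m = "s + t - 1"
  have "card Y = card {1..?m}" using Y t by (simp add: length_gs)
  then obtain z where z: "bij_betw z {1..?m} Y"
    using Y(1) finite_same_card_bij[of "{1..?m}" Y] by auto
  then have inj: "inj_on z {1..?m}" and im: "z ` {1..?m} = Y" by (auto simp: bij_betw_def)
  have "z \<in> R_domain s t" using inj im Y(2) by (auto simp: R_domain_def)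
  note Rz = R[OF this]
  have inj': "inj_on (\<lambda>k. inverse (z k)) {1..?m}" using inj by (auto simp: inj_on_def)
  have "symsum (inverse ` Y) (\<lambda>ys. evals (P_factors t s) ys * weight asm_wt ys) = R s t (\<lambda>k. inverse (z k))"
    unfolding R_symsum[OF t inj'] by (simp only: im[symmetric] image_image)
  also have "\<dots> = R s t z" by (rule Rz[symmetric])
  also have "\<dots> = symsum Y (\<lambda>ys. evals (P_factors t s) ys * weight asm_wt ys)"
    unfolding R_symsum[OF t inj] by (simp only: im)
  finally show ?thesis .
qed

section \<open>Newton series with a palindrome and a reflection\<close>

text \<open>The rows \<open>m = 0, 1, ..\<close> are successive antidifferences, and
  \<open>A m\<close> is the value of row \<open>m\<close> at 0; the signs come from taking
  differences as \<open>f k - f (k + 1)\<close>.\<close>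

definition newton_sum :: "(int \<Rightarrow> complex) \<Rightarrow> nat \<Rightarrow> int \<Rightarrow> complex" where
  "newton_sum A m x = (\<Sum>j\<le>m. (-1) ^ j * A (int m - int j) * (of_int x gchoose j))"

lemma int_fun_const: "(\<And>k. f k = f (k + 1)) \<Longrightarrow> f (x :: int) = f y"
proof -
  assume step: "\<And>k. f k = f (k + 1)"
  have "f x = f 0" for x
  proof (induction x rule: int_induct[where k = 0])
    case (step2 i) then show ?case using step[of "i - 1"] by simp
  qed (use step in auto)
  then show ?thesis by metis
qed

lemma newton_sum_at_0: "newton_sum A m 0 = A (int m)"
proof -
  have "newton_sum A m 0 = (\<Sum>j\<le>m. if j = 0 then A (int m) else 0)"
    unfolding newton_sum_def by (intro sum.cong refl) (auto simp: gbinomial_0_left)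
  then show ?thesis by simp
qed

lemma newton_sum_diff: "newton_sum A (Suc m) x - newton_sum A (Suc m) (x + 1) = newton_sum A m x"
proof -
  have "newton_sum A (Suc m) x - newton_sum A (Suc m) (x + 1) =
    (\<Sum>j\<le>Suc m. (-1) ^ j * A (int (Suc m) - int j) * ((of_int x gchoose j) - (of_int x + 1 gchoose j)))"
    unfolding newton_sum_def by (simp add: sum_subtractf right_diff_distrib del: sum.atMost_Suc)
  also have "\<dots> = (\<Sum>j\<le>m. (-1) ^ Suc j * A (int m - int j) * ((of_int x gchoose Suc j) - (of_int x + 1 gchoose Suc j)))"
    by (subst sum.atMost_Suc_shift) simp
  also have "\<dots> = newton_sum A m x"
    unfolding newton_sum_def by (intro sum.cong refl) (simp add: gbinomial_Suc_Suc)
  finally show ?thesis .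
qed

lemma newton_sum_0: "newton_sum A 0 x = A 0"
  by (simp add: newton_sum_def)

text \<open>Summing to \<open>k\<close> instead of \<open>m\<close> makes the range independent of
  the row, so that it can be reversed in \<open>newton_sum_flip\<close>.\<close>

lemma newton_sum_nat:
  assumes "\<And>i. i < 0 \<Longrightarrow> A i = 0"
  shows "newton_sum A m (int k) = (\<Sum>j\<le>k. (-1) ^ j * A (int m - int j) * of_nat (k choose j))"
proof -
  have "newton_sum A m (int k) = (\<Sum>j\<le>m. (-1) ^ j * A (int m - int j) * of_nat (k choose j))"
    by (simp add: newton_sum_def binomial_gbinomial)
  also have "\<dots> = (\<Sum>j\<le>max m k. (-1) ^ j * A (int m - int j) * of_nat (k choose j))"
    by (rule sum.mono_neutral_left) (auto simp: assms)
  also have "\<dots> = (\<Sum>j\<le>k. (-1) ^ j * A (int m - int j) * of_nat (k choose j))"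
    by (rule sum.mono_neutral_right) (auto simp: binomial_eq_0)
  finally show ?thesis .
qed

text \<open>A row is determined by the previous one up to a constant; one common value fixes it, at
  a point that may differ from row to row.\<close>

lemma newton_sum_unique:
  assumes "\<And>k. F 0 k = F 0 (k + 1)"
    and "\<And>m k. m < M \<Longrightarrow> F (Suc m) k - F (Suc m) (k + 1) = F m k"
    and "\<And>m. m \<le> M \<Longrightarrow> \<exists>x. F m x = newton_sum A m x"
  shows "m \<le> M \<Longrightarrow> F m k = newton_sum A m k"
proof (induction m arbitrary: k)
  case 0
  obtain x where "F 0 x = newton_sum A 0 x" using assms(3) 0 by blast
  then show ?case using int_fun_const[of "F 0" k x] assms(1) by (simp add: newton_sum_0)
next
  case (Suc m)
  obtain x where x: "F (Suc m) x = newton_sum A (Suc m) x" using assms(3) Suc by blast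
  let ?g = "\<lambda>k. F (Suc m) k - newton_sum A (Suc m) k"
  have "?g k = ?g (k + 1)" for k
    using assms(2)[of m k] Suc newton_sum_diff[of A m k] by (simp add: algebra_simps)
  from int_fun_const[of ?g, OF this, of k x] x show ?case by simp
qed

lemma newton_coeffs_zero:
  assumes "\<And>k::nat. (\<Sum>j\<le>d. c j * (of_nat k gchoose j)) = (0::complex)" "j \<le> d"
  shows "c j = 0"
  using assms(2)
proof (induction j rule: less_induct)
  case (less j)
  have "0 = (\<Sum>i\<le>d. c i * (of_nat j gchoose i))" using assms(1)[of j] by simp
  also have "\<dots> = (\<Sum>i\<le>d. if i = j then c j else 0)"
  proof (rule sum.cong[OF refl])
    fix i assume "i \<in> {..d}"
    consider "i < j" | "i = j" | "i > j" by linarith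
    then show "c i * (of_nat j gchoose i) = (if i = j then c j else 0)"
      by cases (use less \<open>i \<in> {..d}\<close> in \<open>auto simp: binomial_gbinomial[symmetric] binomial_eq_0\<close>)
  qed
  also have "\<dots> = c j" using less.prems by simp
  finally show ?case by simp
qed

lemma newton_zero_if_roots:
  assumes "finite Z" "card Z > d" "\<And>x. x \<in> Z \<Longrightarrow> (\<Sum>j\<le>d. c j * (x gchoose j)) = (0::complex)" "j \<le> d"
  shows "c j = 0"
proof -
  define p where "p = (\<Sum>j\<le>d. smult (c j / fact j) (\<Prod>i<j. [:- of_nat i, 1:]))"
  have poly_p: "poly p x = (\<Sum>j\<le>d. c j * (x gchoose j))" for x
    unfolding p_def poly_sum poly_smult poly_prod gbinomial_prod_rev
    by (intro sum.cong refl) (auto simp: atLeast0LessThan)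
  have "degree p \<le> d"
    unfolding p_def
  proof (rule degree_sum_le)
    fix j assume j: "j \<in> {..d}"
    have "degree (\<Prod>i<j. [:- of_nat i, 1::complex:]) = j"
      by (subst degree_prod_eq_sum_degree) auto
    then show "degree (smult (c j / fact j) (\<Prod>i<j. [:- of_nat i, 1::complex:])) \<le> d"
      using j by (auto intro: order.trans[OF degree_smult_le])
  qed auto
  moreover have "Z \<subseteq> {x. poly p x = 0}" using assms(3) poly_p by auto
  ultimately have "p = 0"
    using assms(2) card_mono[OF poly_roots_finite, of p Z] card_poly_roots_bound[of p] by linarith
  then have "(\<Sum>j\<le>d. c j * (x gchoose j)) = 0" for x using poly_p[of x] by simp
  then show ?thesis using newton_coeffs_zero[of c d j] assms(4) by simp
qed

text \<open>Vandermonde for \<open>(x - L) + (- (L + 1))\<close>; the binomial of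
  \<open>x - L\<close> over \<open>r\<close> merges with \<open>x gchoose L\<close> into
  \<open>x gchoose (L + r)\<close>. The left-hand side is built to have the zeros
  \<open>0, .., L - 1\<close> and \<open>2 * L + 1, .., 3 * L\<close> that occur in
  \<open>solution\<close>.\<close>

lemma gbinomial_product_newton:
  fixes x :: complex
  shows "(x gchoose L) * ((x - of_nat (2 * L + 1)) gchoose L) =
    (\<Sum>r\<le>L. (-1) ^ (L - r) * of_nat (((L + r) choose L) * ((2 * L - r) choose L)) * (x gchoose (L + r)))"
proof -
  have e: "(x - of_nat L) + (- of_nat (L + 1)) = x - of_nat (2 * L + 1)" by simp
  have "(x gchoose L) * ((x - of_nat (2 * L + 1)) gchoose L) =
    (\<Sum>r=0..L. (x gchoose L) * (((x - of_nat L) gchoose r) * ((- of_nat (L + 1)) gchoose (L - r))))"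
    unfolding e[symmetric] gbinomial_Vandermonde[symmetric] sum_distrib_left ..
  also have "\<dots> = (\<Sum>r=0..L. (-1) ^ (L - r) * of_nat (((L + r) choose L) * ((2 * L - r) choose L)) * (x gchoose (L + r)))"
  proof (intro sum.cong refl)
    fix r assume "r \<in> {0..L}"
    then have r: "r \<le> L" by simp
    have 1: "(x gchoose L) * ((x - of_nat L) gchoose r) = (x gchoose (L + r)) * of_nat ((L + r) choose L)"
      using gbinomial_trinomial_revision[of L "L + r" x] by (simp add: binomial_gbinomial)
    have "((- of_nat (L + 1)) gchoose (L - r)) = (-1) ^ (L - r) * ((of_nat (L - r) - (- of_nat (L + 1)) - 1) gchoose (L - r) :: complex)"
      by (rule gbinomial_negated_upper)
    also have "(of_nat (L - r) - (- of_nat (L + 1)) - 1 :: complex) = of_nat (2 * L - r)"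
      using r by (simp add: of_nat_diff)
    also have "(of_nat (2 * L - r) gchoose (L - r) :: complex) = of_nat ((2 * L - r) choose L)"
    proof -
      have "2 * L - r - (L - r) = L" using r by simp
      then have "(2 * L - r) choose (L - r) = (2 * L - r) choose L"
        using binomial_symmetric[of "L - r" "2 * L - r"] by simp
      then show ?thesis by (simp only: binomial_gbinomial[symmetric])
    qed
    finally show "(x gchoose L) * (((x - of_nat L) gchoose r) * ((- of_nat (L + 1)) gchoose (L - r))) =
       (-1) ^ (L - r) * of_nat (((L + r) choose L) * ((2 * L - r) choose L)) * (x gchoose (L + r))"
      using 1 by (simp add: mult_ac)
  qed
  finally show ?thesis by (simp add: atLeast0AtMost)
qed

locale palindrome =
  fixes L :: nat and A :: "int \<Rightarrow> complex"
  assumes odd_L: "odd L"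
    and A_sym: "A (int L - i) = A i"
    and A_neg: "i < 0 \<Longrightarrow> A i = 0"
begin

lemma A_gt: "i > int L \<Longrightarrow> A i = 0"
  using A_sym[of i] A_neg[of "int L - i"] by simp

lemma newton_sum_nat': "newton_sum A m (int k) = (\<Sum>j\<le>k. (-1) ^ j * A (int m - int j) * of_nat (k choose j))"
  by (rule newton_sum_nat) (rule A_neg)

text \<open>Reversing the \<open>k + 1\<close> terms of the alternating sum: on pairs of a row and
  an argument \<open>k \<ge> 0\<close> the palindrome acts by taking \<open>(m, k)\<close> to
  \<open>(L + k - m, k)\<close>.\<close>

lemma newton_sum_flip:
  assumes "m + m' = L + k"
  shows "newton_sum A m (int k) = (-1) ^ k * newton_sum A m' (int k)"
proof -
  have "newton_sum A m (int k) = (\<Sum>j\<le>k. (-1) ^ (k - j) * A (int m - int (k - j)) * of_nat (k choose (k - j)))"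
    unfolding newton_sum_nat' by (rule sum.reindex_bij_witness[of _ "\<lambda>j. k - j" "\<lambda>j. k - j"]) auto
  also have "\<dots> = (\<Sum>j\<le>k. (-1) ^ k * ((-1) ^ j * A (int m' - int j) * of_nat (k choose j)))"
  proof (rule sum.cong[OF refl])
    fix j assume "j \<in> {..k}"
    then have j: "j \<le> k" by simp
    have "A (int m - int (k - j)) = A (int m' - int j)"
      using A_sym[of "int m' - int j"] assms j by (simp add: of_nat_diff algebra_simps) (smt (verit) of_nat_add)
    moreover have "(-1) ^ (k - j) = ((-1) ^ k * (-1) ^ j :: complex)"
      using j by (auto simp: power_diff minus_one_power_iff)
    ultimately show "(-1) ^ (k - j) * A (int m - int (k - j)) * of_nat (k choose (k - j)) =
       (-1) ^ k * ((-1) ^ j * A (int m' - int j) * of_nat (k choose j))"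
      using binomial_symmetric[OF j] by simp
  qed
  finally show ?thesis by (simp add: newton_sum_nat' sum_distrib_left)
qed

text \<open>A fixed point of \<open>newton_sum_flip\<close> at an odd argument, where the sign is
  -1. These are the zeros known from \<open>Psi_zero\<close>, which is how the palindrome meets the
  antidifferences of the triangle count.\<close>

lemma newton_sum_zero:
  assumes "L \<le> 2 * m"
  shows "newton_sum A m (2 * int m - int L) = 0"
proof -
  have k: "2 * int m - int L = int (2 * m - L)" using assms by (simp add: of_nat_diff)
  have "odd (2 * m - L)" using odd_L assms by simp
  then have "newton_sum A m (2 * int m - int L) = - newton_sum A m (2 * int m - int L)"
    unfolding k using newton_sum_flip[of m m "2 * m - L"] assms by simp
  then show ?thesis by simp
qed

text \<open>The centre of reflection moves by one half from row to row because
  \<open>f x - f (x + 1)\<close> involves two neighbouring arguments.\<close>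

definition parity :: "nat \<Rightarrow> bool" where
  "parity m \<longleftrightarrow> (\<forall>x. newton_sum A m x = (-1) ^ m * newton_sum A m (int L + int m - x))"

lemma parD: "parity m \<Longrightarrow> newton_sum A m x = (-1) ^ m * newton_sum A m (int L + int m - x)"
  unfolding parity_def by blast

lemma parity_down:
  assumes "parity (Suc m)" shows "parity m"
  unfolding parity_def
proof
  fix x
  have a: "newton_sum A (Suc m) x = (-1) ^ Suc m * newton_sum A (Suc m) (int L + int (Suc m) - x)"
    and b: "newton_sum A (Suc m) (x + 1) = (-1) ^ Suc m * newton_sum A (Suc m) (int L + int (Suc m) - (x + 1))"
    by (rule parD[OF assms])+
  have i: "int L + int (Suc m) - x = (int L + int m - x) + 1" "int L + int (Suc m) - (x + 1) = int L + int m - x" by auto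
  have "newton_sum A m x = newton_sum A (Suc m) x - newton_sum A (Suc m) (x + 1)" by (rule newton_sum_diff[symmetric])
  also have "\<dots> = (-1) ^ m * (newton_sum A (Suc m) (int L + int m - x) - newton_sum A (Suc m) ((int L + int m - x) + 1))"
    unfolding a b i by (simp add: algebra_simps)
  also have "\<dots> = (-1) ^ m * newton_sum A m (int L + int m - x)" unfolding newton_sum_diff ..
  finally show "newton_sum A m x = (-1) ^ m * newton_sum A m (int L + int m - x)" .
qed

lemma parity_le: "parity m \<Longrightarrow> m' \<le> m \<Longrightarrow> parity m'"
  by (induction m arbitrary: m') (auto simp: le_Suc_eq parity_down)

text \<open>The step from \<open>m\<close> to \<open>Suc m\<close> determines the reflection up to a constant. The constant is
  evaluated at \<open>x = L\<close>, where both reflections lead back to the row \<open>L\<close>.\<close>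

lemma parity_up:
  assumes "parity m" "L \<le> m" "Suc m \<le> 2 * L"
  shows "parity (Suc m)"
  unfolding parity_def
proof
  fix x
  define g where "g = (\<lambda>x. newton_sum A (Suc m) x - (-1) ^ Suc m * newton_sum A (Suc m) (int L + int (Suc m) - x))"
  have "g x = g (x + 1)" for x
  proof -
    define y where "y = int L + int m - x"
    have i: "int L + int (Suc m) - x = y + 1" "int L + int (Suc m) - (x + 1) = y" by (auto simp: y_def)
    have "newton_sum A m x = (-1) ^ m * newton_sum A m y" using parD[OF assms(1), of x] unfolding y_def .
    then show ?thesis unfolding g_def i
      using newton_sum_diff[of A m x] newton_sum_diff[of A m y] by (simp add: algebra_simps)
  qed
  then have "g x = g (int L)" by (rule int_fun_const)
  also have "g (int L) = 0"
  proof -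
    define m' where "m' = 2 * L - Suc m"
    have m': "Suc m + m' = L + L" "m' \<le> m" using assms by (auto simp: m'_def)
    have parL: "parity L" and parm': "parity m'" using parity_le[OF assms(1)] assms m' by auto
    have oL: "(-1) ^ L = (-1 :: complex)" using odd_L by simp
    \<comment> \<open>As pairs of row and argument, the path is \<open>(m + 1, L)\<close>,
      \<open>(m', L)\<close>, \<open>(m', m')\<close>, \<open>(L, m')\<close>,
      \<open>(L, m + 1)\<close>, \<open>(m + 1, m + 1)\<close>, alternating flips and known
      reflections. The claim is the reflection that closes this hexagon.\<close>
    have "newton_sum A (Suc m) (int L) = - newton_sum A m' (int L)"
      using newton_sum_flip[OF m'(1)] oL by simp
    also have "newton_sum A m' (int L) = (-1) ^ m' * newton_sum A m' (int L + int m' - int L)"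
      by (rule parD[OF parm'])
    also have "newton_sum A m' (int L + int m' - int L) = (-1) ^ m' * newton_sum A L (int m')"
      using newton_sum_flip[of m' L m'] by simp
    also have "newton_sum A L (int m') = - newton_sum A L (int L + int L - int m')"
      using parD[OF parL, of "int m'"] unfolding oL by simp
    also have "int L + int L - int m' = int (Suc m)" using m' by simp
    also have "newton_sum A L (int (Suc m)) = (-1) ^ Suc m * newton_sum A (Suc m) (int (Suc m))"
      by (rule newton_sum_flip) simp
    finally have "newton_sum A (Suc m) (int L) = (-1) ^ Suc m * newton_sum A (Suc m) (int (Suc m))"
      by (simp add: minus_one_power_iff)
    then show ?thesis by (simp add: g_def)
  qed
  finally show "newton_sum A (Suc m) x = (-1) ^ Suc m * newton_sum A (Suc m) (int L + int (Suc m) - x)"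
    unfolding g_def by (rule eq_iff_diff_eq_0[THEN iffD2])
qed

text \<open>Row \<open>2 * L\<close> vanishes at \<open>0, .., L - 1\<close> because
  \<open>A\<close> vanishes beyond \<open>L\<close>, and the reflection of \<open>x\<close> to
  \<open>3 * L - x\<close> carries these zeros to \<open>2 * L + 1, .., 3 * L\<close>.\<close>

lemma solution:
  assumes "\<And>x. newton_sum A L x = - newton_sum A L (2 * int L - x)" "m \<le> L"
  shows "of_nat ((2 * L) choose L) * A (int m) = A 0 * of_nat (((L + m) choose L) * ((2 * L - m) choose L))"
proof -
  have parL: "parity L"
    unfolding parity_def
  proof
    fix x
    have "(-1) ^ L = (-1 :: complex)" "int L + int L = 2 * int L" using odd_L by auto
    then show "newton_sum A L x = (-1) ^ L * newton_sum A L (int L + int L - x)"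
      using assms(1)[of x] by (simp only: mult_minus1)
  qed
  have "parity (L + k)" if "k \<le> L" for k
    using that by (induction k) (auto simp: parL intro: parity_up)
  then have par2: "parity (2 * L)" by (simp add: mult_2)
  define b where "b = (\<lambda>m. of_nat (((L + m) choose L) * ((2 * L - m) choose L)) :: complex)"
  \<comment> \<open>Newton coefficients of the combination of row \<open>2 * L\<close> and
    \<open>T\<close> whose top terms cancel: degree at most \<open>2 * L - 1\<close> then faces
    \<open>2 * L\<close> zeros.\<close>
  define c where "c = (\<lambda>j. (-1) ^ j * (b 0 * A (int (2 * L) - int j) - A 0 * (if L \<le> j then b (2 * L - j) else 0)))"
  define T where "T = (\<lambda>x::complex. (x gchoose L) * ((x - of_nat (2 * L + 1)) gchoose L))"
  have L0: "L > 0" using odd_L by (rule odd_pos)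
  have T_exp: "T x = (\<Sum>j\<le>2 * L. (-1) ^ j * (if L \<le> j then b (2 * L - j) else 0) * (x gchoose j))" for x
  proof -
    have "T x = (\<Sum>r\<le>L. (-1) ^ (L + r) * b (2 * L - (L + r)) * (x gchoose (L + r)))"
      unfolding T_def gbinomial_product_newton
    proof (intro sum.cong refl)
      fix r assume "r \<in> {..L}"
      then have r: "r \<le> L" by simp
      then have "(-1) ^ (L - r) = ((-1) ^ (L + r) :: complex)" by (auto simp: minus_one_power_iff)
      moreover have "b (2 * L - (L + r)) = of_nat (((L + r) choose L) * ((2 * L - r) choose L))"
      proof -
        have "L + (2 * L - (L + r)) = 2 * L - r" "2 * L - (2 * L - (L + r)) = L + r" using r by auto
        then show ?thesis by (simp only: b_def mult.commute)
      qed
      ultimately show "(- 1) ^ (L - r) * of_nat (((L + r) choose L) * ((2 * L - r) choose L)) * (x gchoose (L + r)) =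
          (- 1) ^ (L + r) * b (2 * L - (L + r)) * (x gchoose (L + r))" by simp
    qed
    also have "\<dots> = (\<Sum>j\<in>{L..2 * L}. (-1) ^ j * b (2 * L - j) * (x gchoose j))"
      by (rule sum.reindex_bij_witness[of _ "\<lambda>j. j - L" "\<lambda>r. L + r"]) auto
    also have "\<dots> = (\<Sum>j\<in>{L..2 * L}. (-1) ^ j * (if L \<le> j then b (2 * L - j) else 0) * (x gchoose j))"
      by (intro sum.cong) auto
    also have "\<dots> = (\<Sum>j\<le>2 * L. (-1) ^ j * (if L \<le> j then b (2 * L - j) else 0) * (x gchoose j))"
      by (rule sum.mono_neutral_left) auto
    finally show ?thesis .
  qed
  have comb: "(\<Sum>j\<le>2 * L. c j * (of_int x gchoose j)) = b 0 * newton_sum A (2 * L) x - A 0 * T (of_int x)" for x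
    unfolding newton_sum_def T_exp c_def sum_distrib_left sum_subtractf[symmetric]
    by (intro sum.cong refl) (simp add: algebra_simps)
  have low: "newton_sum A (2 * L) (int k) = 0" if "k < L" for k
    unfolding newton_sum_nat' using that by (intro sum.neutral) (auto simp: A_gt)
  have Tlow: "T (of_nat k) = 0" if "k < L" for k
    using that by (simp add: T_def binomial_gbinomial[symmetric] binomial_eq_0)
  have Thigh: "T (of_nat (2 * L + 1 + k)) = 0" if "k < L" for k
    using that binomial_gbinomial[of k L, where ?'a = complex] by (simp add: T_def binomial_eq_0)
  have high: "newton_sum A (2 * L) (int (2 * L + 1 + k)) = 0" if "k < L" for k
  proof -
    have "newton_sum A (2 * L) (int (2 * L + 1 + k)) = newton_sum A (2 * L) (int L + int (2 * L) - int (2 * L + 1 + k))"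
      using parD[OF par2, of "int (2 * L + 1 + k)"] by (simp only: even_mult_iff even_numeral power_minus1_even simp_thms mult_1 power_mult power2_minus power_one)
    also have "int L + int (2 * L) - int (2 * L + 1 + k) = int (L - 1 - k)" using that by auto
    finally show ?thesis using low[of "L - 1 - k"] that by simp
  qed
  define Z where "Z = (of_nat ` ({..<L} \<union> {2 * L + 1..3 * L}) :: complex set)"
  have "card ({..<L} \<union> {2 * L + 1..3 * L}) = 2 * L" by (subst card_Un_disjoint) auto
  then have "card Z = 2 * L" unfolding Z_def by (subst card_image) (auto simp: inj_on_def)
  moreover have top: "c (2 * L) = 0" by (simp add: c_def b_def)
  have d: "{..2 * L} = insert (2 * L) {..2 * L - 1}" using L0 by auto
  have "c j = 0" if "j \<le> 2 * L - 1" for j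
  proof (rule newton_zero_if_roots[of Z])
    show "finite Z" "2 * L - 1 < card Z" using \<open>card Z = 2 * L\<close> L0 by (auto simp: Z_def)
    fix x assume "x \<in> Z"
    then obtain k where k: "x = of_nat k" "k < L \<or> (2 * L + 1 \<le> k \<and> k \<le> 3 * L)" by (auto simp: Z_def)
    have "newton_sum A (2 * L) (int k) = 0 \<and> T (of_nat k) = 0"
      using k(2) low[of k] Tlow[of k] high[of "k - (2 * L + 1)"] Thigh[of "k - (2 * L + 1)"] L0
      by (cases "k < L") (auto simp del: of_nat_add of_nat_Suc of_nat_mult)
    then have "(\<Sum>j\<le>2 * L. c j * (x gchoose j)) = 0"
      using comb[of "int k"] k(1) by simp
    moreover have "(\<Sum>j\<le>2 * L. c j * (x gchoose j)) = (\<Sum>j\<le>2 * L - 1. c j * (x gchoose j))"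
      unfolding d using L0 by (subst sum.insert) (auto simp: top)
    ultimately show "(\<Sum>j\<le>2 * L - 1. c j * (x gchoose j)) = 0" by simp
  qed (use that in auto)
  then have "c (2 * L - m) = 0" using top by (cases "m = 0") auto
  then have "b 0 * A (int m) = A 0 * b m" using assms(2) by (simp add: c_def of_nat_diff)
  then show ?thesis by (simp add: b_def)
qed

end

section \<open>Vertically symmetric alternating sign matrices\<close>

lemma alternating_sign_vec_iff:
  assumes ent: "\<And>a. a < dim_vec v \<Longrightarrow> v $ a \<in> {0, 1, -1}"
  shows "alternating_sign_vec v \<longleftrightarrow>
    (\<forall>r\<le>dim_vec v. (\<Sum>a<r. v $ a) \<in> {0, 1}) \<and> (\<Sum>a<dim_vec v. v $ a) = 1"
proof
  assume alt: "alternating_sign_vec v"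
  then have tot: "(\<Sum>a<dim_vec v. v $ a) = 1"
    and alt': "\<And>a b. a < b \<Longrightarrow> b < dim_vec v \<Longrightarrow> v $ a \<noteq> 0 \<Longrightarrow> v $ b \<noteq> 0 \<Longrightarrow>
      (\<And>c. a < c \<Longrightarrow> c < b \<Longrightarrow> v $ c = 0) \<Longrightarrow> sgn (v $ b) = - sgn (v $ a)"
    by (auto simp: alternating_sign_vec_def)
  \<comment> \<open>\<open>f\<close> is meaningless while no non-zero entry is known to exist; the
    first alternative of the invariant covers the initial zeros. From the first non-zero entry on,
    each partial sum is \<open>e\<close> or 0.\<close>
  define f where "f = (LEAST a. a < dim_vec v \<and> v $ a \<noteq> 0)"
  define e where "e = v $ f"
  have inv: "r \<le> dim_vec v \<Longrightarrow> (\<forall>a<r. v $ a = 0) \<or>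
     (\<exists>a<r. v $ a \<noteq> 0 \<and> (\<forall>c. a < c \<longrightarrow> c < r \<longrightarrow> v $ c = 0) \<and>
        ((v $ a = e \<and> (\<Sum>a<r. v $ a) = e) \<or> (v $ a = - e \<and> (\<Sum>a<r. v $ a) = 0)))" for r
  proof (induction r)
    case (Suc r)
    then have r: "r < dim_vec v" by simp
    show ?case
    proof (cases "v $ r = 0")
      case True
      from Suc.IH r consider "\<forall>a<r. v $ a = 0" | a where "a < r" "v $ a \<noteq> 0" "\<forall>c. a < c \<longrightarrow> c < r \<longrightarrow> v $ c = 0"
        "(v $ a = e \<and> (\<Sum>a<r. v $ a) = e) \<or> (v $ a = - e \<and> (\<Sum>a<r. v $ a) = 0)" by auto
      then show ?thesis
      proof cases
        case 1 then show ?thesis using True less_Suc_eq by auto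
      next
        case 2
        then show ?thesis using True
          by (intro disjI2 exI[of _ a]) (auto simp: less_Suc_eq)
      qed
    next
      case False
      from Suc.IH r consider "\<forall>a<r. v $ a = 0" | a where "a < r" "v $ a \<noteq> 0" "\<forall>c. a < c \<longrightarrow> c < r \<longrightarrow> v $ c = 0"
        "(v $ a = e \<and> (\<Sum>a<r. v $ a) = e) \<or> (v $ a = - e \<and> (\<Sum>a<r. v $ a) = 0)" by auto
      then show ?thesis
      proof cases
        case 1
        have "f = r" unfolding f_def
          by (rule Least_equality) (use 1 False r in \<open>auto simp: not_le[symmetric]\<close>)
        then have "v $ r = e" by (simp add: e_def)
        moreover have "(\<Sum>a<r. v $ a) = 0" using 1 by simp
        ultimately show ?thesis using False by (intro disjI2 exI[of _ r]) auto
      next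
        case 2
        have "sgn (v $ r) = - sgn (v $ a)" using 2 False r by (intro alt') auto
        then have "v $ r = - (v $ a)" using ent[of a] ent[of r] 2 r False by auto
        then show ?thesis using False 2 by (intro disjI2 exI[of _ r]) auto
      qed
    qed
  qed simp
  have sums: "(\<Sum>a<r. v $ a) \<in> {0, e}" if "r \<le> dim_vec v" for r
    using inv[OF that] by auto
  \<comment> \<open>The total rules out that the first non-zero entry is -1.\<close>
  from sums[of "dim_vec v"] tot have "e = 1" by auto
  with sums tot show "(\<forall>r\<le>dim_vec v. (\<Sum>a<r. v $ a) \<in> {0, 1}) \<and> (\<Sum>a<dim_vec v. v $ a) = 1" by auto
next
  assume *: "(\<forall>r\<le>dim_vec v. (\<Sum>a<r. v $ a) \<in> {0, 1}) \<and> (\<Sum>a<dim_vec v. v $ a) = 1"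
  show "alternating_sign_vec v"
    unfolding alternating_sign_vec_def
  proof (intro conjI allI impI)
    fix a b assume ab: "a < b \<and> b < dim_vec v \<and> v $ a \<noteq> 0 \<and> v $ b \<noteq> 0 \<and> (\<forall>c. a < c \<and> c < b \<longrightarrow> v $ c = 0)"
    have "(\<Sum>c<b. v $ c) = (\<Sum>c<Suc a. v $ c)"
      using ab by (intro sum.mono_neutral_right) (auto simp: less_Suc_eq)
    then have "(\<Sum>c<b. v $ c) = (\<Sum>c<a. v $ c) + v $ a" "(\<Sum>c<Suc b. v $ c) = (\<Sum>c<b. v $ c) + v $ b" by auto
    moreover have "(\<Sum>c<a. v $ c) \<in> {0, 1}" "(\<Sum>c<b. v $ c) \<in> {0, 1}" "(\<Sum>c<Suc b. v $ c) \<in> {0, 1}"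
      using *[THEN conjunct1, rule_format, of a] *[THEN conjunct1, rule_format, of b]
        *[THEN conjunct1, rule_format, of "Suc b"] ab by simp_all
    ultimately show "sgn (v $ b) = - sgn (v $ a)" using ent[of a] ent[of b] ab by auto
  qed (use * in simp)
qed

section \<open>Interlacing in terms of counting functions\<close>

definition sorted_ints :: "nat set \<Rightarrow> int list" where
  "sorted_ints S = map int (sorted_list_of_set S)"

lemma length_sorted_ints [simp]: "length (sorted_ints S) = card S"
  by (simp add: sorted_ints_def)

lemma set_sorted_ints [simp]: "finite S \<Longrightarrow> set (sorted_ints S) = int ` S"
  by (simp add: sorted_ints_def)

lemma sorted_sorted_ints: "sorted_wrt (<) (sorted_ints S)"
  by (simp add: sorted_ints_def sorted_wrt_map)

text \<open>Position and rank are inverse to each other; this trades comparisons of entries for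
  comparisons of counts.\<close>

lemma sorted_ints_nth_less_iff:
  assumes "finite S" "i < card S"
  shows "sorted_ints S ! i < int r \<longleftrightarrow> i < card (S \<inter> {..<r})"
proof -
  let ?l = "sorted_list_of_set S"
  have len: "length ?l = card S" by simp
  have mono: "?l ! i < ?l ! j \<longleftrightarrow> i < j" if "i < card S" "j < card S" for i j
    using sorted_wrt_nth_less[OF strict_sorted_list_of_set[of S], of i j]
      sorted_wrt_nth_less[OF strict_sorted_list_of_set[of S], of j i] that
    by (metis len less_asym linorder_neqE_nat less_irrefl)
  have bij: "bij_betw ((!) ?l) {..<card S} S"
    using bij_betw_nth[of ?l "{..<length ?l}" "set ?l"] assms by simp
  have "S \<inter> {..<r} = (!) ?l ` {j. j < card S \<and> ?l ! j < r}"
    using bij_betw_imp_surj_on[OF bij] by auto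
  then have c: "card (S \<inter> {..<r}) = card {j. j < card S \<and> ?l ! j < r}"
    using bij_betw_imp_inj_on[OF bij] by (simp add: card_image inj_on_subset[of _ "{..<card S}"] subset_eq)
  have "?l ! i < r \<longleftrightarrow> i < card {j. j < card S \<and> ?l ! j < r}"
  proof
    assume "?l ! i < r"
    have "{..i} \<subseteq> {j. j < card S \<and> ?l ! j < r}"
    proof
      fix j assume "j \<in> {..i}"
      then have "j = i \<or> ?l ! j < ?l ! i" using assms mono[of j i] by auto
      then show "j \<in> {j. j < card S \<and> ?l ! j < r}"
        using \<open>?l ! i < r\<close> \<open>j \<in> {..i}\<close> assms by auto
    qed
    from card_mono[OF _ this] show "i < card {j. j < card S \<and> ?l ! j < r}" by auto
  next
    assume lt: "i < card {j. j < card S \<and> ?l ! j < r}"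
    show "?l ! i < r"
    proof (rule ccontr)
      assume "\<not> ?l ! i < r"
      have "{j. j < card S \<and> ?l ! j < r} \<subseteq> {..<i}"
      proof
        fix j assume j: "j \<in> {j. j < card S \<and> ?l ! j < r}"
        then have "\<not> i < j" "j \<noteq> i" using mono[of i j] \<open>\<not> ?l ! i < r\<close> assms by auto
        then show "j \<in> {..<i}" by simp
      qed
      from card_mono[OF _ this] lt show False by auto
    qed
  qed
  then show ?thesis using c assms by (simp add: sorted_ints_def)
qed

text \<open>The difference of the two counting functions is the partial sum of a column written as a
  difference of indicators, so interlacing becomes the partial sum condition of
  \<open>alternating_sign_vec_iff\<close>.\<close>

lemma sorted_ints_interlace_iff:
  assumes S: "S \<subseteq> {..<M}" and S': "S' \<subseteq> {..<M}"
  shows "sorted_ints S \<in> interlace (sorted_ints S') \<longleftrightarrow>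
    (\<forall>r\<le>M. int (card (S' \<inter> {..<r})) - int (card (S \<inter> {..<r})) \<in> {0, 1}) \<and> card S' = Suc (card S)"
proof (cases "S' = {}")
  case True
  then show ?thesis by (simp add: sorted_ints_def)
next
  case False
  have fin: "finite S" "finite S'" using S S' finite_subset by auto
  have interlace: "sorted_ints S \<in> interlace (sorted_ints S') \<longleftrightarrow> Suc (card S) = card S' \<and>
     (\<forall>i<card S. sorted_ints S' ! i \<le> sorted_ints S ! i \<and> sorted_ints S ! i \<le> sorted_ints S' ! Suc i)"
  proof -
    obtain y ys where y: "sorted_ints S' = y # ys" using False fin by (cases "sorted_ints S'") (auto simp: sorted_ints_def)
    then have "sorted_wrt (<) (y # ys)" using sorted_sorted_ints[of S'] by simp
    then show ?thesis
      unfolding length_sorted_ints[of S', symmetric] unfolding y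
      by (subst interlace_iff) (auto simp: sorted_sorted_ints neq_Nil_conv)
  qed
  show ?thesis unfolding interlace
  proof (intro iffI conjI allI impI)
    assume *: "Suc (card S) = card S' \<and> (\<forall>i<card S. sorted_ints S' ! i \<le> sorted_ints S ! i \<and> sorted_ints S ! i \<le> sorted_ints S' ! Suc i)"
    then show "card S' = Suc (card S)" by simp
    fix r assume "r \<le> M"
    let ?a = "card (S \<inter> {..<r})" and ?b = "card (S' \<inter> {..<r})"
    have le: "?a \<le> card S" "?b \<le> card S'" using fin by (auto intro: card_mono)
    have "?a \<le> ?b"
    proof (cases "?a = 0")
      case False
      then have i: "?a - 1 < card S" "?a - 1 < ?a" using le by linarith+
      then have "sorted_ints S ! (?a - 1) < int r" using sorted_ints_nth_less_iff[OF fin(1) i(1)] by simp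
      then have "sorted_ints S' ! (?a - 1) < int r" using * i by force
      then have "?a - 1 < ?b" using sorted_ints_nth_less_iff[OF fin(2), of "?a - 1" r] i * by auto
      then show ?thesis by simp
    qed simp
    moreover have "?b \<le> ?a + 1"
    proof (cases "?b < 2")
      case False
      then have i: "Suc (?b - 2) < card S'" "Suc (?b - 2) < ?b" using le by linarith+
      then have j: "?b - 2 < card S" using * by simp
      have "sorted_ints S' ! Suc (?b - 2) < int r" using sorted_ints_nth_less_iff[OF fin(2) i(1)] i by simp
      then have "sorted_ints S ! (?b - 2) < int r" using * j by force
      then have "?b - 2 < ?a" using sorted_ints_nth_less_iff[OF fin(1) j] by simp
      then show ?thesis by simp
    qed simp
    ultimately show "int ?b - int ?a \<in> {0, 1}" by auto
  next
    assume *: "(\<forall>r\<le>M. int (card (S' \<inter> {..<r})) - int (card (S \<inter> {..<r})) \<in> {0, 1}) \<and> card S' = Suc (card S)"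
    then show "Suc (card S) = card S'" by simp
    fix i assume i: "i < card S"
    have i': "i < card S'" "Suc i < card S'" using i * by auto
    have ex: "\<exists>x<M. sorted_ints T ! j = int x" if "T \<subseteq> {..<M}" "j < card T" for T j
    proof -
      have "finite T" using that finite_subset by auto
      then have "sorted_ints T ! j \<in> int ` T" using that nth_mem[of j "sorted_ints T"] by simp
      then show ?thesis using that by auto
    qed
    obtain x where x: "x < M" "sorted_ints S ! i = int x" using ex[OF S i] by auto
    obtain y where y: "y < M" "sorted_ints S' ! Suc i = int y" using ex[OF S' i'(2)] by auto
    have "i < card (S \<inter> {..<Suc x})" using sorted_ints_nth_less_iff[OF fin(1) i, of "Suc x"] x by simp
    then have "i < card (S' \<inter> {..<Suc x})" using *[THEN conjunct1, rule_format, of "Suc x"] x by auto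
    then show "sorted_ints S' ! i \<le> sorted_ints S ! i" using sorted_ints_nth_less_iff[OF fin(2) i'(1), of "Suc x"] x by simp
    have "Suc i < card (S' \<inter> {..<Suc y})" using sorted_ints_nth_less_iff[OF fin(2) i'(2), of "Suc y"] y by simp
    then have "i < card (S \<inter> {..<Suc y})" using *[THEN conjunct1, rule_format, of "Suc y"] y by auto
    then show "sorted_ints S ! i \<le> sorted_ints S' ! Suc i" using sorted_ints_nth_less_iff[OF fin(1) i, of "Suc y"] y by simp
  qed
qed

abbreviation ind :: "nat set \<Rightarrow> nat \<Rightarrow> int" where "ind S r \<equiv> of_bool (r \<in> S)"

lemma sum_ind: "(\<Sum>a<r. ind S a) = int (card (S \<inter> {..<r}))"
proof (induction r)
  case (Suc r)
  have "S \<inter> {..<Suc r} = (if r \<in> S then insert r (S \<inter> {..<r}) else S \<inter> {..<r})"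
    by (auto simp: less_Suc_eq)
  with Suc show ?case by auto
qed simp

lemma alternating_ind_iff:
  assumes S: "S \<subseteq> {..<M}" and S': "S' \<subseteq> {..<M}" and dim: "dim_vec v = M"
    and v: "\<And>r. r < M \<Longrightarrow> v $ r = ind S' r - ind S r"
  shows "alternating_sign_vec v \<longleftrightarrow> sorted_ints S \<in> interlace (sorted_ints S')"
proof -
  have fin: "finite S" "finite S'" using S S' finite_subset by auto
  have sum: "(\<Sum>a<r. v $ a) = int (card (S' \<inter> {..<r})) - int (card (S \<inter> {..<r}))" if "r \<le> M" for r
    using that by (simp add: v sum_subtractf sum_ind[symmetric])
  have "S' \<inter> {..<M} = S'" "S \<inter> {..<M} = S" using S S' by auto
  then have "alternating_sign_vec v \<longleftrightarrow>
     (\<forall>r\<le>M. int (card (S' \<inter> {..<r})) - int (card (S \<inter> {..<r})) \<in> {0, 1}) \<and> int (card S') - int (card S) = 1"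
    using sum by (subst alternating_sign_vec_iff) (auto simp: dim v)
  then show ?thesis unfolding sorted_ints_interlace_iff[OF S S'] by auto
qed

section \<open>Monotone triangles as lists of rows\<close>

primrec mt_chains :: "nat \<Rightarrow> int list \<Rightarrow> int list list set" where
  "mt_chains 0 ks = {[]}"
| "mt_chains (Suc m) ks = (\<lambda>(ls, rest). ls # rest) ` (SIGMA ls:interlace ks. mt_chains m ls)"

lemma finite_mt_chains [simp]: "finite (mt_chains m ks)"
  by (induction m arbitrary: ks) auto

lemma card_mt_chains: "card (mt_chains m ks) = mt_count m ks"
proof (induction m arbitrary: ks)
  case (Suc m)
  have "card (mt_chains (Suc m) ks) = card (SIGMA ls:interlace ks. mt_chains m ls)"
    unfolding mt_chains.simps by (rule card_image) (auto simp: inj_on_def)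
  also have "\<dots> = (\<Sum>ls\<in>interlace ks. card (mt_chains m ls))" by (rule card_SigmaI) auto
  finally show ?case using Suc by simp
qed simp

lemma mt_chains_iff: "ch \<in> mt_chains m ks \<longleftrightarrow> length ch = m \<and> (\<forall>p<m. ch ! p \<in> interlace ((ks # ch) ! p))"
proof (induction m arbitrary: ks ch)
  case 0 then show ?case by auto
next
  case (Suc m)
  show ?case
  proof (cases ch)
    case (Cons l rest)
    have "ch \<in> mt_chains (Suc m) ks \<longleftrightarrow> l \<in> interlace ks \<and> rest \<in> mt_chains m l" unfolding Cons by auto
    then show ?thesis unfolding Suc.IH Cons by (auto simp: All_less_Suc2)
  qed auto
qed

lemma interlace_bounds:
  assumes "ls \<in> interlace ks" "sorted_wrt (<) (tl ks)" "tl ks \<noteq> [] \<Longrightarrow> hd ks \<le> hd (tl ks)" "x \<in> set ls"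
  shows "hd ks \<le> x" "\<exists>y\<in>set ks. x \<le> y" "\<exists>y\<in>set ks. y \<le> x"
proof -
  have ne: "ks \<noteq> []" using assms(1) by auto
  note I = interlace_iff[OF ne assms(2,3), THEN iffD1, OF _ assms(1)]
  obtain i where i: "i < length ls" "x = ls ! i" using assms(4) by (auto simp: in_set_conv_nth)
  have b: "ks ! i \<le> x" "x \<le> ks ! Suc i" "i < length ks" "Suc i < length ks" using I i by auto
  then show "\<exists>y\<in>set ks. x \<le> y" "\<exists>y\<in>set ks. y \<le> x" by (meson nth_mem)+
  obtain k ks' where ks: "ks = k # ks'" using ne by (cases ks) auto
  have "k \<le> ks ! i"
  proof (cases i)
    case 0 then show ?thesis by (simp add: ks)
  next
    case (Suc i')
    have "ks' \<noteq> []" using b by (auto simp: ks)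
    then have "k \<le> hd ks'" using assms(3) by (simp add: ks)
    also have "hd ks' \<le> ks' ! i'"
      using sorted_wrt_nth_less[of "(<)" ks' 0 i'] assms(2) b \<open>ks' \<noteq> []\<close>
      by (cases "i' = 0") (auto simp: ks Suc hd_conv_nth)
    finally show ?thesis by (simp add: ks Suc)
  qed
  then show "hd ks \<le> x" using b by (simp add: ks)
qed

lemma interlace_bounds':
  assumes "ls \<in> interlace ks" "sorted_wrt (<) ks" "x \<in> set ls"
  shows "hd ks \<le> x" "\<exists>y\<in>set ks. x \<le> y" "\<exists>y\<in>set ks. y \<le> x"
proof -
  have "sorted_wrt (<) (tl ks)" "tl ks \<noteq> [] \<Longrightarrow> hd ks \<le> hd (tl ks)"
    using assms(2) by (cases ks; cases "tl ks"; auto)+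
  from interlace_bounds[OF assms(1) this assms(3)] show "hd ks \<le> x" "\<exists>y\<in>set ks. x \<le> y" "\<exists>y\<in>set ks. y \<le> x" by auto
qed

lemma mt_chains_lower:
  assumes "ch \<in> mt_chains m ks" "sorted_wrt (<) ks" "\<forall>x\<in>set ks. b \<le> x"
  shows "\<forall>ls\<in>set ch. \<forall>x\<in>set ls. b \<le> x"
  using assms
proof (induction m arbitrary: ks ch)
  case (Suc m)
  then obtain l rest where ch: "ch = l # rest" "l \<in> interlace ks" "rest \<in> mt_chains m l" by auto
  have l: "\<forall>x\<in>set l. b \<le> x" using interlace_bounds'(3)[OF ch(2) Suc.prems(2)] Suc.prems(3) by fastforce
  have "\<forall>ls\<in>set rest. \<forall>x\<in>set ls. b \<le> x"
    using Suc.IH[OF ch(3) interlace_sorted[OF ch(2) Suc.prems(2)] l] .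
  with l show ?case by (simp add: ch)
qed simp

text \<open>While the diagonal stays at 1, the row above \<open>1 # xs\<close> is 1 followed by a
  row interlacing \<open>xs\<close>. Where it leaves 1, the last 1 only matters as a lower bound,
  which for a row without 1 is as good as 2; hence the bottom row \<open>2 # xs\<close>.\<close>

primrec marked_chains :: "nat \<Rightarrow> int list \<Rightarrow> int list list set" where
  "marked_chains 0 xs = mt_chains (Suc (length xs)) (2 # xs)"
| "marked_chains (Suc j) xs = (\<lambda>(ls, rest). (1 # ls) # rest) ` (SIGMA ls:interlace xs. marked_chains j ls)"

lemma finite_marked_chains [simp]: "finite (marked_chains j xs)"
  by (induction j arbitrary: xs) auto

lemma card_marked_chains: "card (marked_chains j xs) = trap_count j 2 xs"
proof (induction j arbitrary: xs)
  case 0 show ?case by (simp add: card_mt_chains del: mt_count.simps mt_chains.simps)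
next
  case (Suc j)
  have "card (marked_chains (Suc j) xs) = card (SIGMA ls:interlace xs. marked_chains j ls)"
    unfolding marked_chains.simps by (rule card_image) (auto simp: inj_on_def)
  also have "\<dots> = (\<Sum>ls\<in>interlace xs. card (marked_chains j ls))" by (rule card_SigmaI) auto
  finally show ?case using Suc by simp
qed

lemma marked_chains_eq:
  assumes "sorted_wrt (<) (1 # xs)" "j \<le> length xs"
  shows "{ch \<in> mt_chains (Suc (length xs)) (1 # xs). \<forall>p\<le>length xs. 1 \<in> set (ch ! p) \<longleftrightarrow> p < j} = marked_chains j xs"
  using assms
proof (induction j arbitrary: xs)
  case 0
  have xs: "sorted_wrt (<) xs" "\<forall>x\<in>set xs. 2 \<le> x" using 0 by auto
  \<comment> \<open>\<open>2 # xs\<close> may begin with two equal entries;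
    \<open>interlace_iff\<close> and \<open>interlace_bounds\<close> allow this.\<close>
  have iff: "l \<in> interlace (1 # xs) \<and> 1 \<notin> set l \<longleftrightarrow> l \<in> interlace (2 # xs)" for l
  proof -
    have 1: "l \<in> interlace (1 # xs) \<longleftrightarrow> Suc (length l) = length (1 # xs) \<and> sorted_wrt (<) l \<and>
       (\<forall>i<length l. (1 # xs) ! i \<le> l ! i \<and> l ! i \<le> (1 # xs) ! Suc i)"
      using xs by (intro interlace_iff) (auto simp: neq_Nil_conv)
    have 2: "l \<in> interlace (2 # xs) \<longleftrightarrow> Suc (length l) = length (2 # xs) \<and> sorted_wrt (<) l \<and>
       (\<forall>i<length l. (2 # xs) ! i \<le> l ! i \<and> l ! i \<le> (2 # xs) ! Suc i)"
      using xs by (intro interlace_iff) (auto simp: neq_Nil_conv)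
    show ?thesis
    proof
      assume a: "l \<in> interlace (1 # xs) \<and> 1 \<notin> set l"
      then have "l ! 0 \<noteq> 1" if "l \<noteq> []" using that by (metis length_greater_0_conv nth_mem)
      with a show "l \<in> interlace (2 # xs)" unfolding 1 2
        by (auto simp: nth_Cons split: nat.splits) force
    next
      assume a: "l \<in> interlace (2 # xs)"
      have "2 \<le> x" if "x \<in> set l" for x
        using interlace_bounds(1)[OF a _ _ that] xs by (auto simp: neq_Nil_conv)
      then have "1 \<notin> set l" by force
      moreover have "l \<in> interlace (1 # xs)" using a unfolding 1 2
        by (auto simp: nth_Cons split: nat.splits)
      ultimately show "l \<in> interlace (1 # xs) \<and> 1 \<notin> set l" by simp
    qed
  qed
  show ?case
  proof (intro equalityI subsetI)
    fix ch assume "ch \<in> {ch \<in> mt_chains (Suc (length xs)) (1 # xs). \<forall>p\<le>length xs. (1 \<in> set (ch ! p)) = (p < 0)}"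
    then obtain l rest where ch: "ch = l # rest" "l \<in> interlace (1 # xs)" "rest \<in> mt_chains (length xs) l" "1 \<notin> set l" by force
    then show "ch \<in> marked_chains 0 xs" using iff by auto
  next
    fix ch assume "ch \<in> marked_chains 0 xs"
    then obtain l rest where ch: "ch = l # rest" "l \<in> interlace (2 # xs)" "rest \<in> mt_chains (length xs) l" by auto
    have l2: "2 \<le> x" if "x \<in> set l" for x
      using interlace_bounds(1)[OF ch(2) _ _ that] xs by (auto simp: neq_Nil_conv)
    have sl: "sorted_wrt (<) l" using iff[of l] ch(2) 0 interlace_sorted by blast
    have rest: "\<forall>ls\<in>set rest. \<forall>x\<in>set ls. 2 \<le> x" using mt_chains_lower[OF ch(3) sl] l2 by blast
    have "length ch = Suc (length xs)" using ch mt_chains_iff[of rest "length xs" l] by simp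
    then have "1 \<notin> set (ch ! p)" if "p \<le> length xs" for p
      using that nth_mem[of p ch] rest l2 unfolding ch(1) by force
    moreover have "ch \<in> mt_chains (Suc (length xs)) (1 # xs)" using ch iff by auto
    ultimately show "ch \<in> {ch \<in> mt_chains (Suc (length xs)) (1 # xs). \<forall>p\<le>length xs. (1 \<in> set (ch ! p)) = (p < 0)}" by simp
  qed
next
  case (Suc j)
  then obtain x xs' where xs: "xs = x # xs'" by (cases xs) auto
  have x: "1 < x" using Suc.prems xs by simp
  have sxs: "sorted_wrt (<) xs" using Suc.prems by simp
  \<comment> \<open>Since \<open>1 < x\<close>, an entry 1 can only be the first one, and strictness
    then puts no constraint on the others.\<close>
  have iff: "l \<in> interlace (1 # xs) \<and> 1 \<in> set l \<longleftrightarrow> (\<exists>ls\<in>interlace xs. l = 1 # ls)" for l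
  proof
    assume a: "l \<in> interlace (1 # xs) \<and> 1 \<in> set l"
    then consider a ls where "l = a # ls" "1 \<le> a" "a < x" "ls \<in> interlace xs" | ls where "l = x # ls" "ls \<in> interlace ((x + 1) # xs')"
      unfolding xs by auto
    then show "\<exists>ls\<in>interlace xs. l = 1 # ls"
    proof cases
      case 1
      have "1 \<notin> set ls" using interlace_bounds'(1)[OF 1(4) sxs, of 1] x by (auto simp: xs)
      then show ?thesis using 1 a by auto
    next
      case 2
      have "sorted_wrt (<) xs'" using sxs by (simp add: xs)
      moreover have "x + 1 \<le> hd xs'" if "xs' \<noteq> []" using sxs that by (cases xs') (auto simp: xs)
      ultimately have "1 \<notin> set ls" using interlace_bounds(1)[OF 2(2), of 1] x by auto
      then show ?thesis using 2 a x by auto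
    qed
  qed (use x in \<open>auto simp: xs\<close>)
  have step: "sorted_wrt (<) (1 # ls)" "Suc (length ls) = length xs" if "ls \<in> interlace xs" for ls
    using interlace_sorted[OF that sxs] interlace_bounds'(1)[OF that sxs] x length_interlace[OF that] by (fastforce simp: xs)+
  show ?case
  proof (intro equalityI subsetI)
    fix ch assume a: "ch \<in> {ch \<in> mt_chains (Suc (length xs)) (1 # xs). \<forall>p\<le>length xs. (1 \<in> set (ch ! p)) = (p < Suc j)}"
    then obtain l rest where ch: "ch = l # rest" "l \<in> interlace (1 # xs)" "rest \<in> mt_chains (length xs) l" "1 \<in> set l" by force
    with iff obtain ls where ls: "ls \<in> interlace xs" "l = 1 # ls" by blast
    have "\<forall>p\<le>length ls. (1 \<in> set (rest ! p)) = (p < j)"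
      using a step(2)[OF ls(1)] by (auto simp: ch(1)) (metis Suc_le_mono nth_Cons_Suc Suc_less_eq)+
    then have "rest \<in> marked_chains j ls"
      using Suc.IH[OF step(1)[OF ls(1)]] ch(3) step(2)[OF ls(1)] Suc.prems ls(2) by auto
    then show "ch \<in> marked_chains (Suc j) xs" using ls ch by auto
  next
    fix ch assume "ch \<in> marked_chains (Suc j) xs"
    then obtain ls rest where ch: "ch = (1 # ls) # rest" "ls \<in> interlace xs" "rest \<in> marked_chains j ls" by auto
    have r: "rest \<in> mt_chains (Suc (length ls)) (1 # ls)" "\<forall>p\<le>length ls. (1 \<in> set (rest ! p)) = (p < j)"
      using Suc.IH[OF step(1)[OF ch(2)]] ch(3) step(2)[OF ch(2)] Suc.prems by auto
    have "1 # ls \<in> interlace (1 # xs)" using iff ch(2) by blast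
    then have "ch \<in> mt_chains (Suc (length xs)) (1 # xs)" using r(1) ch(1) step(2)[OF ch(2)] by auto
    moreover have "(1 \<in> set (ch ! p)) = (p < Suc j)" if "p \<le> length xs" for p
      using r(2) that step(2)[OF ch(2)] by (cases p) (auto simp: ch(1))
    ultimately show "ch \<in> {ch \<in> mt_chains (Suc (length xs)) (1 # xs). \<forall>p\<le>length xs. (1 \<in> set (ch ! p)) = (p < Suc j)}" by simp
  qed
qed

section \<open>Translation invariance of the counts\<close>

lemma interlace_shift: "interlace (map (\<lambda>x. x + d) ks) = map (\<lambda>x. x + d) ` interlace ks"
proof (induction ks rule: interlace.induct)
  case (3 k l ks)
  have e: "(l + 1 + d) = (l + d + 1)" by simp
  have 2: "interlace ((l + d + 1) # map (\<lambda>x. x + d) ks) = map (\<lambda>x. x + d) ` interlace ((l + 1) # ks)" 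
    using "3.IH"(2) by (simp only: e list.map)
  let ?f = "\<lambda>x::int. x + d"
  have 1: "interlace ((l + d) # map ?f ks) = map ?f ` interlace (l # ks)"
    using "3.IH"(1) by (simp only: list.map)
  have 3: "(\<lambda>(a, ls). a # ls) ` ({k + d..<l + d} \<times> map ?f ` interlace (l # ks)) =
    map ?f ` (\<lambda>(a, ls). a # ls) ` ({k..<l} \<times> interlace (l # ks))"
  proof -
    have "{k + d..<l + d} \<times> map ?f ` interlace (l # ks) = (\<lambda>(a, ls). (a + d, map ?f ls)) ` ({k..<l} \<times> interlace (l # ks))"
      (is "?A = ?B")
    proof (intro equalityI subsetI)
      fix p assume "p \<in> ?A"
      then obtain a x where "p = (a, map ?f x)" "k + d \<le> a" "a < l + d" "x \<in> interlace (l # ks)" by auto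
      then show "p \<in> ?B" by (intro image_eqI[of _ _ "(a - d, x)"]) auto
    qed auto
    then show ?thesis by (simp only: image_image) (intro image_cong; auto)
  qed
  have 4: "(#) (l + d) ` map ?f ` interlace ((l + 1) # ks) = map ?f ` (#) l ` interlace ((l + 1) # ks)"
    unfolding image_image by (intro image_cong) auto
  show ?case
    unfolding list.map interlace.simps 1 2 3 4 image_Un ..
qed auto

lemma mt_count_shift: "mt_count n (map (\<lambda>x. x + d) ks) = mt_count n ks"
proof (induction n arbitrary: ks)
  case (Suc n)
  have "inj (map (\<lambda>x. x + d))" by (rule inj_mapI) (auto simp: inj_def)
  then show ?case using Suc by (simp add: interlace_shift sum.reindex inj_on_subset[OF _ subset_UNIV])
qed simp

lemma trap_count_shift: "trap_count j (k + d) (map (\<lambda>x. x + d) xs) = trap_count j k xs"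
proof (induction j arbitrary: xs)
  case 0
  show ?case using mt_count_shift[of "Suc (length xs)" d "k # xs"] by (simp del: mt_count.simps)
next
  case (Suc j)
  have "inj (map (\<lambda>x. x + d))" by (rule inj_mapI) (auto simp: inj_def)
  then show ?case using Suc by (simp add: interlace_shift sum.reindex inj_on_subset[OF _ subset_UNIV])
qed

lemma sorted_ints_nat_set:
  assumes "sorted_wrt (<) ls" "\<forall>x\<in>set ls. 0 \<le> x"
  shows "sorted_ints (nat ` set ls) = ls"
proof -
  have "sorted_wrt (<) (map nat ls)"
    using assms unfolding sorted_wrt_map
    by (induction ls) auto
  then have "sorted_list_of_set (set (map nat ls)) = map nat ls"
    by (intro sorted_list_of_set.idem_if_sorted_distinct) (auto simp: strict_sorted_iff)
  then have "sorted_ints (nat ` set ls) = map (\<lambda>x. int (nat x)) ls"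
    unfolding sorted_ints_def set_map[symmetric] by (simp add: comp_def)
  also have "\<dots> = ls" using assms(2) by (intro map_idI) auto
  finally show ?thesis .
qed

section \<open>The monotone triangle of a vertically symmetric matrix\<close>

definition odds :: "nat \<Rightarrow> nat set" where "odds n = {r. r < 2 * n + 1 \<and> odd r}"

definition odd_list :: "nat \<Rightarrow> int list" where "odd_list n = map (\<lambda>j. 2 * int j + 1) [0..<n]"

lemma sorted_odd_list: "sorted_wrt (<) (odd_list n)"
  by (auto simp: odd_list_def sorted_wrt_iff_nth_less)

lemma sorted_ints_odds: "sorted_ints (odds n) = odd_list n"
proof -
  have "odds n = nat ` set (odd_list n)"
  proof (intro equalityI subsetI)
    fix r assume "r \<in> odds n"
    then obtain j where "r = 2 * j + 1" "j < n" by (auto simp: odds_def elim!: oddE)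
    then show "r \<in> nat ` set (odd_list n)"
      by (auto simp: odd_list_def image_image nat_add_distrib nat_mult_distrib intro!: image_eqI[of _ _ j])
  qed (auto simp: odds_def odd_list_def nat_add_distrib nat_mult_distrib)
  moreover have "sorted_ints (nat ` set (odd_list n)) = odd_list n"
    by (rule sorted_ints_nat_set[OF sorted_odd_list]) (auto simp: odd_list_def)
  ultimately show ?thesis by simp
qed

definition partial_ones :: "nat \<Rightarrow> int mat \<Rightarrow> nat \<Rightarrow> nat set" where
  "partial_ones n A c = {r. r < 2 * n + 1 \<and> (\<Sum>d<c. A $$ (r, d)) = 1}"

text \<open>Ordered from the bottom upward; the row for \<open>n\<close> columns is left out because
  it is the same for all matrices, by \<open>partial_ones_n\<close>.\<close>

definition chain :: "nat \<Rightarrow> int mat \<Rightarrow> int list list" where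
  "chain n A = map (\<lambda>p. sorted_ints (partial_ones n A (n - 1 - p))) [0..<n]"

lemma finite_partial_ones [simp]: "finite (partial_ones n A c)"
  by (simp add: partial_ones_def)

lemma partial_ones_subset: "partial_ones n A c \<subseteq> {..<2 * n + 1}"
  by (auto simp: partial_ones_def)

lemma sum_mirror: "(\<Sum>d<2 * n + 1. f d) = (\<Sum>d<n. f d) + f n + (\<Sum>d<n. f (2 * n - d) :: int)"
  for n :: nat
proof -
  have "{..<2 * n + 1} = {..<n} \<union> insert n {n + 1..2 * n}" by auto
  then have "(\<Sum>d<2 * n + 1. f d) = (\<Sum>d\<in>{..<n} \<union> insert n {n + 1..2 * n}. f d)" by (simp only:)
  also have "\<dots> = (\<Sum>d<n. f d) + (\<Sum>d\<in>insert n {n + 1..2 * n}. f d)"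
    by (rule sum.union_disjoint) auto
  also have "(\<Sum>d\<in>insert n {n + 1..2 * n}. f d) = f n + (\<Sum>d\<in>{n + 1..2 * n}. f d)"
    by (rule sum.insert) auto
  also have "(\<Sum>d\<in>{n + 1..2 * n}. f d) = (\<Sum>d<n. f (2 * n - d))"
    by (rule sum.reindex_bij_witness[of _ "\<lambda>d. 2 * n - d" "\<lambda>d. 2 * n - d"]) auto
  finally show ?thesis by simp
qed

locale vsasm =
  fixes n :: nat and A :: "int mat"
  assumes dim: "A \<in> carrier_mat (2 * n + 1) (2 * n + 1)" and vs: "is_VSASM A"
begin

lemma dims [simp]: "dim_row A = 2 * n + 1" "dim_col A = 2 * n + 1"
  using dim by auto

lemma entry: "r < 2 * n + 1 \<Longrightarrow> c < 2 * n + 1 \<Longrightarrow> A $$ (r, c) \<in> {0, 1, -1}"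
  using vs elements_matI[OF dim, of r c "A $$ (r, c)"] unfolding is_VSASM_def is_ASM_def by blast

lemma mirror: "r < 2 * n + 1 \<Longrightarrow> c < 2 * n + 1 \<Longrightarrow> A $$ (r, 2 * n - c) = A $$ (r, c)"
  using vs unfolding is_VSASM_def by auto

lemma row_sums:
  assumes "r < 2 * n + 1"
  shows "c \<le> 2 * n + 1 \<Longrightarrow> (\<Sum>d<c. A $$ (r, d)) \<in> {0, 1}" "(\<Sum>d<2 * n + 1. A $$ (r, d)) = 1"
proof -
  have alt: "alternating_sign_vec (row A r)" using vs assms unfolding is_VSASM_def is_ASM_def by auto
  have "row A r $ d = A $$ (r, d)" if "d < 2 * n + 1" for d using that assms by simp
  then have *: "(\<Sum>d<c. row A r $ d) = (\<Sum>d<c. A $$ (r, d))" if "c \<le> 2 * n + 1" for c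
    using that by (intro sum.cong) auto
  have ent: "row A r $ d \<in> {0, 1, -1}" if "d < dim_vec (row A r)" for d
    using that assms entry by auto
  have dv: "dim_vec (row A r) = 2 * n + 1" by simp
  have "(\<forall>c\<le>2 * n + 1. (\<Sum>d<c. row A r $ d) \<in> {0, 1}) \<and> (\<Sum>d<2 * n + 1. row A r $ d) = 1"
    using alternating_sign_vec_iff[OF ent] alt unfolding dv by blast
  then have "(\<forall>c\<le>2 * n + 1. (\<Sum>d<c. A $$ (r, d)) \<in> {0, 1}) \<and> (\<Sum>d<2 * n + 1. A $$ (r, d)) = 1"
    using * by (metis order_refl)
  then show "c \<le> 2 * n + 1 \<Longrightarrow> (\<Sum>d<c. A $$ (r, d)) \<in> {0, 1}" "(\<Sum>d<2 * n + 1. A $$ (r, d)) = 1" by auto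
qed

lemma row_sum_ind: "r < 2 * n + 1 \<Longrightarrow> c \<le> 2 * n + 1 \<Longrightarrow> (\<Sum>d<c. A $$ (r, d)) = ind (partial_ones n A c) r"
  using row_sums(1)[of r c] by (auto simp: partial_ones_def)

lemma entry_ind: "r < 2 * n + 1 \<Longrightarrow> c < 2 * n + 1 \<Longrightarrow> A $$ (r, c) = ind (partial_ones n A (Suc c)) r - ind (partial_ones n A c) r"
  using row_sum_ind[of r c] row_sum_ind[of r "Suc c"] by simp

lemma col_alt: "c < 2 * n + 1 \<Longrightarrow> alternating_sign_vec (col A c)"
  using vs unfolding is_VSASM_def is_ASM_def by auto

lemma interlacing: "c < 2 * n + 1 \<Longrightarrow> sorted_ints (partial_ones n A c) \<in> interlace (sorted_ints (partial_ones n A (Suc c)))"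
  using alternating_ind_iff[OF partial_ones_subset partial_ones_subset, of "col A c" n A "Suc c" A c] col_alt[of c] entry_ind[of _ c]
  by auto

lemma middle: "r < 2 * n + 1 \<Longrightarrow> A $$ (r, n) = 1 - 2 * ind (partial_ones n A n) r"
proof -
  assume r: "r < 2 * n + 1"
  have "(\<Sum>d<n. A $$ (r, 2 * n - d)) = (\<Sum>d<n. A $$ (r, d))"
    using r by (intro sum.cong) (auto simp: mirror)
  then show ?thesis
    using row_sums(2)[OF r] row_sum_ind[OF r, of n] unfolding sum_mirror by auto
qed

text \<open>By symmetry a middle entry is 1 minus twice the left partial sum, hence never 0. An
  alternating column without zeros is \<open>1, -1, .., 1\<close>, and -1 stands at the odd indices,
  counted from 0.\<close>

lemma partial_ones_n: "partial_ones n A n = odds n"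
proof -
  have sums: "\<forall>r\<le>2 * n + 1. (\<Sum>a<r. A $$ (a, n)) \<in> {0, 1}"
  proof -
    have "col A n $ a \<in> {0, 1, -1}" if "a < dim_vec (col A n)" for a using that entry by auto
    from alternating_sign_vec_iff[OF this] col_alt[of n]
    have "\<forall>r\<le>2 * n + 1. (\<Sum>a<r. col A n $ a) \<in> {0, 1}" by auto
    moreover have "(\<Sum>a<r. col A n $ a) = (\<Sum>a<r. A $$ (a, n))" if "r \<le> 2 * n + 1" for r
      using that by (intro sum.cong) auto
    ultimately show ?thesis by auto
  qed
  have q: "r \<le> 2 * n + 1 \<Longrightarrow> (\<Sum>a<r. A $$ (a, n)) = of_bool (odd r)" for r
  proof (induction r)
    case (Suc r)
    then have "A $$ (r, n) \<in> {1, -1}" using middle[of r] by auto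
    with Suc sums[rule_format, of "Suc r"] show ?case by auto
  qed simp
  have "r \<in> partial_ones n A n \<longleftrightarrow> odd r" if "r < 2 * n + 1" for r
    using q[of r] q[of "Suc r"] middle[OF that] that by (auto split: if_splits)
  then show ?thesis using partial_ones_subset[of n A n] by (auto simp: odds_def)
qed

lemma chain_in_mt_chains: "chain n A \<in> mt_chains n (odd_list n)"
  unfolding mt_chains_iff
proof (intro conjI allI impI)
  fix p assume p: "p < n"
  have 1: "chain n A ! p = sorted_ints (partial_ones n A (n - 1 - p))" using p by (simp add: chain_def)
  have "(odd_list n # chain n A) ! p = sorted_ints (partial_ones n A (n - p))"
    using p by (cases p) (auto simp: chain_def partial_ones_n sorted_ints_odds)
  moreover have "n - p = Suc (n - 1 - p)" using p by simp
  ultimately show "chain n A ! p \<in> interlace ((odd_list n # chain n A) ! p)"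
    unfolding 1 using interlacing[of "n - 1 - p"] by simp
qed (simp add: chain_def)

lemma lower: "c \<le> n \<Longrightarrow> r \<in> partial_ones n A c \<Longrightarrow> 1 \<le> r"
proof -
  assume c: "c \<le> n" "r \<in> partial_ones n A c"
  have o: "\<forall>x\<in>set (odd_list n). 1 \<le> x" by (auto simp: odd_list_def)
  show ?thesis
  proof (cases "c = n")
    case True then show ?thesis using c by (auto simp: partial_ones_n odds_def intro: Suc_leI odd_pos)
  next
    case False
    then have "sorted_ints (partial_ones n A c) \<in> set (chain n A)"
      using c unfolding chain_def by (auto intro!: image_eqI[of _ _ "n - 1 - c"])
    then show ?thesis using mt_chains_lower[OF chain_in_mt_chains sorted_odd_list o] c by force
  qed
qed

text \<open>1 is the least possible entry by \<open>lower\<close>, and by interlacing some entry of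
  the next row is at most 1.\<close>

lemma one_mono: "c < n \<Longrightarrow> 1 \<in> partial_ones n A c \<Longrightarrow> 1 \<in> partial_ones n A (Suc c)"
proof -
  assume c: "c < n" "1 \<in> partial_ones n A c"
  have mem: "1 \<in> set (sorted_ints (partial_ones n A c))" using c by auto
  have "sorted_ints (partial_ones n A c) \<in> interlace (sorted_ints (partial_ones n A (Suc c)))" using c by (intro interlacing) simp
  from interlace_bounds'(3)[OF this sorted_sorted_ints mem]
  obtain y where "y \<in> set (sorted_ints (partial_ones n A (Suc c))) \<and> y \<le> 1" unfolding Bex_def ..
  then have y: "y \<in> set (sorted_ints (partial_ones n A (Suc c)))" "y \<le> 1" by simp_all
  then have "nat y \<in> partial_ones n A (Suc c)" "y \<ge> 0" by auto
  moreover have "1 \<le> nat y" using lower[OF _ calculation(1)] c by simp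
  moreover have "nat y \<le> 1" using y(2) by simp
  ultimately show ?thesis by (metis le_antisym)
qed

lemma one_mono': "c \<le> c' \<Longrightarrow> c' \<le> n \<Longrightarrow> 1 \<in> partial_ones n A c \<Longrightarrow> 1 \<in> partial_ones n A c'"
proof (induction c')
  case (Suc c')
  show ?case
  proof (cases "c = Suc c'")
    case False
    then show ?thesis using Suc by (intro one_mono Suc.IH) auto
  qed (use Suc in simp)
qed simp

text \<open>By \<open>one_mono'\<close> the partial sums of the second matrix row switch from 0 to 1
  only once before the middle column, and that happens at the first 1.\<close>

lemma first_one_iff:
  assumes n: "1 \<le> n" and i: "1 \<le> i" "i \<le> n"
  shows "(\<exists>c<2 * n + 1. i = Suc c \<and> A $$ (1, c) = 1 \<and> (\<forall>d<c. A $$ (1, d) \<noteq> 1)) \<longleftrightarrow>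
    (\<forall>c<n. 1 \<in> partial_ones n A c \<longleftrightarrow> i \<le> c)"
proof -
  obtain j where j: "i = Suc j" "j < n" using i by (cases i) auto
  have e: "A $$ (1, c) = ind (partial_ones n A (Suc c)) 1 - ind (partial_ones n A c) 1" if "c < n" for c
    using that n by (intro entry_ind) auto
  have one_n: "1 \<in> partial_ones n A n" using n by (auto simp: partial_ones_n odds_def)
  show ?thesis
  proof
    assume "\<exists>c<2 * n + 1. i = Suc c \<and> A $$ (1, c) = 1 \<and> (\<forall>d<c. A $$ (1, d) \<noteq> 1)"
    then have "A $$ (1, j) = 1" using j by auto
    then have *: "1 \<in> partial_ones n A (Suc j)" "1 \<notin> partial_ones n A j"
      using e[OF j(2)] by (cases "1 \<in> partial_ones n A (Suc j)"; cases "1 \<in> partial_ones n A j"; simp)+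
    show "\<forall>c<n. 1 \<in> partial_ones n A c \<longleftrightarrow> i \<le> c"
    proof (intro allI impI iffI)
      fix c assume c: "c < n" "1 \<in> partial_ones n A c"
      show "i \<le> c"
      proof (rule ccontr)
        assume "\<not> i \<le> c"
        then have "1 \<in> partial_ones n A j" using one_mono'[of c j] c j by simp
        with * show False by simp
      qed
    next
      fix c assume "c < n" "i \<le> c"
      then show "1 \<in> partial_ones n A c" using one_mono'[of i c] * j by simp
    qed
  next
    assume *: "\<forall>c<n. 1 \<in> partial_ones n A c \<longleftrightarrow> i \<le> c"
    then have **: "1 \<in> partial_ones n A c \<longleftrightarrow> i \<le> c" if "c \<le> n" for c
      using that one_n i by (cases "c = n") auto
    have "A $$ (1, d) = of_bool (d = j)" if "d \<le> j" for d
      using e[of d] **[of d] **[of "Suc d"] that j by auto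
    then show "\<exists>c<2 * n + 1. i = Suc c \<and> A $$ (1, c) = 1 \<and> (\<forall>d<c. A $$ (1, d) \<noteq> 1)"
      using j by (intro exI[of _ j]) auto
  qed
qed

end

lemma chain_inj:
  assumes "vsasm n A" "vsasm n B" "chain n A = chain n B"
  shows "A = B"
proof -
  interpret A: vsasm n A by fact
  interpret B: vsasm n B by fact
  have S: "partial_ones n A c = partial_ones n B c" if "c \<le> n" for c
  proof (cases "c = n")
    case True then show ?thesis by (simp add: A.partial_ones_n B.partial_ones_n)
  next
    case False
    then have "chain n A ! (n - 1 - c) = sorted_ints (partial_ones n A c)" "chain n B ! (n - 1 - c) = sorted_ints (partial_ones n B c)"
      using that by (auto simp: chain_def)
    then have "sorted_ints (partial_ones n A c) = sorted_ints (partial_ones n B c)" using assms(3) by simp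
    then have "int ` partial_ones n A c = int ` partial_ones n B c" by (metis finite_partial_ones set_sorted_ints)
    then show ?thesis by (simp add: inj_image_eq_iff)
  qed
  have left: "A $$ (r, c) = B $$ (r, c)" if "r < 2 * n + 1" "c \<le> n" for r c
  proof (cases "c = n")
    case True then show ?thesis using A.middle[of r] B.middle[of r] S that by simp
  next
    case False
    then show ?thesis using A.entry_ind[of r c] B.entry_ind[of r c] S[of c] S[of "Suc c"] that by simp
  qed
  show ?thesis
  proof (rule eq_matI)
    fix r c assume "r < dim_row B" "c < dim_col B"
    then have rc: "r < 2 * n + 1" "c < 2 * n + 1" by auto
    show "A $$ (r, c) = B $$ (r, c)"
    proof (cases "c \<le> n")
      case False
      then show ?thesis using left[of r "2 * n - c"] A.mirror[of r c] B.mirror[of r c] rc by simp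
    qed (use left rc in simp)
  qed auto
qed

section \<open>Reconstructing the matrix from its triangle\<close>

definition chain_mat :: "nat \<Rightarrow> (nat \<Rightarrow> nat set) \<Rightarrow> int mat" where
  "chain_mat n S = mat (2 * n + 1) (2 * n + 1) (\<lambda>(r, c).
     if c < n then ind (S (Suc c)) r - ind (S c) r
     else if c = n then 1 - 2 * ind (S n) r
     else ind (S (Suc (2 * n - c))) r - ind (S (2 * n - c)) r)"

lemma chain_mat_vsasm:
  assumes S0: "S 0 = {}" and Sn: "S n = odds n"
    and sub: "\<And>c. c \<le> n \<Longrightarrow> S c \<subseteq> {..<2 * n + 1}"
    and il: "\<And>c. c < n \<Longrightarrow> sorted_ints (S c) \<in> interlace (sorted_ints (S (Suc c)))"
  shows "vsasm n (chain_mat n S)" "\<And>c. c \<le> n \<Longrightarrow> partial_ones n (chain_mat n S) c = S c"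
proof -
  let ?A = "chain_mat n S"
  have dims: "dim_row ?A = 2 * n + 1" "dim_col ?A = 2 * n + 1" by (auto simp: chain_mat_def)
  have e1: "?A $$ (r, c) = ind (S (Suc c)) r - ind (S c) r" if "r < 2 * n + 1" "c < n" for r c
    using that by (simp add: chain_mat_def)
  have e2: "?A $$ (r, n) = 1 - 2 * ind (S n) r" if "r < 2 * n + 1" for r
    using that by (simp add: chain_mat_def)
  have mirror: "?A $$ (r, 2 * n - c) = ?A $$ (r, c)" if "r < 2 * n + 1" "c < 2 * n + 1" for r c
    using that by (cases c n rule: linorder_cases) (auto simp: chain_mat_def)
  have ent: "?A $$ (r, c) \<in> {0, 1, -1}" if "r < 2 * n + 1" "c < 2 * n + 1" for r c
    using that by (auto simp: chain_mat_def)
  have ps: "(\<Sum>d<c. ?A $$ (r, d)) = ind (S c) r" if "r < 2 * n + 1" "c \<le> n" for r c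
    using that(2)
  proof (induction c)
    case (Suc c) then show ?case using e1[OF that(1), of c] by simp
  qed (simp add: S0)
  \<comment> \<open>Past the middle column the mirrored entries retrace the left half: the partial
    sums are the complements of the indicators of \<open>S n, S (n - 1), .., S 0\<close>.\<close>
  have ps2: "(\<Sum>d<n + 1 + e. ?A $$ (r, d)) = 1 - ind (S (n - e)) r" if "r < 2 * n + 1" "e \<le> n" for r e
    using that(2)
  proof (induction e)
    case 0 then show ?case using ps[OF that(1), of n] e2[OF that(1)] by simp
  next
    case (Suc e)
    have "?A $$ (r, n + 1 + e) = ?A $$ (r, 2 * n - (n + 1 + e))" using mirror[of r "n + 1 + e"] that Suc by simp
    also have "2 * n - (n + 1 + e) = n - Suc e" by simp
    also have "?A $$ (r, n - Suc e) = ind (S (n - e)) r - ind (S (n - Suc e)) r"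
      using e1[OF that(1), of "n - Suc e"] Suc by (simp add: Suc_diff_Suc)
    finally show ?case using Suc by simp
  qed
  have row: "alternating_sign_vec (row ?A r)" if r: "r < 2 * n + 1" for r
  proof -
    have s: "(\<Sum>d<c. row ?A r $ d) = (\<Sum>d<c. ?A $$ (r, d))" if "c \<le> 2 * n + 1" for c
      using that r dims by (intro sum.cong) auto
    have "(\<Sum>d<c. ?A $$ (r, d)) \<in> {0, 1}" if "c \<le> 2 * n + 1" for c
    proof (cases "c \<le> n")
      case False
      then have "c = n + 1 + (c - n - 1)" "c - n - 1 \<le> n" using that by auto
      then show ?thesis using ps2[OF r, of "c - n - 1"] by auto
    qed (use ps[OF r] in auto)
    then have "(\<Sum>d<c. row ?A r $ d) \<in> {0, 1}" if "c \<le> 2 * n + 1" for c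
      unfolding s[OF that] using that by blast
    moreover have "(\<Sum>d<2 * n + 1. row ?A r $ d) = 1"
    proof -
      have e: "n + 1 + n = 2 * n + 1" by simp
      have "(\<Sum>d<2 * n + 1. ?A $$ (r, d)) = 1 - ind (S (n - n)) r"
        using ps2[OF r order_refl] unfolding e .
      also have "\<dots> = 1" by (simp add: S0)
      finally show ?thesis unfolding s[OF order_refl] .
    qed
    moreover have dv: "dim_vec (row ?A r) = 2 * n + 1" using dims by simp
    moreover have "row ?A r $ d \<in> {0, 1, -1}" if "d < dim_vec (row ?A r)" for d
      using ent[OF r, of d] that dims r by simp
    ultimately show ?thesis by (subst alternating_sign_vec_iff) (simp_all only: dv, blast)
  qed
  have coln: "alternating_sign_vec (col ?A n)"
  proof -
    have s: "(\<Sum>a<r. col ?A n $ a) = (if odd r then 1 else 0)" if "r \<le> 2 * n + 1" for r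
      using that
    proof (induction r)
      case (Suc r)
      have "col ?A n $ r = 1 - 2 * ind (odds n) r" using Suc e2[of r] dims by (simp add: Sn)
      then show ?case using Suc by (auto simp: odds_def)
    qed simp
    have ent_n: "col ?A n $ r \<in> {0, 1, -1}" if "r < dim_vec (col ?A n)" for r using that dims ent by auto
    have dv: "dim_vec (col ?A n) = 2 * n + 1" using dims by simp
    have a: "(\<Sum>a<r. col ?A n $ a) \<in> {0, 1}" if "r \<le> 2 * n + 1" for r
      unfolding s[OF that] by simp
    have b: "(\<Sum>a<2 * n + 1. col ?A n $ a) = 1" unfolding s[OF order_refl] by simp
    have "(\<forall>r\<le>dim_vec (col ?A n). (\<Sum>a<r. col ?A n $ a) \<in> {0, 1}) \<and> (\<Sum>a<dim_vec (col ?A n). col ?A n $ a) = 1"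
      unfolding dv by (intro conjI allI impI a b)
    then show ?thesis by (rule alternating_sign_vec_iff[THEN iffD2, rotated]) (rule ent_n)
  qed
  have colc: "alternating_sign_vec (col ?A c)" if "c < n" for c
  proof (rule alternating_ind_iff[THEN iffD2])
    show "S c \<subseteq> {..<2 * n + 1}" "S (Suc c) \<subseteq> {..<2 * n + 1}" using that sub[of c] sub[of "Suc c"] by simp_all
    show "dim_vec (col ?A c) = 2 * n + 1" using dims by simp
    show "sorted_ints (S c) \<in> interlace (sorted_ints (S (Suc c)))" by (rule il[OF that])
    show "col ?A c $ r = ind (S (Suc c)) r - ind (S c) r" if "r < 2 * n + 1" for r
      using that \<open>c < n\<close> dims e1[OF that \<open>c < n\<close>] by simp
  qed
  have col: "alternating_sign_vec (col ?A c)" if "c < 2 * n + 1" for c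
  proof (cases c n rule: linorder_cases)
    case greater
    have "col ?A c = col ?A (2 * n - c)"
      using that mirror dims by (intro eq_vecI) auto
    moreover have "2 * n - c < n" using greater that by auto
    ultimately show ?thesis using colc by simp
  qed (simp_all add: colc coln)
  show "vsasm n ?A"
  proof
    show "?A \<in> carrier_mat (2 * n + 1) (2 * n + 1)" using dims by (rule carrier_matI)
    have "elements_mat ?A \<subseteq> {0, 1, -1}"
    proof
      fix x assume "x \<in> elements_mat ?A"
      then obtain r c where "r < 2 * n + 1" "c < 2 * n + 1" "x = ?A $$ (r, c)"
        by (metis elements_matD dims)
      then show "x \<in> {0, 1, -1}" using ent[of r c] by simp
    qed
    moreover have "?A $$ (r, 2 * n + 1 - 1 - c) = ?A $$ (r, c)" if "r < 2 * n + 1" "c < 2 * n + 1" for r c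
      using mirror[OF that] by simp
    ultimately show "is_VSASM ?A"
      unfolding is_VSASM_def is_ASM_def square_mat.simps dims by (intro conjI allI impI row col) simp_all
  qed
  fix c assume c: "c \<le> n"
  show "partial_ones n ?A c = S c"
    using ps[OF _ c] sub[OF c] by (auto simp: partial_ones_def split: if_splits)
qed

lemma chain_surj:
  assumes ch: "ch \<in> mt_chains n (odd_list n)"
  shows "\<exists>A. vsasm n A \<and> chain n A = ch"
proof -
  define S where "S = (\<lambda>c. if c < n then nat ` set (ch ! (n - 1 - c)) else odds n)"
  have len: "length ch = n" and il: "\<And>p. p < n \<Longrightarrow> ch ! p \<in> interlace ((odd_list n # ch) ! p)"
    using ch by (auto simp: mt_chains_iff)
  have inv: "p \<le> n \<Longrightarrow> sorted_wrt (<) ((odd_list n # ch) ! p) \<and> length ((odd_list n # ch) ! p) = n - p \<and>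
     (\<forall>x\<in>set ((odd_list n # ch) ! p). 0 \<le> x \<and> x < 2 * int n + 1)" for p
  proof (induction p)
    case 0 show ?case using sorted_odd_list by (auto simp: odd_list_def)
  next
    case (Suc p)
    then have IH: "sorted_wrt (<) ((odd_list n # ch) ! p)" "length ((odd_list n # ch) ! p) = n - p"
      "\<forall>x\<in>set ((odd_list n # ch) ! p). 0 \<le> x \<and> x < 2 * int n + 1" by auto
    have i: "ch ! p \<in> interlace ((odd_list n # ch) ! p)" using il Suc by simp
    have "sorted_wrt (<) (ch ! p)" by (rule interlace_sorted[OF i IH(1)])
    moreover have "length (ch ! p) = n - Suc p" using length_interlace[OF i] IH(2) by simp
    moreover have "0 \<le> x \<and> x < 2 * int n + 1" if "x \<in> set (ch ! p)" for x
      using interlace_bounds'(2,3)[OF i IH(1) that] IH(3) by force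
    ultimately show ?case by simp
  qed
  have nth_ch: "(odd_list n # ch) ! (n - c) = ch ! (n - 1 - c)" if "c < n" for c
  proof -
    have "n - c = Suc (n - 1 - c)" using that by simp
    then show ?thesis by (simp only: nth_Cons_Suc)
  qed
  have sl: "sorted_ints (S c) = (odd_list n # ch) ! (n - c)" if "c \<le> n" for c
  proof (cases "c = n")
    case True then show ?thesis by (simp add: S_def sorted_ints_odds)
  next
    case False
    have nth: "(odd_list n # ch) ! (n - c) = ch ! (n - 1 - c)" by (rule nth_ch) (use False that in simp)
    have "sorted_ints (nat ` set (ch ! (n - 1 - c))) = ch ! (n - 1 - c)"
      using inv[of "n - c"] unfolding nth by (intro sorted_ints_nat_set) auto
    then show ?thesis using False that by (simp add: S_def nth)
  qed
  have sub: "S c \<subseteq> {..<2 * n + 1}" if "c \<le> n" for c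
  proof (cases "c = n")
    case False
    have nth: "(odd_list n # ch) ! (n - c) = ch ! (n - 1 - c)" by (rule nth_ch) (use False that in simp)
    have "\<forall>x\<in>set (ch ! (n - 1 - c)). 0 \<le> x \<and> x < 2 * int n + 1"
      using inv[of "n - c"] unfolding nth by simp
    then show ?thesis using False that by (auto simp: S_def)
  qed (auto simp: S_def odds_def)
  have S0: "S 0 = {}"
  proof (cases n)
    case 0 then show ?thesis by (auto simp: S_def odds_def intro: odd_pos)
  next
    case (Suc m)
    have "length (sorted_ints (S 0)) = 0" using sl[of 0] inv[of n] by simp
    moreover have "finite (S 0)" using Suc by (auto simp: S_def)
    ultimately show ?thesis by simp
  qed
  have Sn: "S n = odds n" by (simp add: S_def)
  have ilS: "sorted_ints (S c) \<in> interlace (sorted_ints (S (Suc c)))" if "c < n" for c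
  proof -
    have "n - c = Suc (n - Suc c)" using that by simp
    then show ?thesis using il[of "n - Suc c"] sl[of c] sl[of "Suc c"] that by simp
  qed
  note A = chain_mat_vsasm[of S n, OF S0 Sn sub ilS]
  have "chain n (chain_mat n S) = ch"
  proof (rule nth_equalityI)
    fix p assume p: "p < length (chain n (chain_mat n S))"
    then have "chain n (chain_mat n S) ! p = sorted_ints (S (n - 1 - p))" using A(2) by (simp add: chain_def)
    also have "\<dots> = (odd_list n # ch) ! (n - (n - 1 - p))" by (rule sl) simp
    also have "n - (n - 1 - p) = Suc p" using p by (simp add: chain_def)
    finally show "chain n (chain_mat n S) ! p = ch ! p" by simp
  qed (simp add: chain_def len)
  with A(1) show ?thesis by blast
qed

lemma B_VSASM_trap_count:
  assumes n: "1 \<le> n" and i: "1 \<le> i" "i \<le> n"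
  shows "B_VSASM n i = trap_count (n - i) 2 (map (\<lambda>j. 2 * int j + 1) [1..<n])"
proof -
  let ?xs = "map (\<lambda>j. 2 * int j + 1) [1..<n]"
  have ol: "odd_list n = 1 # ?xs" unfolding odd_list_def using n by (simp add: upt_conv_Cons)
  have len: "n = Suc (length ?xs)" using n by simp
  let ?V = "{A \<in> carrier_mat (2 * n + 1) (2 * n + 1). is_VSASM A \<and>
     (\<exists>c<2 * n + 1. i = Suc c \<and> A $$ (1, c) = 1 \<and> (\<forall>d<c. A $$ (1, d) \<noteq> 1))}"
  let ?C = "{ch \<in> mt_chains n (odd_list n). \<forall>p\<le>length ?xs. 1 \<in> set (ch ! p) \<longleftrightarrow> p < n - i}"
  have cond: "(\<exists>c<2 * n + 1. i = Suc c \<and> A $$ (1, c) = 1 \<and> (\<forall>d<c. A $$ (1, d) \<noteq> 1)) \<longleftrightarrow>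
     (\<forall>p\<le>length ?xs. 1 \<in> set (chain n A ! p) \<longleftrightarrow> p < n - i)" if "vsasm n A" for A
  proof -
    have mem: "1 \<in> set (chain n A ! p) \<longleftrightarrow> 1 \<in> partial_ones n A (n - 1 - p)" if "p < n" for p
      using that by (auto simp: chain_def)
    \<comment> \<open>The chain runs backwards through the columns: position \<open>p\<close> stands
      for \<open>n - 1 - p\<close> columns, and \<open>i \<le> n - 1 - p\<close> is
      \<open>p < n - i\<close>.\<close>
    have "(\<forall>c<n. 1 \<in> partial_ones n A c \<longleftrightarrow> i \<le> c) \<longleftrightarrow> (\<forall>p<n. 1 \<in> partial_ones n A (n - 1 - p) \<longleftrightarrow> p < n - i)"
    proof
      assume *: "\<forall>c<n. (1 \<in> partial_ones n A c) = (i \<le> c)"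
      show "\<forall>p<n. (1 \<in> partial_ones n A (n - 1 - p)) = (p < n - i)"
      proof (intro allI impI)
        fix p assume p: "p < n"
        then have "(1 \<in> partial_ones n A (n - 1 - p)) = (i \<le> n - 1 - p)" using * by simp
        then show "(1 \<in> partial_ones n A (n - 1 - p)) = (p < n - i)" using p i by auto
      qed
    next
      assume *: "\<forall>p<n. (1 \<in> partial_ones n A (n - 1 - p)) = (p < n - i)"
      show "\<forall>c<n. (1 \<in> partial_ones n A c) = (i \<le> c)"
      proof (intro allI impI)
        fix c assume c: "c < n"
        then have "n - 1 - c < n" by simp
        with * have "(1 \<in> partial_ones n A (n - 1 - (n - 1 - c))) = (n - 1 - c < n - i)" by blast
        moreover have "n - 1 - (n - 1 - c) = c" using c by simp
        ultimately show "(1 \<in> partial_ones n A c) = (i \<le> c)" using c i by auto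
      qed
    qed
    also have "\<dots> \<longleftrightarrow> (\<forall>p\<le>length ?xs. 1 \<in> set (chain n A ! p) \<longleftrightarrow> p < n - i)"
      using mem len by (auto simp: less_Suc_eq_le)
    finally show ?thesis using vsasm.first_one_iff[OF that n i] by simp
  qed
  have "bij_betw (chain n) ?V ?C"
    unfolding bij_betw_def
  proof
    show "inj_on (chain n) ?V" by (auto simp: inj_on_def vsasm_def intro: chain_inj)
    show "chain n ` ?V = ?C"
    proof (intro equalityI subsetI)
      fix ch assume "ch \<in> chain n ` ?V"
      then obtain A where A: "vsasm n A" "A \<in> ?V" "ch = chain n A" by (auto simp: vsasm_def)
      then show "ch \<in> ?C" using cond[OF A(1)] vsasm.chain_in_mt_chains[OF A(1)] by auto
    next
      fix ch assume c: "ch \<in> ?C"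
      then have "ch \<in> mt_chains n (odd_list n)" by simp
      then obtain A where A: "vsasm n A" "chain n A = ch" using chain_surj by blast
      then have "A \<in> ?V" using cond[OF A(1)] c by (auto simp: vsasm_def)
      then show "ch \<in> chain n ` ?V" using A by auto
    qed
  qed
  then have "B_VSASM n i = card ?C" unfolding B_VSASM_def by (rule bij_betw_same_card)
  also have "?C = {ch \<in> mt_chains (Suc (length ?xs)) (1 # ?xs). \<forall>p\<le>length ?xs. 1 \<in> set (ch ! p) \<longleftrightarrow> p < n - i}"
    by (simp only: ol len[symmetric])
  also have "\<dots> = marked_chains (n - i) ?xs"
    using i n sorted_odd_list[of n] unfolding ol by (intro marked_chains_eq) auto
  finally show ?thesis by (simp add: card_marked_chains)
qed

section \<open>The closed formula\<close>

text \<open>\<open>(L + i) choose L\<close> is, up to sign, the binomial with upper index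
  \<open>- (L + 1)\<close> and lower index \<open>i\<close>, so the sum is a Vandermonde convolution
  with total upper index \<open>- 2 * (L + 1)\<close>.\<close>

lemma sum_binomial_product:
  "(\<Sum>i\<le>L. ((L + i) choose L) * ((2 * L - i) choose L)) = (3 * L + 1) choose L"
proof -
  have neg: "((- of_nat (L + 1)) gchoose i) = ((-1) ^ i * of_nat ((L + i) choose L) :: real)" for i
  proof -
    have "((- of_nat (L + 1)) gchoose i) = (-1) ^ i * ((of_nat i - (- of_nat (L + 1)) - 1) gchoose i :: real)"
      by (rule gbinomial_negated_upper)
    also have "(of_nat i - (- of_nat (L + 1)) - 1 :: real) = of_nat (L + i)" by simp
    also have "(of_nat (L + i) gchoose i :: real) = of_nat ((L + i) choose i)" by (rule binomial_gbinomial[symmetric])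
    also have "(L + i) choose i = (L + i) choose L" using binomial_symmetric[of i "L + i"] by simp
    finally show ?thesis .
  qed
  have "(-1) ^ L * real (\<Sum>i\<le>L. ((L + i) choose L) * ((2 * L - i) choose L)) =
    (\<Sum>i=0..L. ((- of_nat (L + 1)) gchoose i) * ((- of_nat (L + 1)) gchoose (L - i)))"
    unfolding neg of_nat_sum sum_distrib_left atLeast0AtMost
  proof (rule sum.cong[OF refl])
    fix i assume "i \<in> {..L}"
    then have "i \<le> L" by simp
    then have "L + (L - i) = 2 * L - i" "(-1) ^ L = ((-1) ^ i * (-1) ^ (L - i) :: real)"
      by (auto simp: power_add[symmetric])
    then show "(-1) ^ L * real (((L + i) choose L) * ((2 * L - i) choose L)) =
      (-1) ^ i * real ((L + i) choose L) * ((-1) ^ (L - i) * real ((L + (L - i)) choose L))"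
      by simp
  qed
  also have "\<dots> = (- of_nat (L + 1) + - of_nat (L + 1)) gchoose L" by (rule gbinomial_Vandermonde)
  also have "\<dots> = (-1) ^ L * ((of_nat L - (- of_nat (L + 1) + - of_nat (L + 1)) - 1) gchoose L)"
    by (rule gbinomial_negated_upper)
  also have "(of_nat L - (- of_nat (L + 1) + - of_nat (L + 1)) - 1 :: real) = of_nat (3 * L + 1)" by simp
  also have "(of_nat (3 * L + 1) gchoose L :: real) = of_nat ((3 * L + 1) choose L)"
    by (rule binomial_gbinomial[symmetric])
  finally have "real (\<Sum>i\<le>L. ((L + i) choose L) * ((2 * L - i) choose L)) = real ((3 * L + 1) choose L)"
    by (simp only: mult_cancel_left) simp
  then show ?thesis by (simp only: of_nat_eq_iff)
qed

text \<open>The terms are those of \<open>sum_binomial_product\<close> for the odd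
  \<open>L = 2 * m - 1\<close>. They are symmetric under replacing \<open>i\<close> by
  \<open>L - i\<close>, without a middle term, so the first \<open>m\<close> of them make up half
  the sum.\<close>

lemma half_sum_binomial_product:
  assumes "1 \<le> m"
  shows "2 * (\<Sum>i=1..m. ((2 * m + i - 2) choose (2 * m - 1)) * ((4 * m - i - 1) choose (2 * m - 1))) =
    (6 * m - 2) choose (2 * m - 1)"
proof -
  define L where "L = 2 * m - 1"
  let ?f = "\<lambda>i. ((L + i) choose L) * ((2 * L - i) choose L)"
  have s1: "(\<Sum>i=1..m. ((2 * m + i - 2) choose (2 * m - 1)) * ((4 * m - i - 1) choose (2 * m - 1))) = (\<Sum>i<m. ?f i)"
    by (rule sum.reindex_bij_witness[of _ Suc "\<lambda>i. i - 1"])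
       (auto simp: L_def intro!: arg_cong2[where f = "(*)"] arg_cong2[where f = "(choose)"])
  have s2: "(\<Sum>i\<in>{m..L}. ?f i) = (\<Sum>i<m. ?f i)"
  proof (rule sum.reindex_bij_witness[of _ "\<lambda>i. L - i" "\<lambda>i. L - i"])
    fix i assume "i \<in> {m..L}"
    then have "L + (L - i) = 2 * L - i" "2 * L - (L - i) = L + i" by auto
    then show "?f (L - i) = ?f i" by (simp only: mult.commute)
  qed (use assms in \<open>auto simp: L_def\<close>)
  have "{..L} = {..<m} \<union> {m..L}" using assms by (auto simp: L_def)
  then have s3: "(\<Sum>i\<le>L. ?f i) = (\<Sum>i<m. ?f i) + (\<Sum>i\<in>{m..L}. ?f i)"
    by (simp only:) (rule sum.union_disjoint; auto)
  have "2 * (\<Sum>i<m. ?f i) = (\<Sum>i\<le>L. ?f i)" unfolding s3 s2 by (rule mult_2)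
  also have "\<dots> = (3 * L + 1) choose L" by (rule sum_binomial_product)
  also have "3 * L + 1 = 6 * m - 2" using assms by (simp add: L_def)
  finally show ?thesis unfolding s1 unfolding L_def .
qed

section \<open>Relations between totals and refined counts\<close>

lemma trap_count_full: "length xs = j \<Longrightarrow> trap_count j k xs = mt_count j xs"
proof (induction j arbitrary: xs)
  case (Suc j)
  have "trap_count j k ls = mt_count j ls" if "ls \<in> interlace xs" for ls
    using length_interlace[OF that] Suc.prems by (intro Suc.IH) auto
  then show ?case by simp
qed simp

text \<open>The triangles over \<open>k # xs\<close> are sorted by the number \<open>j\<close> of
  further entries \<open>k\<close> on the left diagonal, the last \<open>k\<close> being raised to
  \<open>k + 1\<close>. An induction on the difference equation replaces the bijection.\<close>

lemma trap_count_sum: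
  "sorted_wrt (<) ((k + 1) # xs) \<Longrightarrow> trap_count 0 k xs = (\<Sum>j\<le>length xs. trap_count j (k + 1) xs)"
proof (induction "length xs" arbitrary: xs)
  case 0 then show ?case by simp
next
  case (Suc l)
  have s: "sorted_wrt (<) xs" "sorted_wrt (<) (k # xs)" using Suc.prems by auto
  have "complex_of_nat (trap_count 0 k xs) - of_nat (trap_count 0 (k + 1) xs) = of_nat (trap_count 1 k xs)"
    using trap_value_diff[OF s(1), of 0 k] trap_value_trap_count[OF s(2)] trap_value_trap_count[OF Suc.prems] by simp
  then have "complex_of_nat (trap_count 0 k xs) = of_nat (trap_count 0 (k + 1) xs + trap_count 1 k xs)"
    by (simp only: of_nat_add) (simp only: diff_eq_eq add.commute)
  then have "trap_count 0 k xs = trap_count 0 (k + 1) xs + trap_count 1 k xs" by (simp only: of_nat_eq_iff)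
  also have "trap_count 1 k xs = (\<Sum>ls\<in>interlace xs. \<Sum>j\<le>l. trap_count j (k + 1) ls)"
    unfolding One_nat_def trap_count.simps(2)
  proof (rule sum.cong[OF refl])
    fix ls assume ls: "ls \<in> interlace xs"
    have "k + 1 < x" if "x \<in> set ls" for x
      using interlace_bounds'(3)[OF ls s(1) that] Suc.prems by auto
    then have "sorted_wrt (<) ((k + 1) # ls)" using interlace_sorted[OF ls s(1)] by simp
    moreover have "l = length ls" using length_interlace[OF ls] Suc.hyps by simp
    ultimately show "trap_count 0 k ls = (\<Sum>j\<le>l. trap_count j (k + 1) ls)" using Suc.hyps(1)[of ls] by simp
  qed
  also have "\<dots> = (\<Sum>j\<le>l. trap_count (Suc j) (k + 1) xs)" by (subst sum.swap) simp
  also have "trap_count 0 (k + 1) xs + \<dots> = (\<Sum>j\<le>length xs. trap_count j (k + 1) xs)"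
    unfolding Suc.hyps(2)[symmetric] by (simp only: sum.atMost_Suc_shift)
  finally show ?case .
qed

definition vsasm_total :: "nat \<Rightarrow> nat" where "vsasm_total m = mt_count m (odd_list m)"

text \<open>For \<open>i = 1\<close> the left diagonal consists of 1 throughout; deleting it leaves
  a triangle over \<open>3, 5, .., 2 * m + 1\<close>, a translate of
  \<open>odd_list m\<close>.\<close>

lemma B_first: "B_VSASM (Suc m) 1 = vsasm_total m"
proof -
  have "map (\<lambda>j. 2 * int j + 1) [1..<Suc m] = map (\<lambda>x. x + 2) (odd_list m)"
    unfolding odd_list_def One_nat_def map_Suc_upt[symmetric] by simp
  then have "B_VSASM (Suc m) 1 = trap_count m 2 (map (\<lambda>x. x + 2) (odd_list m))"
    using B_VSASM_trap_count[of "Suc m" 1] by (simp del: upt_Suc)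
  also have "\<dots> = mt_count m (map (\<lambda>x. x + 2) (odd_list m))" by (rule trap_count_full) (simp add: odd_list_def)
  finally show ?thesis by (simp add: vsasm_total_def mt_count_shift)
qed

lemma B_sum:
  assumes "1 \<le> m"
  shows "vsasm_total m = (\<Sum>i=1..m. B_VSASM m i)"
proof -
  let ?xs = "map (\<lambda>j. 2 * int j + 1) [1..<m]"
  have ol: "odd_list m = 1 # ?xs" unfolding odd_list_def using assms by (simp add: upt_conv_Cons)
  have len: "Suc (length ?xs) = m" using assms by simp
  have "vsasm_total m = trap_count 0 1 ?xs" unfolding vsasm_total_def trap_count.simps len ol ..
  also have "\<dots> = (\<Sum>j\<le>length ?xs. trap_count j (1 + 1) ?xs)"
    by (rule trap_count_sum) (auto simp: sorted_wrt_iff_nth_less nth_Cons split: nat.splits)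
  also have "\<dots> = (\<Sum>i=1..m. trap_count (m - i) 2 ?xs)"
    by (rule sum.reindex_bij_witness[of _ "\<lambda>i. m - i" "\<lambda>j. m - j"]) (use assms in auto)
  also have "\<dots> = (\<Sum>i=1..m. B_VSASM m i)"
    by (rule sum.cong) (auto simp: B_VSASM_trap_count)
  finally show ?thesis .
qed

section \<open>Ratios of the refined counts for a fixed order\<close>

context
  fixes n :: nat
  assumes R_inverse: "\<And>z :: nat \<Rightarrow> complex. z \<in> R_domain n n \<Longrightarrow> R n n z = R n n (\<lambda>k. inverse (z k))"
    and n: "1 \<le> n"
begin

abbreviation (input) X where "X \<equiv> map (\<lambda>j. 2 * int j - int n) [1..<n]"

lemma B_trap_value:
  assumes "1 \<le> i" "i \<le> n"
  shows "trap_value (n - i) (1 - int n) X = of_nat (B_VSASM n i)"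
proof -
  have X: "X = map (\<lambda>x. x + (- int n - 1)) (map (\<lambda>j. 2 * int j + 1) [1..<n])" by simp
  have "sorted_wrt (<) ((1 - int n) # X)"
    by (auto simp: sorted_wrt_iff_nth_less nth_Cons split: nat.splits)
  then have "trap_value (n - i) (1 - int n) X = of_nat (trap_count (n - i) (1 - int n) X)" by (rule trap_value_trap_count)
  also have "trap_count (n - i) (1 - int n) X = trap_count (n - i) 2 (map (\<lambda>j. 2 * int j + 1) [1..<n])"
    using trap_count_shift[of "n - i" 2 "- int n - 1" "map (\<lambda>j. 2 * int j + 1) [1..<n]"] unfolding X by simp
  finally show ?thesis using B_VSASM_trap_count[OF n assms] by simp
qed

text \<open>Indexed from 0 so that entry \<open>m\<close> can be the value at 0 of row
  \<open>m\<close> of \<open>newton_sum\<close>. The second half is postulated as the mirror image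
  of the first; \<open>row_fun_newton_sum\<close> justifies it.\<close>

definition B_seq :: "int \<Rightarrow> complex" where
  "B_seq m = (if 0 \<le> m \<and> m < int n then of_nat (B_VSASM n (Suc (nat m)))
    else if int n \<le> m \<and> m < 2 * int n then of_nat (B_VSASM n (2 * n - nat m)) else 0)"

lemma palindrome_B_seq: "palindrome (2 * n - 1) B_seq"
proof
  show "odd (2 * n - 1)" using n by simp
  show "B_seq (int (2 * n - 1) - i) = B_seq i" for i
    using n unfolding B_seq_def
    by (auto simp: of_nat_diff intro!: arg_cong[where f = "B_VSASM n"])
qed (simp add: B_seq_def)

interpretation palindrome "2 * n - 1" B_seq by (rule palindrome_B_seq)

text \<open>The argument is shifted so that \<open>k = 0\<close> is the first entry
  \<open>1 - n\<close> of \<open>B_trap_value\<close>. The two families fit together because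
  \<open>Psi n 0\<close> is \<open>trap_value 0\<close>, the row \<open>n - 1\<close>.\<close>

definition row_fun :: "nat \<Rightarrow> int \<Rightarrow> complex" where
  "row_fun m k = (if m < n then trap_value (n - 1 - m) (k + 1 - int n) X else Psi n (Suc m - n) (k + 1 - int n))"

lemma row_fun_newton_sum: "m \<le> 2 * n - 1 \<Longrightarrow> row_fun m k = newton_sum B_seq m k"
proof (rule newton_sum_unique[where M = "2 * n - 1"])
  fix k
  have "trap_value (n - 1) (k + 1 - int n) X - trap_value (n - 1) (k + 1 - int n + 1) X = trap_value (Suc (n - 1)) (k + 1 - int n) X"
    by (rule trap_value_diff[OF sorted_X])
  also have "\<dots> = 0" by (rule trap_value_0) (use n in simp)
  finally have "trap_value (n - 1) (k + 1 - int n) X = trap_value (n - 1) (k + 1 - int n + 1) X" by simp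
  moreover have "k + 1 + 1 - int n = k + 1 - int n + 1" "0 < n" using n by auto
  ultimately show "row_fun 0 k = row_fun 0 (k + 1)" by (simp only: row_fun_def if_True diff_zero)
next
  fix m k assume "m < 2 * n - 1"
  have k: "k + 1 + 1 - int n = (k + 1 - int n) + 1" by simp
  consider "Suc m < n" | "Suc m = n" | "n \<le> m" by linarith
  then show "row_fun (Suc m) k - row_fun (Suc m) (k + 1) = row_fun m k"
  proof cases
    case 1
    then have "n - 1 - m = Suc (n - 1 - Suc m)" by simp
    then show ?thesis using 1 trap_value_diff[OF sorted_X, of "n - 1 - Suc m" "k + 1 - int n" n] by (simp only: row_fun_def k) simp
  next
    case 2
    then have "n - 1 - m = 0" "Suc (Suc m) - n = Suc 0" "m < n" "\<not> Suc m < n" by auto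
    then show ?thesis using Psi_diff[of n 0 "k + 1 - int n"] Psi_0[of n] by (simp only: row_fun_def k if_True if_False)
  next
    case 3
    then have "Suc (Suc m) - n = Suc (Suc m - n)" "\<not> m < n" "\<not> Suc m < n" by auto
    then show ?thesis using Psi_diff[of n "Suc m - n" "k + 1 - int n"] by (simp only: row_fun_def k if_False)
  qed
next
  fix m assume m: "m \<le> 2 * n - 1"
  show "\<exists>x. row_fun m x = newton_sum B_seq m x"
  proof (cases "m < n")
    case True
    then have "row_fun m 0 = B_seq (int m)"
      using B_trap_value[of "Suc m"] by (simp add: row_fun_def B_seq_def)
    then show ?thesis by (intro exI[of _ 0]) (simp only: newton_sum_at_0)
  next
    case False
    have e: "Suc m - n = Suc (m - n)" "2 * int m - int (2 * n - 1) + 1 - int n = 2 * int (m - n) - int n + 2"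
      using False n by (auto simp: of_nat_diff)
    \<comment> \<open>For \<open>m \<ge> n\<close> no value at 0 is known beforehand; the row is
      matched at the zero that \<open>Psi_zero\<close> and the palindrome have in common.\<close>
    have "row_fun m (2 * int m - int (2 * n - 1)) = 0"
      using False Psi_zero[of n "m - n"] by (simp only: row_fun_def if_False e)
    moreover have "newton_sum B_seq m (2 * int m - int (2 * n - 1)) = 0"
      by (rule newton_sum_zero) (use False in simp)
    ultimately show ?thesis by metis
  qed
qed

text \<open>\<open>P n n\<close> has the odd number \<open>2 * n - 1\<close> of variables, whence
  the minus sign.\<close>

lemma newton_sum_reflect: "newton_sum B_seq (2 * n - 1) x = - newton_sum B_seq (2 * n - 1) (2 * int (2 * n - 1) - x)"
proof -
  have N: "2 * n - 1 = length (P_factors n n)" using n by (simp add: length_gs)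
  have row: "newton_sum B_seq (2 * n - 1) y = Psi n n (y + 1 - int n)" for y
  proof -
    have "\<not> 2 * n - 1 < n" "Suc (2 * n - 1) - n = n" using n by auto
    then show ?thesis using row_fun_newton_sum[of "2 * n - 1" y] by (simp only: row_fun_def if_False order_refl)
  qed
  have "Psi n n (x + 1 - int n) = (-1) ^ (2 * n - 1) * Psi n n (int (2 * n - 1) + 1 - (x + 1 - int n))"
    by (rule Psi_refl[OF N]) (rule symsum_inverse[OF R_inverse n], (assumption | simp only: N)+)
  also have "(-1) ^ (2 * n - 1) = (-1 :: complex)" using n by (intro power_minus_odd[of _ 1, simplified]) simp
  also have "int (2 * n - 1) + 1 - (x + 1 - int n) = (2 * int (2 * n - 1) - x) + 1 - int n"
    using n by (simp add: of_nat_diff)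
  finally show ?thesis unfolding row by simp
qed

lemma B_VSASM_ratio:
  assumes "1 \<le> i" "i \<le> n"
  shows "((4 * n - 2) choose (2 * n - 1)) * B_VSASM n i =
    B_VSASM n 1 * (((2 * n + i - 2) choose (2 * n - 1)) * ((4 * n - i - 1) choose (2 * n - 1)))"
proof -
  have "of_nat ((2 * (2 * n - 1)) choose (2 * n - 1)) * B_seq (int (i - 1)) = B_seq 0 *
    of_nat (((2 * n - 1 + (i - 1)) choose (2 * n - 1)) * ((2 * (2 * n - 1) - (i - 1)) choose (2 * n - 1)))"
    by (rule solution[OF newton_sum_reflect]) (use assms in simp)
  moreover have "Suc (nat (int (i - 1))) = i" "0 \<le> int (i - 1)" "int (i - 1) < int n"
    using assms by (auto simp only: nat_int)
  then have "B_seq (int (i - 1)) = of_nat (B_VSASM n i)" by (simp only: B_seq_def simp_thms if_True)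
  moreover have "B_seq 0 = of_nat (B_VSASM n 1)" using n by (simp add: B_seq_def)
  moreover have "2 * (2 * n - 1) = 4 * n - 2" "2 * n - 1 + (i - 1) = 2 * n + i - 2"
    "4 * n - 2 - (i - 1) = 4 * n - i - 1" using assms n by auto
  ultimately have "complex_of_nat (((4 * n - 2) choose (2 * n - 1)) * B_VSASM n i) =
    of_nat (B_VSASM n 1 * (((2 * n + i - 2) choose (2 * n - 1)) * ((4 * n - i - 1) choose (2 * n - 1))))"
    by (simp only: of_nat_mult)
  then show ?thesis by (simp only: of_nat_eq_iff)
qed

end

text \<open>Summing \<open>ratio\<close> over \<open>i\<close> turns the right-hand side into half
  of a single binomial coefficient, and \<open>B_VSASM m 1\<close> is the previous total. So the
  factor is \<open>((6 * m - 2) choose (2 * m - 1))\<close> divided by twice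
  \<open>((4 * m - 2) choose (2 * m - 1))\<close>.\<close>

lemma vsasm_total_ratio:
  assumes "1 \<le> m"
    and ratio: "\<And>i. 1 \<le> i \<Longrightarrow> i \<le> m \<Longrightarrow> ((4 * m - 2) choose (2 * m - 1)) * B_VSASM m i =
    B_VSASM m 1 * (((2 * m + i - 2) choose (2 * m - 1)) * ((4 * m - i - 1) choose (2 * m - 1)))"
  shows "real (vsasm_total m) = real (vsasm_total (m - 1)) *
     (real (3 * m - 1) * fact (2 * m - 1) * fact (6 * m - 3) / (fact (4 * m - 2) * fact (4 * m - 1)))"
proof -
  have "((4 * m - 2) choose (2 * m - 1)) * vsasm_total m =
     B_VSASM m 1 * (\<Sum>i=1..m. ((2 * m + i - 2) choose (2 * m - 1)) * ((4 * m - i - 1) choose (2 * m - 1)))"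
    unfolding B_sum[OF assms(1)] sum_distrib_left by (rule sum.cong[OF refl], rule ratio) simp_all
  then have "2 * (((4 * m - 2) choose (2 * m - 1)) * vsasm_total m) =
     B_VSASM m 1 * (2 * (\<Sum>i=1..m. ((2 * m + i - 2) choose (2 * m - 1)) * ((4 * m - i - 1) choose (2 * m - 1))))"
    by (simp only: mult.left_commute)
  then have "2 * (((4 * m - 2) choose (2 * m - 1)) * vsasm_total m) = vsasm_total (m - 1) * ((6 * m - 2) choose (2 * m - 1))"
    unfolding half_sum_binomial_product[OF assms(1)] using B_first[of "m - 1"] assms(1) by simp
  then have eq: "2 * (real ((4 * m - 2) choose (2 * m - 1)) * real (vsasm_total m)) =
     real (vsasm_total (m - 1)) * real ((6 * m - 2) choose (2 * m - 1))"
    by (metis of_nat_mult of_nat_numeral)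
  have 1: "4 * m - 2 - (2 * m - 1) = 2 * m - 1" "6 * m - 2 - (2 * m - 1) = 4 * m - 1"
    "2 * m - 1 \<le> 4 * m - 2" "2 * m - 1 \<le> 6 * m - 2" using assms(1) by auto
  have c1: "real ((4 * m - 2) choose (2 * m - 1)) = fact (4 * m - 2) / (fact (2 * m - 1) * fact (2 * m - 1))"
    using binomial_fact[OF 1(3), where ?'a = real] by (simp only: 1)
  have c2: "real ((6 * m - 2) choose (2 * m - 1)) = fact (6 * m - 2) / (fact (2 * m - 1) * fact (4 * m - 1))"
    using binomial_fact[OF 1(4), where ?'a = real] by (simp only: 1)
  \<comment> \<open>The 2 of the halved sum cancels against
    \<open>6 * m - 2 = 2 * (3 * m - 1)\<close>, which leaves the factor \<open>3 * m - 1\<close> of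
    the product formula.\<close>
  have "6 * m - 2 = Suc (6 * m - 3)" "real (6 * m - 2) = 2 * real (3 * m - 1)" using assms(1) by (auto simp: of_nat_diff)
  then have c3: "(fact (6 * m - 2) :: real) = 2 * real (3 * m - 1) * fact (6 * m - 3)"
    by (metis fact_Suc)
  define a b c d e where "a = (fact (4 * m - 2) :: real)" and "b = (fact (2 * m - 1) :: real)"
    and "c = (fact (4 * m - 1) :: real)" and "d = (fact (6 * m - 3) :: real)" and "e = real (3 * m - 1)"
  have pos: "a > 0" "b > 0" "c > 0" by (simp_all add: a_def b_def c_def)
  have "2 * (a / (b * b) * real (vsasm_total m)) = real (vsasm_total (m - 1)) * (2 * e * d / (b * c))"
    using eq unfolding c1 c2 c3 a_def b_def c_def d_def e_def .
  then have "real (vsasm_total m) = real (vsasm_total (m - 1)) * (e * b * d / (a * c))"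
    using pos by (simp add: field_simps)
  then show ?thesis by (simp only: a_def b_def c_def d_def e_def)
qed

theorem theorem1p2:
  assumes R_inverse: "\<And>s t (z :: nat \<Rightarrow> complex). 1 \<le> s \<Longrightarrow> s \<le> t \<Longrightarrow> z \<in> R_domain s t \<Longrightarrow>
      R s t z = R s t (\<lambda>k. inverse (z k))"
    and n: "1 \<le> n"
    and i: "1 \<le> i" "i \<le> n"
  shows "real (B_VSASM n i) =
      real ((2 * n + i - 2) choose (2 * n - 1)) * real ((4 * n - i - 1) choose (2 * n - 1))
        / real ((4 * n - 2) choose (2 * n - 1)) *
      (\<Prod>j = 1..n - 1. real (3 * j - 1) * fact (2 * j - 1) * fact (6 * j - 3)
        / (fact (4 * j - 2) * fact (4 * j - 1)))"
proof -
  have ratio: "((4 * m - 2) choose (2 * m - 1)) * B_VSASM m i =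
    B_VSASM m 1 * (((2 * m + i - 2) choose (2 * m - 1)) * ((4 * m - i - 1) choose (2 * m - 1)))"
    if "1 \<le> m" "1 \<le> i" "i \<le> m" for m i
    by (rule B_VSASM_ratio) (use that R_inverse[of m m] in auto)
  have T: "real (vsasm_total m) = (\<Prod>j = 1..m. real (3 * j - 1) * fact (2 * j - 1) * fact (6 * j - 3)
        / (fact (4 * j - 2) * fact (4 * j - 1)))" for m
  proof (induction m)
    case 0 show ?case by (simp add: vsasm_total_def)
  next
    case (Suc m)
    have "real (vsasm_total (Suc m)) = real (vsasm_total m) * (real (3 * Suc m - 1) * fact (2 * Suc m - 1) * fact (6 * Suc m - 3)
        / (fact (4 * Suc m - 2) * fact (4 * Suc m - 1)))"
      using vsasm_total_ratio[OF _ ratio, of "Suc m"] by (simp only: diff_Suc_1)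
    moreover have le: "1 \<le> Suc m" by simp
    ultimately show ?case unfolding prod.nat_ivl_Suc'[OF le] Suc.IH[symmetric] by (subst mult.commute)
  qed
  have "real ((4 * n - 2) choose (2 * n - 1)) * real (B_VSASM n i) =
    real (B_VSASM n 1) * (real ((2 * n + i - 2) choose (2 * n - 1)) * real ((4 * n - i - 1) choose (2 * n - 1)))"
    using ratio[OF n i] by (metis of_nat_mult)
  moreover have "B_VSASM n 1 = vsasm_total (n - 1)" using B_first[of "n - 1"] n by simp
  moreover have "real ((4 * n - 2) choose (2 * n - 1)) > 0" by simp
  ultimately show ?thesis unfolding T[symmetric] by (simp add: field_simps)
qed

end
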